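(* Let $\mathbb G$ be a finite semicomplete digraph. Then $\mathbb G$ is (1) isomorphic to $\mathbb T_n$ for some $n\geq 1$, (2) isomorphic to $\mathbb C^{n,k}_2$ for some $n,k\geq 0$, (3) isomorphic to $\mathbb C^{n,k}_3$ for some $n,k\geq 0$, or (4) in the same pp-constructability class as $\mathbb K_3$.
   Context: A digraph is a structure with one binary relation (its edge relation). A digraph is semicomplete if any two nodes in it are connected by either a directed or an undirected edge (an undirected edge between $u$ and $v$ meaning that both $(u,v)$ and $(v,u)$ are edges). $\mathbb T_n$ is the transitive tournament $(\{0,\dots,n-1\},\{(i,j)\mid 0\leq i<j<n\})$. $\mathbb K_3$ is the complete graph on three vertices. Let $f$ be the map sending $a,b,c$ to $0$ and each integer to itself. For $n,k\geq 0$: $\mathbb C^{n,k}_2$ is the digraph with vertices $-n,\dots,-1,a,b,1,\dots,k$, an edge from $u$ to $v$ whenever $f(u)<f(v)$, and additionally the edges $(a,b),(b,a)$; $\mathbb C^{n,k}_3$ is the digraph with vertices $-n,\dots,-1,a,b,c,1,\dots,k$, an edge from $u$ to $v$ whenever $f(u)<f(v)$, and additionally the edges $(a,b),(b,c),(c,a)$. Structures have nonempty domains. A primitive positive (pp) formula is a first-order formula built from atomic formulas $R(x_1,\dots,x_n)$, $x\approx y$, and the always-false formula $\bot$ using only conjunction and existential quantification. A structure is a pp-power of $\mathbb A$ if it is isomorphic to a structure with domain $A^n$ for some $n\geq 1$ whose relations are pp-definable in $\mathbb A$ (a $k$-ary relation on $A^n$ being regarded as a $kn$-ary relation on $A$).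 $\mathbb A\leq\mathbb B$ means that $\mathbb B$ is homomorphically equivalent to a pp-power of $\mathbb A$; $\mathbb A$ and $\mathbb B$ are in the same pp-constructability class if $\mathbb A\leq\mathbb B$ and $\mathbb B\leq\mathbb A$.
   Formalization: Semicomplete digraphs are taken to have no loops; a single vertex with a loop would otherwise be a counterexample, and all four alternatives fail for every digraph with a loop. *)

theory Defs
  imports Main
begin

text \<open>
  The relation symbols are the elements of the type \<open>'r\<close>,
  and a relation is a set of argument lists.
\<close>

record ('r, 'a) rel_structure =
  universe :: "'a set"
  arity :: "'r \<Rightarrow> nat"
  rel :: "'r \<Rightarrow> 'a list set"

definition is_struct :: "('r, 'a) rel_structure \<Rightarrow> bool" where
  "is_struct A \<longleftrightarrow> universe A \<noteq> {} \<and>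
     (\<forall>r. rel A r \<subseteq> {xs. length xs = arity A r \<and> set xs \<subseteq> universe A})"

definition is_hom :: "('a \<Rightarrow> 'b) \<Rightarrow> ('r, 'a) rel_structure \<Rightarrow> ('r, 'b) rel_structure \<Rightarrow> bool" where
  "is_hom h A B \<longleftrightarrow> h ` universe A \<subseteq> universe B \<and> (\<forall>r. \<forall>xs \<in> rel A r. map h xs \<in> rel B r)"

definition hom_equiv :: "('r, 'a) rel_structure \<Rightarrow> ('r, 'b) rel_structure \<Rightarrow> bool" where
  "hom_equiv A B \<longleftrightarrow> arity A = arity B \<and> (\<exists>h. is_hom h A B) \<and> (\<exists>h. is_hom h B A)"

definition isomorphic :: "('r, 'a) rel_structure \<Rightarrow> ('r, 'b) rel_structure \<Rightarrow> bool" where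
  "isomorphic A B \<longleftrightarrow> arity A = arity B \<and>
     (\<exists>h. bij_betw h (universe A) (universe B) \<and>
        (\<forall>r. \<forall>xs \<in> lists (universe A). xs \<in> rel A r \<longleftrightarrow> map h xs \<in> rel B r))"

text \<open>
  Primitive positive formulas with variables named by natural numbers. An atom with
  the wrong number of arguments is false in every structure, i.e. equivalent to
  \<open>Bot\<close>, so such atoms need not be excluded.
\<close>

datatype 'r pp =
    Bot
  | Eq nat nat
  | Atom 'r "nat list"
  | And "'r pp" "'r pp"
  | Ex nat "'r pp"

primrec fv :: "'r pp \<Rightarrow> nat set" where
  "fv Bot = {}"
| "fv (Eq x y) = {x, y}"
| "fv (Atom r xs) = set xs"
| "fv (And p q) = fv p \<union> fv q"
| "fv (Ex x p) = fv p - {x}"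

primrec sat :: "('r, 'a) rel_structure \<Rightarrow> (nat \<Rightarrow> 'a) \<Rightarrow> 'r pp \<Rightarrow> bool" where
  "sat A s Bot \<longleftrightarrow> False"
| "sat A s (Eq x y) \<longleftrightarrow> s x = s y"
| "sat A s (Atom r xs) \<longleftrightarrow> map s xs \<in> rel A r"
| "sat A s (And p q) \<longleftrightarrow> sat A s p \<and> sat A s q"
| "sat A s (Ex x p) \<longleftrightarrow> (\<exists>a \<in> universe A. sat A (s(x := a)) p)"

text \<open>
  The free variables are among \<open>0, \<dots>, m - 1\<close>, so the values of \<open>nth xs\<close> beyond the
  length \<open>m\<close> of \<open>xs\<close> are irrelevant.
\<close>

definition pp_definable :: "('r, 'a) rel_structure \<Rightarrow> nat \<Rightarrow> 'a list set \<Rightarrow> bool" where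
  "pp_definable A m R \<longleftrightarrow>
     (\<exists>p. fv p \<subseteq> {..<m} \<and> R = {xs. length xs = m \<and> set xs \<subseteq> universe A \<and> sat A (nth xs) p})"

text \<open>
  Elements of the \<open>n\<close>-th power are lists of length \<open>n\<close>; \<open>concat\<close> turns a \<open>k\<close>-ary relation
  on them into a relation of arity \<open>k * n\<close> on the base structure.
\<close>

definition is_power_struct :: "nat \<Rightarrow> ('r, 'a) rel_structure \<Rightarrow> ('s, 'a list) rel_structure \<Rightarrow> bool" where
  "is_power_struct n A P \<longleftrightarrow> is_struct P \<and>
     universe P = {xs. length xs = n \<and> set xs \<subseteq> universe A} \<and>
     (\<forall>r. pp_definable A (arity P r * n) (concat ` rel P r))"

definition is_pp_power :: "('r, 'a) rel_structure \<Rightarrow> ('s, 'b) rel_structure \<Rightarrow> bool" where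
  "is_pp_power A B \<longleftrightarrow> (\<exists>n \<ge> 1. \<exists>P. is_power_struct n A P \<and> isomorphic B P)"

text \<open>
  Every pp-power of \<open>A\<close> has an isomorphic copy whose elements are lists over \<open>A\<close>, so
  letting \<open>C\<close> range over structures on the type \<open>'a list\<close> loses nothing.
\<close>

definition pp_constructs :: "('r, 'a) rel_structure \<Rightarrow> ('s, 'b) rel_structure \<Rightarrow> bool" where
  "pp_constructs A B \<longleftrightarrow>
     (\<exists>C :: ('s, 'a list) rel_structure. is_struct C \<and> is_pp_power A C \<and> hom_equiv B C)"

definition same_pp_class :: "('r, 'a) rel_structure \<Rightarrow> ('s, 'b) rel_structure \<Rightarrow> bool" where
  "same_pp_class A B \<longleftrightarrow> pp_constructs A B \<and> pp_constructs B A"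

type_synonym 'a dgraph = "(unit, 'a) rel_structure"

definition is_digraph :: "'a dgraph \<Rightarrow> bool" where
  "is_digraph G \<longleftrightarrow> is_struct G \<and> arity G = (\<lambda>_. 2)"

definition edge :: "'a dgraph \<Rightarrow> 'a \<Rightarrow> 'a \<Rightarrow> bool" where
  "edge G u v \<longleftrightarrow> [u, v] \<in> rel G ()"

definition digraph_of :: "'a set \<Rightarrow> ('a \<times> 'a) set \<Rightarrow> 'a dgraph" where
  "digraph_of V E = \<lparr>universe = V, arity = (\<lambda>_. 2), rel = (\<lambda>_. {[u, v] | u v. (u, v) \<in> E})\<rparr>"

text \<open>
  As is standard, semicomplete digraphs have no loops. A single vertex with a loop would
  otherwise be a counterexample to the classification.
\<close>

definition semicomplete :: "'a dgraph \<Rightarrow> bool" where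
  "semicomplete G \<longleftrightarrow> (\<forall>u \<in> universe G. \<not> edge G u u) \<and>
     (\<forall>u \<in> universe G. \<forall>v \<in> universe G. u \<noteq> v \<longrightarrow> edge G u v \<or> edge G v u)"

definition transitive_tournament :: "nat \<Rightarrow> nat dgraph" where
  "transitive_tournament n = digraph_of {..<n} {(i, j). i < j \<and> j < n}"

definition K3 :: "nat dgraph" where
  "K3 = digraph_of {..<3} {(i, j). i < 3 \<and> j < 3 \<and> i \<noteq> j}"

text \<open>
  \<open>level\<close> is the map \<open>f\<close> sending \<open>a, b, c\<close> to \<open>0\<close> and fixing integers. The integer \<open>0\<close>
  itself is not a vertex of the digraphs below.
\<close>

datatype cvertex = VA | VB | VC | Num int

fun level :: "cvertex \<Rightarrow> int" where
  "level (Num i) = i"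
| "level _ = 0"

definition C_verts :: "cvertex set \<Rightarrow> nat \<Rightarrow> nat \<Rightarrow> cvertex set" where
  "C_verts S n k = Num ` {- int n..-1} \<union> S \<union> Num ` {1..int k}"

definition C2 :: "nat \<Rightarrow> nat \<Rightarrow> cvertex dgraph" where
  "C2 n k = digraph_of (C_verts {VA, VB} n k)
     ({(u, v). u \<in> C_verts {VA, VB} n k \<and> v \<in> C_verts {VA, VB} n k \<and> level u < level v}
       \<union> {(VA, VB), (VB, VA)})"

definition C3 :: "nat \<Rightarrow> nat \<Rightarrow> cvertex dgraph" where
  "C3 n k = digraph_of (C_verts {VA, VB, VC} n k)
     ({(u, v). u \<in> C_verts {VA, VB, VC} n k \<and> v \<in> C_verts {VA, VB, VC} n k \<and> level u < level v}
       \<union> {(VA, VB), (VB, VC), (VC, VA)})"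

end

(*
A digraph G pp-constructs B as soon as there is a map from the polymorphisms of G to their
coordinates that is compatible with taking minors. A loopless semicomplete digraph is a core, so
its polymorphisms can be made idempotent, and invariant sets and relations can then be defined
from E using constants. The union of all subdigraphs without sources and sinks is invariant; if
it is empty or a directed cycle, G is one of the three exceptions. Otherwise some vertex in it
has two out-neighbours. Choose an invariant set with an invariant semicomplete digraph of this
kind having as few vertices as possible. By minimality every proper invariant subset contains at
most one cycle, which restricts the digraph so much that either it has three vertices, or its
first and last strong components are distinct and are directed cycles. In both cases the sets of coordinates that
decide the value of an operation form an ultrafilter, which is principal and gives the coordinate.
K3 is itself an instance, and so pp-constructs G.
*)

theory Submission
  imports Defs
begin

section \<open>Smooth and branching digraphs\<close>

text \<open>Minimality ranges over all invariant relations on invariant subsets, not only over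
  restrictions of \<open>E\<close>. A proper invariant set is therefore refuted in two ways: by two
  different smooth subsets of it, or by an invariant relation that is loopless and total on it and
  branches on a smooth subset. Neighbourhoods of a vertex are the basic supply of such sets: they
  are invariant because the operations fix singletons, and proper because there are no loops. One
  obstacle is that a union of invariant sets need not be invariant, so lying on one of two cycles
  has to be expressed by a single relation, a closed walk of fixed length. In the strongly connected
  case the double edges steer the argument: two at a common vertex, none, a perfect matching, or
  just one. What survives has three vertices, where \<open>E\<close> defines all edges of the
  complete graph. Tuples with only two entries \<open>p\<close> and \<open>q\<close> suffice: they
  determine the coordinate, and reindexing such a tuple gives such a tuple again.\<close>

definition smooth :: "'a set \<Rightarrow> ('a \<times> 'a) set \<Rightarrow> bool" where
  "smooth K R \<longleftrightarrow> (\<forall>x\<in>K. (\<exists>y\<in>K. (x, y) \<in> R) \<and> (\<exists>y\<in>K. (y, x) \<in> R))"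

definition semic :: "'a set \<Rightarrow> ('a \<times> 'a) set \<Rightarrow> bool" where
  "semic S R \<longleftrightarrow> (\<forall>x\<in>S. (x, x) \<notin> R) \<and> (\<forall>x\<in>S. \<forall>y\<in>S. x \<noteq> y \<longrightarrow> (x, y) \<in> R \<or> (y, x) \<in> R)"

definition branching :: "'a set \<Rightarrow> ('a \<times> 'a) set \<Rightarrow> bool" where
  "branching K R \<longleftrightarrow> (\<exists>u\<in>K. \<exists>v\<in>K. \<exists>w\<in>K. (u, v) \<in> R \<and> (u, w) \<in> R \<and> v \<noteq> w)"

definition hard :: "'a set \<Rightarrow> ('a \<times> 'a) set \<Rightarrow> bool" where
  "hard S R \<longleftrightarrow> finite S \<and> semic S R \<and> smooth S R \<and> branching S R"

text \<open>Not the core in the sense of homomorphisms. The union is itself smooth, hence the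
  largest smooth subset; for finite \<open>S\<close> it is empty exactly when \<open>R\<close> has
  no directed cycle in \<open>S\<close>.\<close>

definition core :: "'a set \<Rightarrow> ('a \<times> 'a) set \<Rightarrow> 'a set" where
  "core S R = \<Union>{K. K \<subseteq> S \<and> smooth K R}"

lemma smooth_converse [simp]: "smooth K (R\<inverse>) = smooth K R"
  unfolding smooth_def by auto

lemma semic_converse [simp]: "semic K (R\<inverse>) = semic K R"
  unfolding semic_def by auto

lemma semic_subset: "semic S R \<Longrightarrow> T \<subseteq> S \<Longrightarrow> semic T R"
  unfolding semic_def by blast

lemma core_subset: "core S R \<subseteq> S"
  unfolding core_def by blast

lemma smooth_core: "smooth (core S R) R"
proof -
  have "(\<exists>y\<in>core S R. (x, y) \<in> R) \<and> (\<exists>y\<in>core S R. (y, x) \<in> R)" if x: "x \<in> core S R" for x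
  proof -
    obtain K where K: "K \<in> {K. K \<subseteq> S \<and> smooth K R}" "x \<in> K"
      using x unfolding core_def by blast
    have "(\<exists>y\<in>K. (x, y) \<in> R) \<and> (\<exists>y\<in>K. (y, x) \<in> R)"
      using K unfolding smooth_def by simp
    then show ?thesis
      unfolding core_def using K(1) by (meson UnionI)
  qed
  then show ?thesis unfolding smooth_def by simp
qed

lemma smooth_le_core: "K \<subseteq> S \<Longrightarrow> smooth K R \<Longrightarrow> K \<subseteq> core S R"
  unfolding core_def by blast

lemma branching_mono: "branching K R \<Longrightarrow> K \<subseteq> L \<Longrightarrow> branching L R"
  unfolding branching_def by blast

lemma smooth_pair: "(a, b) \<in> R \<Longrightarrow> (b, a) \<in> R \<Longrightarrow> smooth {a, b} R"
  unfolding smooth_def by auto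

lemma smooth_pair_path:
  "(a, b) \<in> R \<Longrightarrow> (b, a) \<in> R \<Longrightarrow> (a, x) \<in> R \<Longrightarrow> (x, b) \<in> R \<Longrightarrow> smooth {a, b, x} R"
  unfolding smooth_def by auto

lemma smooth_triple:
  "(a, b) \<in> R \<Longrightarrow> (b, c) \<in> R \<Longrightarrow> (c, a) \<in> R \<Longrightarrow> smooth {a, b, c} R"
  unfolding smooth_def by auto

text \<open>If all in-degrees are at most one, smoothness makes the predecessor map \<open>p\<close>
  total, and it is onto because every vertex has a successor. A surjection of a finite set onto
  itself is injective, so no vertex has two successors.\<close>

lemma not_branching_converse:
  assumes "finite S" "smooth S R" "\<not> branching S (R\<inverse>)"
  shows "\<not> branching S R"
proof
  assume "branching S R"
  then obtain u v w where uvw: "u \<in> S" "v \<in> S" "w \<in> S" "(u, v) \<in> R" "(u, w) \<in> R" "v \<noteq> w"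
    unfolding branching_def by blast
  define p where "p x = (SOME y. y \<in> S \<and> (y, x) \<in> R)" for x
  have p: "p x \<in> S \<and> (p x, x) \<in> R" if "x \<in> S" for x
  proof -
    have "\<exists>y. y \<in> S \<and> (y, x) \<in> R" using assms(2) that unfolding smooth_def by blast
    then show ?thesis unfolding p_def by (rule someI_ex)
  qed
  have un: "p x = y" if "x \<in> S" "y \<in> S" "(y, x) \<in> R" for x y
  proof (rule ccontr)
    assume "p x \<noteq> y"
    then have "branching S (R\<inverse>)"
      unfolding branching_def using p[OF that(1)] that by (meson converse_iff)
    then show False using assms(3) by simp
  qed
  have "y \<in> p ` S" if y: "y \<in> S" for y
  proof -
    obtain x where "x \<in> S" "(y, x) \<in> R" using assms(2) y unfolding smooth_def by meson
    then show ?thesis using un[of x y] y by (metis imageI)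
  qed
  then have "S \<subseteq> p ` S" by (rule subsetI)
  then have "card (p ` S) = card S"
    using assms(1) by (meson antisym card_image_le card_mono finite_imageI)
  then have "inj_on p S"
    using assms(1) eq_card_imp_inj_on by blast
  moreover have "p v = p w" using un uvw by metis
  ultimately show False using uvw by (auto dest: inj_onD)
qed

lemma hard_converse: "hard S R \<Longrightarrow> hard S (R\<inverse>)"
  unfolding hard_def using not_branching_converse[of S R] by auto

text \<open>Discarding the sinks preserves the hypothesis: a predecessor of a vertex has that vertex
  as a successor, so it is not discarded.\<close>

lemma ex_smooth_subset:
  assumes "finite S" "S \<noteq> {}" "\<And>x. x \<in> S \<Longrightarrow> \<exists>y\<in>S. (y, x) \<in> R"
  shows "\<exists>K\<subseteq>S. K \<noteq> {} \<and> smooth K R"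
  using assms
proof (induction S rule: finite_psubset_induct)
  case (psubset S)
  let ?T = "{x \<in> S. \<exists>y\<in>S. (x, y) \<in> R}"
  have T: "\<exists>y\<in>?T. (y, x) \<in> R" if "x \<in> S" for x
    using psubset.prems(2) that by blast
  have ne: "?T \<noteq> {}" using T psubset.prems(1) by blast
  show ?case
  proof (cases "?T = S")
    case True
    then have "smooth S R" unfolding smooth_def using psubset.prems(2) by blast
    with psubset.prems(1) show ?thesis by blast
  next
    case False
    then have "?T \<subset> S" by blast
    have "\<exists>K\<subseteq>?T. K \<noteq> {} \<and> smooth K R"
      by (rule psubset.IH[OF \<open>?T \<subset> S\<close> ne]) (use T in blast)
    then obtain K where "K \<subseteq> ?T" "K \<noteq> {}" "smooth K R" by (elim exE conjE)
    moreover have "?T \<subseteq> S" by (rule Collect_restrict)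
    ultimately show ?thesis by (meson subset_trans)
  qed
qed

text \<open>All out-degrees are one, so a walk \<open>a\<close>, \<open>b\<close>, \<open>c\<close>
  exhausts the digraph: \<open>a\<close> and \<open>b\<close> have their only successors on the
  walk, and any further vertex would send edges to both and branch.\<close>

lemma smooth_nonbranching_cases:
  assumes "semic K R" "smooth K R" "K \<noteq> {}" "\<not> branching K R"
  obtains (two) a b where "K = {a, b}" "a \<noteq> b" "(a, b) \<in> R" "(b, a) \<in> R"
  | (three) a b c where "K = {a, b, c}" "a \<noteq> b" "b \<noteq> c" "a \<noteq> c"
      "(a, b) \<in> R" "(b, c) \<in> R" "(c, a) \<in> R" "(b, a) \<notin> R" "(c, b) \<notin> R" "(a, c) \<notin> R"
proof -
  have un: "v = w" if "u \<in> K" "v \<in> K" "w \<in> K" "(u, v) \<in> R" "(u, w) \<in> R" for u v w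
    using assms(4) that unfolding branching_def by blast
  have ir: "u \<noteq> v" if "u \<in> K" "(u, v) \<in> R" for u v
    using assms(1) that unfolding semic_def by blast
  have tot: "(u, v) \<in> R \<or> (v, u) \<in> R" if "u \<in> K" "v \<in> K" "u \<noteq> v" for u v
    using assms(1) that unfolding semic_def by blast
  have ex: "\<exists>v\<in>K. (u, v) \<in> R" if "u \<in> K" for u
    using assms(2) that unfolding smooth_def by blast
  obtain a where a: "a \<in> K" using assms(3) by blast
  obtain b where b: "b \<in> K" "(a, b) \<in> R" using ex a by blast
  obtain c where c: "c \<in> K" "(b, c) \<in> R" using ex b by blast
  show ?thesis
  proof (cases "c = a")
    case True
    have "z \<in> {a, b}" if "z \<in> K" for z
      using tot[of a z] tot[of b z] un[of z a b] un[of a b z] un[of b a z] ir a b c that True by blast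
    then have "K = {a, b}" using a b by blast
    then show ?thesis using two[of a b] b c True ir a by blast
  next
    case False
    have ca: "(c, a) \<in> R" using tot[of a c] un[of a b c] ir a b c False by blast
    have "z \<in> {a, b, c}" if "z \<in> K" for z
      using tot[of a z] tot[of b z] un[of z a b] un[of a b z] un[of b c z] ir a b c that by blast
    then have "K = {a, b, c}" using a b c by blast
    then show ?thesis using three[of a b c] a b c ca False ir un by metis
  qed
qed

text \<open>
  \<open>D A\<close> says that the coordinates in \<open>A\<close> decide the value of \<open>f\<close>; the hypotheses make
  \<open>D\<close> an ultrafilter, which is principal as \<open>f\<close> depends on finitely many coordinates.
\<close>

lemma ultrafilter_projection:
  fixes f :: "(nat \<Rightarrow> 'a) \<Rightarrow> 'a"
  assumes fin: "\<exists>m. \<forall>x y. (\<forall>i<m. x i = y i) \<longrightarrow> f x = f y"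
    and pq: "p \<noteq> q"
    and D1: "\<And>A. D A \<Longrightarrow> f (\<lambda>j. if j \<in> A then p else q) = p"
    and D2: "\<And>A. D (- A) \<Longrightarrow> f (\<lambda>j. if j \<in> A then p else q) = q"
    and mono: "\<And>A B. D A \<Longrightarrow> A \<subseteq> B \<Longrightarrow> D B"
    and part: "\<And>P Q. P \<inter> Q = {} \<Longrightarrow> D P \<or> D Q \<or> D (- (P \<union> Q))"
  shows "\<exists>i. \<forall>A. f (\<lambda>j. if j \<in> A then p else q) = (if i \<in> A then p else q)"
proof -
  have compl: "\<not> (D A \<and> D (- A))" for A using D1 D2 pq by metis
  have empty: "\<not> D {}" using compl[of "{}"] mono[of "{}" "- {}"] by auto
  have UNIV: "D UNIV" using part[of "{}" "{}"] empty by simp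
  obtain m where m: "\<And>x y. (\<forall>i<m. x i = y i) \<Longrightarrow> f x = f y" using fin by blast
  have "f (\<lambda>j. if j \<in> {..<m} then p else q) = f (\<lambda>j. if j \<in> UNIV then p else q)"
    by (rule m) auto
  then have "\<not> D (- {..<m})" using D1[OF UNIV] D2[of "{..<m}"] pq by metis
  then have "D {..<m}" using part[of "{..<m}" "{}"] empty by simp
  \<comment> \<open>Closure of \<open>D\<close> under intersection is not assumed. Splitting the
    coordinates into one point of a smallest decisive set, the rest of that set and its complement
    leaves only the point.\<close>
  then have "\<exists>M. (finite M \<and> D M) \<and> (\<forall>M'. finite M' \<and> D M' \<longrightarrow> card M \<le> card M')"
    by (intro ex_has_least_nat[of _ "{..<m}"]) simp
  then obtain M where M: "finite M" "D M" and min: "\<And>M'. finite M' \<Longrightarrow> D M' \<Longrightarrow> card M \<le> card M'"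
    by auto
  obtain i where i: "i \<in> M" using M(2) empty by (cases "M = {}") auto
  have "D {i} \<or> D (M - {i}) \<or> D (- M)"
    using part[of "{i}" "M - {i}"] i by (simp add: insert_absorb)
  moreover have "\<not> D (M - {i})" using min[of "M - {i}"] M i by (metis card_Diff1_less finite_Diff leD)
  ultimately have Di: "D {i}" using compl M(2) by blast
  show ?thesis
  proof (intro exI allI)
    fix A show "f (\<lambda>j. if j \<in> A then p else q) = (if i \<in> A then p else q)"
      using D1[of A] D2[of A] mono[OF Di, of A] mono[OF Di, of "- A"] by auto
  qed
qed

section \<open>Invariant sets and relations\<close>

text \<open>Operations take infinite sequences, so that those of all arities share one type. Since
  \<open>p\<close> and \<open>q\<close> differ, the tested tuples determine \<open>i\<close>, which
  is all that the minor map has to know.\<close>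

definition projective :: "((nat \<Rightarrow> 'a) \<Rightarrow> 'a) set \<Rightarrow> 'a set \<Rightarrow> bool" where
  "projective F V \<longleftrightarrow> (\<exists>p\<in>V. \<exists>q\<in>V. p \<noteq> q \<and>
     (\<forall>f\<in>F. \<exists>i. \<forall>A. f (\<lambda>j. if j \<in> A then p else q) = (if i \<in> A then p else q)))"

lemma projective_mono: "projective F S \<Longrightarrow> S \<subseteq> V \<Longrightarrow> projective F V"
  unfolding projective_def by blast

text \<open>Invariance under \<open>F\<close> takes the place of pp-definability with constants; the
  closure rules below mirror the constructions that such formulas express.\<close>

definition invar :: "((nat \<Rightarrow> 'a) \<Rightarrow> 'a) set \<Rightarrow> 'a set \<Rightarrow> bool" where
  "invar F S \<longleftrightarrow> (\<forall>f\<in>F. \<forall>x. (\<forall>i. x i \<in> S) \<longrightarrow> f x \<in> S)"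

definition invar2 :: "((nat \<Rightarrow> 'a) \<Rightarrow> 'a) set \<Rightarrow> ('a \<times> 'a) set \<Rightarrow> bool" where
  "invar2 F R \<longleftrightarrow> (\<forall>f\<in>F. \<forall>x y. (\<forall>i. (x i, y i) \<in> R) \<longrightarrow> (f x, f y) \<in> R)"

lemma invarD: "invar F S \<Longrightarrow> f \<in> F \<Longrightarrow> (\<And>i. x i \<in> S) \<Longrightarrow> f x \<in> S"
  unfolding invar_def by blast

lemma invar2D: "invar2 F R \<Longrightarrow> f \<in> F \<Longrightarrow> (\<And>i. (x i, y i) \<in> R) \<Longrightarrow> (f x, f y) \<in> R"
  unfolding invar2_def by blast

lemma invar_Int: "invar F S \<Longrightarrow> invar F T \<Longrightarrow> invar F (S \<inter> T)"
  unfolding invar_def by blast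

lemma invar2_Int: "invar2 F R \<Longrightarrow> invar2 F Q \<Longrightarrow> invar2 F (R \<inter> Q)"
  unfolding invar2_def by blast

lemma invar2_converse: "invar2 F R \<Longrightarrow> invar2 F (R\<inverse>)"
  unfolding invar2_def by blast

lemma invar2_Times: "invar F S \<Longrightarrow> invar F T \<Longrightarrow> invar2 F (S \<times> T)"
  unfolding invar_def invar2_def by auto

lemma invar2_Id_on:
  fixes S :: "'a set"
  shows "invar F S \<Longrightarrow> invar2 F (Id_on S)"
  unfolding invar_def invar2_def
proof (intro ballI allI impI)
  fix f and x y :: "nat \<Rightarrow> 'a" assume S: "\<forall>f\<in>F. \<forall>x. (\<forall>i. x i \<in> S) \<longrightarrow> f x \<in> S" and f: "f \<in> F"
    and xy: "\<forall>i. (x i, y i) \<in> Id_on S"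
  then have "x = y" by (auto simp: Id_on_def)
  with S f xy show "(f x, f y) \<in> Id_on S" by (auto simp: Id_on_def)
qed

lemma invar2_relcomp:
  fixes R Q :: "('a \<times> 'a) set"
  assumes "invar2 F R" "invar2 F Q"
  shows "invar2 F (R O Q)"
  unfolding invar2_def
proof (intro ballI allI impI)
  fix f and x y :: "nat \<Rightarrow> 'a" assume f: "f \<in> F" and "\<forall>i. (x i, y i) \<in> R O Q"
  then have "\<forall>i. \<exists>z. (x i, z) \<in> R \<and> (z, y i) \<in> Q" by blast
  then obtain z where "\<And>i. (x i, z i) \<in> R" "\<And>i. (z i, y i) \<in> Q" by metis
  then show "(f x, f y) \<in> R O Q" using assms f by (blast dest: invar2D)
qed

lemma invar_Image:
  fixes R :: "('a \<times> 'a) set"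
  assumes "invar2 F R" "invar F S"
  shows "invar F (R `` S)"
  unfolding invar_def
proof (intro ballI allI impI)
  fix f and x :: "nat \<Rightarrow> 'a" assume f: "f \<in> F" and "\<forall>i. x i \<in> R `` S"
  then have "\<forall>i. \<exists>z. z \<in> S \<and> (z, x i) \<in> R" by blast
  then obtain z where "\<And>i. z i \<in> S" "\<And>i. (z i, x i) \<in> R" by metis
  then show "f x \<in> R `` S" using assms f by (blast dest: invar2D invarD)
qed

lemma invar_Domain:
  fixes R :: "('a \<times> 'a) set"
  assumes "invar2 F R"
  shows "invar F (Domain R)"
  unfolding invar_def
proof (intro ballI allI impI)
  fix f and x :: "nat \<Rightarrow> 'a" assume f: "f \<in> F" and "\<forall>i. x i \<in> Domain R"
  then have "\<forall>i. \<exists>z. (x i, z) \<in> R" by blast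
  then obtain z where "\<And>i. (x i, z i) \<in> R" by metis
  then show "f x \<in> Domain R" using assms f by (blast dest: invar2D)
qed

text \<open>The image of the powers of the core under an operation is again smooth.\<close>

lemma invar_core:
  fixes R :: "('a \<times> 'a) set"
  assumes "invar2 F R" "invar F S"
  shows "invar F (core S R)"
  unfolding invar_def
proof (intro ballI allI impI)
  fix f and x :: "nat \<Rightarrow> 'a" assume f: "f \<in> F" and x: "\<forall>i. x i \<in> core S R"
  let ?K = "{f y | y. \<forall>i. y i \<in> core S R}"
  have "?K \<subseteq> S"
    using invarD[OF assms(2) f] core_subset[of S R] by blast
  moreover have "smooth ?K R"
    unfolding smooth_def
  proof
    fix u assume "u \<in> ?K"
    then obtain y where u: "u = f y" and y: "\<And>i. y i \<in> core S R" by blast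
    have "\<forall>i. \<exists>z. z \<in> core S R \<and> (y i, z) \<in> R" "\<forall>i. \<exists>z. z \<in> core S R \<and> (z, y i) \<in> R"
      using y smooth_core[of S R] unfolding smooth_def by blast+
    then obtain z w where "\<And>i. z i \<in> core S R" "\<And>i. (y i, z i) \<in> R"
        "\<And>i. w i \<in> core S R" "\<And>i. (w i, y i) \<in> R"
      by metis
    then show "(\<exists>v\<in>?K. (u, v) \<in> R) \<and> (\<exists>v\<in>?K. (v, u) \<in> R)"
      unfolding u using invar2D[OF assms(1) f] by blast
  qed
  ultimately have "?K \<subseteq> core S R" by (rule smooth_le_core)
  then show "f x \<in> core S R" using x by blast
qed

section \<open>Ultrafilters of decisive coordinates\<close>

text \<open>Two tuples that differ in every coordinate have different values, and every pair of
  vertices is invariant as the neighbourhood of the third. Together these force the value on one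
  two-valued tuple from that on another.\<close>

lemma K3_projective:
  fixes F :: "((nat \<Rightarrow> 'a) \<Rightarrow> 'a) set"
  assumes fin: "\<And>f. f \<in> F \<Longrightarrow> \<exists>m. \<forall>x y. (\<forall>i<m. x i = y i) \<longrightarrow> f x = f y"
    and V: "V = {a, b, c}" "a \<noteq> b" "b \<noteq> c" "a \<noteq> c"
    and sing: "\<And>v. v \<in> V \<Longrightarrow> invar F {v}"
    and E: "invar2 F {(x, y). x \<in> V \<and> y \<in> V \<and> x \<noteq> y}"
  shows "projective F V"
proof -
  let ?E = "{(x, y). x \<in> V \<and> y \<in> V \<and> x \<noteq> y}"
  have pair: "invar F (V - {r})" if "r \<in> V" for r
  proof -
    have "?E `` {r} = V - {r}" using that by auto
    then show ?thesis using invar_Image[OF E sing[OF that]] by simp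
  qed
  have invV: "invar F V"
  proof -
    have "Domain ?E = V" using V by auto
    then show ?thesis using invar_Domain[OF E] by simp
  qed
  have ex_third: "\<exists>r\<in>V. r \<noteq> p \<and> r \<noteq> q" for p q
    unfolding V(1) using V(2-4) by auto
  have third: "x = p \<or> x = q"
    if "x \<in> V" "x \<noteq> r" "p \<in> V" "q \<in> V" "r \<in> V" "p \<noteq> q" "p \<noteq> r" "q \<noteq> r" for x p q r
    using that unfolding V(1) by auto
  have avoid: "f x \<noteq> f y"
    if "f \<in> F" "\<And>i. x i \<in> V" "\<And>i. y i \<in> V" "\<And>i. x i \<noteq> y i" for f x y
    using invar2D[OF E that(1), of x y] that by auto
  have within: "f x = p \<or> f x = q"
    if f: "f \<in> F" and pq: "p \<in> V" "q \<in> V" "p \<noteq> q" and x: "\<And>i. x i = p \<or> x i = q" for f x p q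
  proof -
    obtain r where r: "r \<in> V" "r \<noteq> p" "r \<noteq> q" using ex_third[of p q] by (elim bexE conjE)
    have "x i \<in> V - {r}" for i using x[of i] pq r by auto
    then have "f x \<in> V - {r}" by (rule invarD[OF pair[OF r(1)] f])
    then show ?thesis using third[of "f x" r p q] pq r by simp
  qed
  have step: "f (\<lambda>j. if j \<in> B then r else p) = r"
    if f: "f \<in> F" and pqr: "p \<in> V" "q \<in> V" "r \<in> V" "p \<noteq> q" "p \<noteq> r" "q \<noteq> r"
      and P: "f (\<lambda>j. if j \<in> P then p else q) = p" and B: "P \<subseteq> B"
    for f p q r P B
  proof -
    have "f (\<lambda>j. if j \<in> P then p else q) \<noteq> f (\<lambda>j. if j \<in> B then r else p)"
      by (rule avoid[OF f]) (use pqr B in auto)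
    moreover have "f (\<lambda>j. if j \<in> B then r else p) = r \<or> f (\<lambda>j. if j \<in> B then r else p) = p"
      by (rule within[OF f]) (use pqr in auto)
    ultimately show ?thesis using P by simp
  qed
  have flip: "f (\<lambda>j. if j \<in> B then y else x) = y"
    if f: "f \<in> F" and xy: "x \<in> V" "y \<in> V" "x \<noteq> y" and B: "f (\<lambda>j. if j \<in> B then x else y) = x"
    for f x y B
  proof -
    have "f (\<lambda>j. if j \<in> B then x else y) \<noteq> f (\<lambda>j. if j \<in> B then y else x)"
      by (rule avoid[OF f]) (use xy in auto)
    moreover have "f (\<lambda>j. if j \<in> B then y else x) = y \<or> f (\<lambda>j. if j \<in> B then y else x) = x"
      by (rule within[OF f]) (use xy in auto)
    ultimately show ?thesis using B by simp
  qed
  have "\<exists>i. \<forall>A. f (\<lambda>j. if j \<in> A then a else b) = (if i \<in> A then a else b)" if f: "f \<in> F" for f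
  proof -
    \<comment> \<open>All supersets and all pairs are built in, so monotonicity is immediate;
      \<open>DI\<close> shows that one pair and the set itself suffice.\<close>
    define D where "D P \<longleftrightarrow> (\<forall>B. P \<subseteq> B \<longrightarrow> (\<forall>p\<in>V. \<forall>q\<in>V. p \<noteq> q \<longrightarrow> f (\<lambda>j. if j \<in> B then p else q) = p))" for P
    have DI: "D P" if p: "p \<in> V" and q: "q \<in> V" and pq: "p \<noteq> q"
      and P: "f (\<lambda>j. if j \<in> P then p else q) = p" for P p q
    proof -
      obtain r where r: "r \<in> V" "r \<noteq> p" "r \<noteq> q" using ex_third[of p q] by (elim bexE conjE)
      \<comment> \<open>\<open>step\<close> rotates the pair \<open>p\<close>, \<open>q\<close> to
        \<open>r\<close>, \<open>p\<close>, then to \<open>q\<close>, \<open>r\<close> and back to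
        \<open>p\<close>, \<open>q\<close>, each time allowing a superset; \<open>flip\<close>
        supplies the three reversed pairs.\<close>
      have u1: "f (\<lambda>j. if j \<in> B then r else p) = r" if "P \<subseteq> B" for B
        using step[OF f p q r(1) pq _ _ P that] r by simp
      have u2: "f (\<lambda>j. if j \<in> B then q else r) = q" if "P \<subseteq> B" for B
        using step[OF f r(1) p q _ _ _ u1[OF that] subset_refl] r pq by simp
      have u3: "f (\<lambda>j. if j \<in> B then p else q) = p" if "P \<subseteq> B" for B
        using step[OF f q r(1) p _ _ _ u2[OF that] subset_refl] r pq by simp
      have V': "V = {p, q, r}" using third[of _ r p q] p q r pq by auto
      show ?thesis unfolding D_def V'
        using u1 u2 u3 flip[OF f r(1) p _ u1] flip[OF f q r(1) _ u2] flip[OF f p q pq u3] r pq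
        by auto
    qed
    show ?thesis
    proof (rule ultrafilter_projection[where D = D])
      show "\<exists>m. \<forall>x y. (\<forall>i<m. x i = y i) \<longrightarrow> f x = f y" by (rule fin[OF f])
      show "a \<noteq> b" by fact
      show "f (\<lambda>j. if j \<in> A then a else b) = a" if "D A" for A
        using that V(2) unfolding D_def V(1) by auto
      show "f (\<lambda>j. if j \<in> A then a else b) = b" if "D (- A)" for A
      proof -
        have "f (\<lambda>j. if j \<in> - A then b else a) = b"
          using that V(2) unfolding D_def V(1) by auto
        moreover have "(\<lambda>j. if j \<in> - A then b else a) = (\<lambda>j. if j \<in> A then a else b)" by auto
        ultimately show ?thesis by simp
      qed
      show "D B" if "D A" "A \<subseteq> B" for A B
        using that unfolding D_def by (meson subset_trans)
      show "D P \<or> D Q \<or> D (- (P \<union> Q))" if PQ: "P \<inter> Q = {}" for P Q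
      proof -
        \<comment> \<open>One colour for each block of the partition; the block whose colour is the
          value of \<open>f\<close> is decisive.\<close>
        let ?z = "\<lambda>j. if j \<in> P then a else if j \<in> Q then b else c"
        have key: "D W" if W: "\<And>j. j \<in> W \<longleftrightarrow> ?z j = v" and v: "v \<in> V" and fz: "f ?z = v" for v W
        proof -
          obtain w where w: "w \<in> V" "w \<noteq> v" using ex_third[of v v] by (elim bexE conjE)
          have "f ?z \<noteq> f (\<lambda>j. if j \<in> W then w else v)"
            by (rule avoid[OF f]) (use W v w V in auto)
          moreover have "f (\<lambda>j. if j \<in> W then w else v) = w \<or> f (\<lambda>j. if j \<in> W then w else v) = v"
            by (rule within[OF f w(1) v w(2)]) simp
          ultimately have "f (\<lambda>j. if j \<in> W then w else v) = w" using fz by simp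
          then show ?thesis by (rule DI[OF w(1) v w(2)])
        qed
        have "f ?z \<in> V" by (rule invarD[OF invV f]) (use V in auto)
        then consider "f ?z = a" | "f ?z = b" | "f ?z = c" unfolding V(1) by auto
        then show ?thesis
        proof cases
          case 1 then show ?thesis using key[of P a] V by auto
        next
          case 2
          have "j \<in> Q \<longleftrightarrow> ?z j = b" for j using V(2-4) PQ by (cases "j \<in> P") auto
          then have "D Q" using key[of Q b] V(1) 2 by simp
          then show ?thesis by simp
        next
          case 3 then show ?thesis using key[of "- (P \<union> Q)" c] V by auto
        qed
      qed
    qed
  qed
  then show ?thesis unfolding projective_def using V by auto
qed

text \<open>
  A tuple with entries in \<open>K\<^sub>1\<close> on \<open>P\<close> and in \<open>K\<^sub>2\<close> off \<open>P\<close> is mapped into \<open>K\<^sub>1\<close> only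
  if \<open>P\<close> decides \<open>f\<close> on \<open>K\<^sub>1\<close>, and into \<open>K\<^sub>2\<close> only if the complement decides \<open>f\<close> on \<open>K\<^sub>2\<close>.
\<close>

lemma two_cycles_projective:
  fixes F :: "((nat \<Rightarrow> 'a) \<Rightarrow> 'a) set"
  assumes fin: "\<And>f. f \<in> F \<Longrightarrow> \<exists>m. \<forall>x y. (\<forall>i<m. x i = y i) \<longrightarrow> f x = f y"
    and inv1: "invar F K1" and inv2: "invar F K2" and inv12: "invar F (K1 \<union> K2)"
    and sing: "\<And>v. v \<in> K1 \<union> K2 \<Longrightarrow> invar F {v}"
    and E: "invar2 F E"
    and smooth: "smooth K1 E" "smooth K2 E" and ne: "K1 \<noteq> {}" "K2 \<noteq> {}"
    and irr: "\<And>v. v \<in> K1 \<union> K2 \<Longrightarrow> (v, v) \<notin> E"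
    and disj: "K1 \<inter> K2 = {}"
    and dom: "\<And>x y. x \<in> K1 \<Longrightarrow> y \<in> K2 \<Longrightarrow> (x, y) \<in> E"
    and out1: "\<And>u v w. u \<in> K1 \<Longrightarrow> v \<in> K1 \<Longrightarrow> w \<in> K1 \<Longrightarrow> (u, v) \<in> E \<Longrightarrow> (u, w) \<in> E \<Longrightarrow> v = w"
    and out2: "\<And>u v w. u \<in> K2 \<Longrightarrow> v \<in> K2 \<Longrightarrow> w \<in> K2 \<Longrightarrow> (u, v) \<in> E \<Longrightarrow> (u, w) \<in> E \<Longrightarrow> v = w"
    and in1: "\<And>u v w. u \<in> K1 \<Longrightarrow> v \<in> K1 \<Longrightarrow> w \<in> K1 \<Longrightarrow> (v, u) \<in> E \<Longrightarrow> (w, u) \<in> E \<Longrightarrow> v = w"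
    and in2: "\<And>u v w. u \<in> K2 \<Longrightarrow> v \<in> K2 \<Longrightarrow> w \<in> K2 \<Longrightarrow> (v, u) \<in> E \<Longrightarrow> (w, u) \<in> E \<Longrightarrow> v = w"
  shows "projective F (K1 \<union> K2)"
proof -
  have succ1: "\<exists>y. y \<in> K1 \<and> (x, y) \<in> E" and pred1: "\<exists>y. y \<in> K1 \<and> (y, x) \<in> E" if "x \<in> K1" for x
    using smooth(1) that unfolding smooth_def by blast+
  have succ2: "\<exists>y. y \<in> K2 \<and> (x, y) \<in> E" and pred2: "\<exists>y. y \<in> K2 \<and> (y, x) \<in> E" if "x \<in> K2" for x
    using smooth(2) that unfolding smooth_def by blast+
  obtain c0 where c0: "c0 \<in> K1" using ne by blast
  obtain c1 where c1: "c1 \<in> K1" "(c0, c1) \<in> E" using succ1[OF c0] by blast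
  obtain c2 where c2: "c2 \<in> K1" "(c1, c2) \<in> E" using succ1[OF c1(1)] by blast
  obtain t0 where t0: "t0 \<in> K2" using ne by blast
  obtain t1 where t1: "t1 \<in> K2" "(t0, t1) \<in> E" using succ2[OF t0] by blast
  have c01: "c0 \<noteq> c1" using irr c0 c1 by blast
  have t01: "t0 \<noteq> t1" using irr t0 t1 by blast
  have const: "f (\<lambda>_. v) = v" if "f \<in> F" "v \<in> K1 \<union> K2" for f v
    using invarD[OF sing[OF that(2)] that(1), of "\<lambda>_. v"] by simp
  have "\<exists>i. \<forall>A. f (\<lambda>j. if j \<in> A then c0 else c1) = (if i \<in> A then c0 else c1)" if f: "f \<in> F" for f
  proof -
    \<comment> \<open>\<open>D\<close> concerns the value \<open>c0\<close> in \<open>K1\<close>,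
      and \<open>T\<close> the value \<open>t1\<close> in \<open>K2\<close>. \<open>D1\<close> moves
      one step forward along the first cycle, \<open>T0\<close> one step backward along the
      second.\<close>
    define D where "D P \<longleftrightarrow> (\<forall>x. (\<forall>i. x i \<in> K1) \<and> (\<forall>i\<in>P. x i = c0) \<longrightarrow> f x = c0)" for P
    define T where "T Q \<longleftrightarrow> (\<forall>x. (\<forall>i. x i \<in> K2) \<and> (\<forall>i\<in>Q. x i = t1) \<longrightarrow> f x = t1)" for Q
    have Dmono: "D B" if "D A" "A \<subseteq> B" for A B using that unfolding D_def by blast
    have fK1: "f x \<in> K1" if "\<And>i. x i \<in> K1" for x using invarD[OF inv1 f that] .
    have fK2: "f x \<in> K2" if "\<And>i. x i \<in> K2" for x using invarD[OF inv2 f that] .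
    have fE: "(f x, f y) \<in> E" if "\<And>i. (x i, y i) \<in> E" for x y using invar2D[OF E f that] .
    have D1: "f x = c1" if P: "D P" and x: "\<And>i. x i \<in> K1" and xP: "\<And>i. i \<in> P \<Longrightarrow> x i = c1" for P x
    proof -
      have "\<forall>i. \<exists>y. y \<in> K1 \<and> (y, x i) \<in> E" using pred1 x by blast
      then obtain y where y: "\<And>i. y i \<in> K1" "\<And>i. (y i, x i) \<in> E" by metis
      have "y i = c0" if "i \<in> P" for i using in1[of c1 "y i" c0] y[of i] xP[OF that] c0 c1 by auto
      then have "f y = c0" using P y unfolding D_def by blast
      then have "(c0, f x) \<in> E" using fE[of y x] y by simp
      then show ?thesis using out1[of c0 "f x" c1] c0 c1 fK1[of x] x by blast
    qed
    have T0: "f x = t0" if P: "T P" and x: "\<And>i. x i \<in> K2" and xP: "\<And>i. i \<in> P \<Longrightarrow> x i = t0" for P x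
    proof -
      have "\<forall>i. \<exists>y. y \<in> K2 \<and> (x i, y) \<in> E" using succ2 x by blast
      then obtain y where y: "\<And>i. y i \<in> K2" "\<And>i. (x i, y i) \<in> E" by metis
      have "y i = t1" if "i \<in> P" for i using out2[of t0 "y i" t1] y[of i] xP[OF that] t0 t1 by auto
      then have "f y = t1" using P y unfolding T_def by blast
      then have "(f x, t1) \<in> E" using fE[of x y] y by simp
      then show ?thesis using in2[of t1 "f x" t0] t0 t1 fK2[of x] x by blast
    qed
    have Tdisj: "\<not> (T P \<and> T (- P))" for P
    proof
      assume T: "T P \<and> T (- P)"
      let ?x = "\<lambda>j. if j \<in> P then t1 else t0"
      have "f ?x = t1" using T t0 t1 unfolding T_def by auto
      moreover have "f ?x = t0" by (rule T0[of "- P"]) (use T t0 t1 in auto)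
      ultimately show False using t01 by simp
    qed
    have Ddisj: "\<not> (D P \<and> D (- P))" for P
    proof
      assume T: "D P \<and> D (- P)"
      let ?x = "\<lambda>j. if j \<in> P then c0 else c1"
      have "f ?x = c0" using T c0 c1 unfolding D_def by auto
      moreover have "f ?x = c1" by (rule D1[of "- P"]) (use T c0 c1 in auto)
      ultimately show False using c01 by simp
    qed
    have TI: "T W" if z: "f z \<in> K2" "\<And>i. z i \<in> K1 \<union> K2" "\<And>i. i \<in> W \<Longrightarrow> z i = t0" "\<And>i. i \<notin> W \<Longrightarrow> z i \<in> K1" for z W
      unfolding T_def
    proof (intro allI impI)
      fix y assume y: "(\<forall>i. y i \<in> K2) \<and> (\<forall>i\<in>W. y i = t1)"
      have "(z i, y i) \<in> E" for i using z(3,4)[of i] y t1 dom by (cases "i \<in> W") auto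
      then have "(f z, f y) \<in> E" by (rule fE)
      moreover have "(z i, t1) \<in> E" for i using z(3,4)[of i] t1 dom by (cases "i \<in> W") auto
      then have "(f z, f (\<lambda>_. t1)) \<in> E" by (rule fE)
      ultimately show "f y = t1"
        using out2[OF z(1), of "f y" t1] fK2[of y] y t1 const[OF f, of t1] by auto
    qed
    have DI: "D P" if z: "f (\<lambda>j. if j \<in> P then c1 else t0) \<in> K1" for P
      unfolding D_def
    proof (intro allI impI)
      let ?z = "\<lambda>j. if j \<in> P then c1 else t0"
      fix x assume x: "(\<forall>i. x i \<in> K1) \<and> (\<forall>i\<in>P. x i = c0)"
      have "(x i, ?z i) \<in> E" for i using x c1 t0 dom by auto
      then have "(f x, f ?z) \<in> E" by (rule fE)
      moreover have "(c0, ?z i) \<in> E" for i using c0 c1 t0 dom by auto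
      then have "(f (\<lambda>_. c0), f ?z) \<in> E" by (rule fE)
      ultimately show "f x = c0"
        using in1[OF z, of "f x" c0] fK1[of x] x c0 const[OF f, of c0] by auto
    qed
    have DT: "D P \<or> T (- P)" for P
    proof -
      let ?z = "\<lambda>j. if j \<in> P then c1 else t0"
      have z: "?z i \<in> K1 \<union> K2" for i using c1 t0 by auto
      then have "f ?z \<in> K1 \<or> f ?z \<in> K2" using invarD[OF inv12 f, of ?z] by blast
      moreover have "T (- P)" if "f ?z \<in> K2" by (rule TI[OF that z]) (use c1 in auto)
      ultimately show ?thesis using DI by blast
    qed
    have DD: "D P \<or> D (- P)" for P using DT[of P] DT[of "- P"] Tdisj[of P] by auto
    have TD: "D P" if "T P" for P using DT[of P] Tdisj[of P] that by auto
    show ?thesis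
    proof (rule ultrafilter_projection[where D = D])
      show "\<exists>m. \<forall>x y. (\<forall>i<m. x i = y i) \<longrightarrow> f x = f y" by (rule fin[OF f])
      show "c0 \<noteq> c1" by fact
      show "f (\<lambda>j. if j \<in> A then c0 else c1) = c0" if "D A" for A
        using that c0 c1 unfolding D_def by auto
      show "f (\<lambda>j. if j \<in> A then c0 else c1) = c1" if "D (- A)" for A
        by (rule D1[OF that]) (use c0 c1 in auto)
      show "D B" if "D A" "A \<subseteq> B" for A B by (rule Dmono[OF that])
      show "D P \<or> D Q \<or> D (- (P \<union> Q))" if PQ: "P \<inter> Q = {}" for P Q
      proof (rule ccontr)
        assume "\<not> ?thesis"
        then have D: "D (- P)" "D (- Q)" "\<not> D (- (P \<union> Q))" using DD by blast+
        let ?z = "\<lambda>j. if j \<in> P then c1 else if j \<in> Q then c2 else t0"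
        have z: "?z i \<in> K1 \<union> K2" for i using c1 c2 t0 by auto
        have "T (- (P \<union> Q))" if "f ?z \<in> K2" by (rule TI[OF that z]) (use c1 c2 in auto)
        then have z1: "f ?z \<in> K1" using invarD[OF inv12 f, of ?z] z TD D(3) by blast
        \<comment> \<open>Both tuples precede \<open>?z\<close> edgewise: \<open>c0\<close> precedes
          \<open>c1\<close> and \<open>t0\<close>, and \<open>c1\<close> precedes \<open>c2\<close>
          and \<open>t0\<close>. Decisiveness of the complements of \<open>Q\<close> and
          \<open>P\<close> gives them the values \<open>c0\<close> and \<open>c1\<close>, two
          predecessors of one vertex of the cycle \<open>K1\<close>.\<close>
        let ?x = "\<lambda>j. if j \<in> Q then c1 else c0" and ?y = "\<lambda>j. if j \<in> P then c0 else c1"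
        have x: "?x i \<in> K1" and y: "?y i \<in> K1" for i using c0 c1 by auto
        have "f ?x = c0" using D(2) x unfolding D_def by auto
        moreover have "f ?y = c1" by (rule D1[OF D(1)]) (use c0 c1 in auto)
        moreover have "(f ?x, f ?z) \<in> E" by (rule fE) (use PQ c0 c1 c2 t0 dom in auto)
        moreover have "(f ?y, f ?z) \<in> E" by (rule fE) (use PQ c0 c1 c2 t0 dom in auto)
        ultimately show False using in1[OF z1, of c0 c1] c0 c1 c01 by auto
      qed
    qed
  qed
  then show ?thesis unfolding projective_def using c0 c1 c01 by blast
qed

section \<open>Minimal digraphs with a branching core\<close>

locale min_hard =
  fixes F :: "((nat \<Rightarrow> 'a) \<Rightarrow> 'a) set" and V :: "'a set" and E :: "('a \<times> 'a) set"
  assumes fin: "f \<in> F \<Longrightarrow> \<exists>m. \<forall>x y. (\<forall>i<m. x i = y i) \<longrightarrow> f x = f y"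
    and sing: "v \<in> V \<Longrightarrow> invar F {v}"
    and E: "invar2 F E"
    and EV: "E \<subseteq> V \<times> V"
    and hard: "hard V E"
    and min: "S \<subseteq> V \<Longrightarrow> invar F S \<Longrightarrow> invar2 F R \<Longrightarrow> hard S R \<Longrightarrow> card V \<le> card S"
begin

definition strong :: bool where
  "strong \<longleftrightarrow> (\<forall>U\<subseteq>V. U \<noteq> {} \<longrightarrow> E `` U \<subseteq> U \<longrightarrow> U = V)"

definition matching :: bool where
  "matching \<longleftrightarrow> (\<forall>x\<in>V. \<exists>!y. (x, y) \<in> E \<and> (y, x) \<in> E)"

lemma strongD: "strong \<Longrightarrow> U \<subseteq> V \<Longrightarrow> U \<noteq> {} \<Longrightarrow> E `` U \<subseteq> U \<Longrightarrow> U = V"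
  unfolding strong_def by blast

lemma finV: "finite V"
  using hard unfolding hard_def by simp

lemma irr: "(x, x) \<notin> E"
  using hard EV unfolding hard_def semic_def by blast

lemma tot: "x \<in> V \<Longrightarrow> y \<in> V \<Longrightarrow> x \<noteq> y \<Longrightarrow> (x, y) \<in> E \<or> (y, x) \<in> E"
  using hard unfolding hard_def semic_def by blast

lemma out: "x \<in> V \<Longrightarrow> \<exists>y. (x, y) \<in> E"
  using hard unfolding hard_def smooth_def by blast

lemma inn: "x \<in> V \<Longrightarrow> \<exists>y. (y, x) \<in> E"
  using hard unfolding hard_def smooth_def by blast

lemma inV: "(x, y) \<in> E \<Longrightarrow> x \<in> V" "(x, y) \<in> E \<Longrightarrow> y \<in> V"
  using EV by blast+

lemma semicV: "S \<subseteq> V \<Longrightarrow> semic S E"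
  using hard semic_subset unfolding hard_def by blast

lemma matching_unique:
  "matching \<Longrightarrow> (x, y) \<in> E \<Longrightarrow> (y, x) \<in> E \<Longrightarrow> (x, z) \<in> E \<Longrightarrow> (z, x) \<in> E \<Longrightarrow> y = z"
  unfolding matching_def using inV(1) by blast

lemma matching_ex: "matching \<Longrightarrow> x \<in> V \<Longrightarrow> \<exists>y. (x, y) \<in> E \<and> (y, x) \<in> E"
  unfolding matching_def by blast

lemma dual: "min_hard F V (E\<inverse>)"
proof
  show "invar2 F (E\<inverse>)" using E by (rule invar2_converse)
  show "E\<inverse> \<subseteq> V \<times> V" using EV by blast
  show "hard V (E\<inverse>)" using hard by (rule hard_converse)
qed (fact fin sing min)+

section \<open>Consequences of minimality\<close>

lemma invV: "invar F V"
proof -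
  have "Domain E = V" using out EV by blast
  then show ?thesis using invar_Domain[OF E] by simp
qed

lemma inv_out: "invar F S \<Longrightarrow> invar F (E `` S)"
  by (rule invar_Image[OF E])

lemma inv_in: "invar F S \<Longrightarrow> invar F (E\<inverse> `` S)"
  by (rule invar_Image[OF invar2_converse[OF E]])

text \<open>Otherwise \<open>core S R\<close>, which is invariant along with \<open>S\<close>, would
  carry a hard digraph with fewer vertices.\<close>

lemma nobranch:
  assumes S: "invar F S" "S \<subset> V" and R: "invar2 F R" and s: "semic S R" and K: "K \<subseteq> S" "smooth K R"
  shows "\<not> branching K R"
proof
  assume "branching K R"
  then have "branching (core S R) R"
    using smooth_le_core[OF K] branching_mono by blast
  moreover have "finite S" using S(2) finV finite_subset by blast
  ultimately have "hard (core S R) R"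
    unfolding hard_def using s core_subset[of S R] smooth_core[of S R]
    by (meson finite_subset semic_subset)
  then have "card V \<le> card (core S R)"
    using min[of "core S R" R] invar_core[OF R S(1)] R S(2) core_subset[of S R] by blast
  moreover have "card (core S R) < card V"
    using core_subset[of S R] S(2) finV by (meson psubset_card_mono subset_psubset_trans)
  ultimately show False by simp
qed

text \<open>The core has out-degree one by minimality. The vertices of \<open>K\<close> already have
  their successors in \<open>K\<close>, so a core vertex outside \<open>K\<close> receives no edge
  from \<open>K\<close> and sends edges to all of it; but \<open>K\<close> has more than one
  vertex.\<close>

lemma cycle_eq_core:
  assumes S: "invar F S" "S \<subset> V" and K: "K \<subseteq> S" "smooth K E" "K \<noteq> {}"
  shows "K = core S E"
proof (rule ccontr)
  let ?L = "core S E"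
  assume "K \<noteq> ?L"
  moreover have KL: "K \<subseteq> ?L" using smooth_le_core K by blast
  ultimately obtain z where z: "z \<in> ?L" "z \<notin> K" by blast
  have nb: "\<not> branching ?L E"
    using nobranch[OF S E semicV core_subset smooth_core] S by blast
  have un: "v = w" if "u \<in> ?L" "v \<in> ?L" "w \<in> ?L" "(u, v) \<in> E" "(u, w) \<in> E" for u v w
    using nb that unfolding branching_def by blast
  have LV: "?L \<subseteq> V" using core_subset[of S E] S(2) by blast
  have zk: "(z, k) \<in> E" if k: "k \<in> K" for k
  proof -
    obtain k' where "k' \<in> K" "(k, k') \<in> E" using K(2) k unfolding smooth_def by blast
    then have "(k, z) \<notin> E" using un[of k k' z] KL k z by blast
    then show ?thesis using tot[of k z] k z KL LV by blast
  qed
  obtain k where k: "k \<in> K" using K(3) by blast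
  obtain k' where k': "k' \<in> K" "(k, k') \<in> E" using K(2) k unfolding smooth_def by blast
  then have "k = k'" using un[of z k k'] zk k KL z by blast
  then show False using k' irr by blast
qed

lemma cycle_invar:
  assumes "invar F S" "S \<subset> V" "K \<subseteq> S" "smooth K E" "K \<noteq> {}"
  shows "invar F K"
  using cycle_eq_core[OF assms] invar_core[OF E assms(1)] by simp

lemma cycle_unique:
  assumes "invar F S" "S \<subset> V" "K \<subseteq> S" "smooth K E" "K \<noteq> {}" "L \<subseteq> S" "smooth L E" "L \<noteq> {}"
  shows "K = L"
  using cycle_eq_core[OF assms(1-5)] cycle_eq_core[OF assms(1,2,6-8)] by simp

lemma cycle_nobranch:
  assumes "invar F S" "S \<subset> V" "K \<subseteq> S" "smooth K E"
  shows "\<not> branching K E"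
  using nobranch[OF assms(1,2) E semicV assms(3,4)] assms(2) by blast

text \<open>In a proper invariant set the pair \<open>a\<close>, \<open>b\<close> and the triple
  \<open>a\<close>, \<open>b\<close>, \<open>x\<close> would be two different smooth subsets. This
  serves to show that certain neighbourhoods are everything.\<close>

lemma two_cycles:
  assumes "invar F S" "(a, b) \<in> E" "(b, a) \<in> E" "(a, x) \<in> E" "(x, b) \<in> E" "a \<in> S" "b \<in> S" "x \<in> S" "S \<subseteq> V"
  shows "S = V"
proof (rule ccontr)
  assume "S \<noteq> V"
  then have S: "S \<subset> V" using assms(9) by blast
  have "{a, b} = {a, b, x}"
    by (rule cycle_unique[OF assms(1) S]) (use assms smooth_pair smooth_pair_path in auto)
  then have "x = a \<or> x = b" by blast
  then show False using irr assms(4,5) by blast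
qed

lemma E_sub: "E `` S \<subseteq> V" "E\<inverse> `` S \<subseteq> V"
  using EV by blast+

lemma out_psubset: "v \<in> V \<Longrightarrow> E `` {v} \<subset> V"
  using E_sub irr by blast

lemma in_psubset: "v \<in> V \<Longrightarrow> E\<inverse> `` {v} \<subset> V"
  using E_sub irr by blast

section \<open>Digraphs that are not strongly connected\<close>

text \<open>The exponent 6 is a common multiple of the cycle lengths 2 and 3.\<close>

lemma cycle_six:
  assumes "K \<subseteq> V" "smooth K E" "\<not> branching K E" "x \<in> K"
  shows "(x, x) \<in> E O E O E O E O E O E"
proof -
  have six: "(p0, p6) \<in> E O E O E O E O E O E"
    if "(p0, p1) \<in> E" "(p1, p2) \<in> E" "(p2, p3) \<in> E" "(p3, p4) \<in> E" "(p4, p5) \<in> E" "(p5, p6) \<in> E"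
    for p0 p1 p2 p3 p4 p5 p6
    using that by (intro relcompI)
  have ne: "K \<noteq> {}" using assms(4) by blast
  from semicV[OF assms(1)] assms(2) ne assms(3) show ?thesis
  proof (cases rule: smooth_nonbranching_cases)
    case (two a b)
    then have "x = a \<or> x = b" using assms(4) by blast
    then show ?thesis using six[of a b a b a b a] six[of b a b a b a b] two(3,4) by (elim disjE) simp_all
  next
    case (three a b c)
    then have "x = a \<or> x = b \<or> x = c" using assms(4) by blast
    then show ?thesis
      using six[of a b c a b c a] six[of b c a b c a b] six[of c a b c a b c] three(5-7) by (elim disjE) simp_all
  qed
qed

text \<open>Every vertex in the strong component of \<open>y\<close> lies on a closed walk itself,
  and its neighbours on that walk belong to the component.\<close>

lemma closed_walk_smooth:
  assumes "(y, y) \<in> E O E O E O E O E O E"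
  shows "smooth {w. (y, w) \<in> E\<^sup>* \<and> (w, y) \<in> E\<^sup>*} E"
proof -
  have "(y, y) \<in> E\<^sup>+"
  proof -
    have step: "E O R \<subseteq> E\<^sup>+" if "R \<subseteq> E\<^sup>+" for R
      using that by (auto intro: trancl_into_trancl2)
    have "E O E O E O E O E O E \<subseteq> E\<^sup>+"
      by (intro step) auto
    then show ?thesis using assms by blast
  qed
  then have w: "(w, w) \<in> E\<^sup>+" if "(y, w) \<in> E\<^sup>*" "(w, y) \<in> E\<^sup>*" for w
    using that by (meson rtrancl_trancl_trancl trancl_rtrancl_trancl)
  show ?thesis
    unfolding smooth_def
  proof (intro ballI)
    fix u assume "u \<in> {w. (y, w) \<in> E\<^sup>* \<and> (w, y) \<in> E\<^sup>*}"
    then have u: "(y, u) \<in> E\<^sup>*" "(u, y) \<in> E\<^sup>*" by auto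
    obtain s where s: "(u, s) \<in> E" "(s, u) \<in> E\<^sup>*" using tranclD[OF w[OF u]] by blast
    obtain t where t: "(t, u) \<in> E" "(u, t) \<in> E\<^sup>*" using tranclD2[OF w[OF u]] by blast
    have "(y, s) \<in> E\<^sup>*" "(s, y) \<in> E\<^sup>*" "(y, t) \<in> E\<^sup>*" "(t, y) \<in> E\<^sup>*"
      using rtrancl_into_rtrancl[OF u(1) s(1)] rtrancl_trans[OF s(2) u(2)]
        rtrancl_trans[OF u(1) t(2)] converse_rtrancl_into_rtrancl[OF t(1) u(2)] by simp_all
    then show "(\<exists>v\<in>{w. (y, w) \<in> E\<^sup>* \<and> (w, y) \<in> E\<^sup>*}. (u, v) \<in> E) \<and>
        (\<exists>v\<in>{w. (y, w) \<in> E\<^sup>* \<and> (w, y) \<in> E\<^sup>*}. (v, u) \<in> E)"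
      using s(1) t(1) by auto
  qed
qed

text \<open>No edge leaves \<open>U\<close>, so by totality every vertex outside dominates every
  vertex inside. Each side contains a cycle and lies in the neighbourhood of a vertex on the other
  side, which is proper and invariant.\<close>

lemma not_strong_projective:
  assumes U: "U \<subseteq> V" "U \<noteq> {}" "U \<noteq> V" "E `` U \<subseteq> U"
  shows "projective F V"
proof -
  have finU: "finite U" "finite (V - U)" using finV rev_finite_subset[OF finV U(1)] by auto
  have "\<exists>y\<in>V - U. (y, x) \<in> E" if "x \<in> V - U" for x
    using inn[of x] that inV U(4) by blast
  then obtain K1 where K1: "K1 \<subseteq> V - U" "K1 \<noteq> {}" "smooth K1 E"
    using ex_smooth_subset[OF finU(2), of E] U by blast
  have "\<exists>y\<in>U. (y, x) \<in> E\<inverse>" if "x \<in> U" for x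
    using out[of x] that U by blast
  then obtain K2 where K2: "K2 \<subseteq> U" "K2 \<noteq> {}" "smooth K2 E"
    using ex_smooth_subset[OF finU(1), of "E\<inverse>"] U by auto
  have dom: "(x, y) \<in> E" if "x \<in> V - U" "y \<in> U" for x y
    using tot[of x y] that U by blast
  obtain k1 where k1: "k1 \<in> K1" using K1 by blast
  obtain k2 where k2: "k2 \<in> K2" using K2 by blast
  let ?S1 = "E\<inverse> `` {k2}" and ?S2 = "E `` {k1}"
  have k12: "k1 \<in> V" "k2 \<in> V" using k1 k2 K1 K2 U by blast+
  have S1: "invar F ?S1" "?S1 \<subset> V" "V - U \<subseteq> ?S1"
    using inv_in[OF sing] in_psubset k12 dom k2 K2 by blast+
  have S2: "invar F ?S2" "?S2 \<subset> V" "U \<subseteq> ?S2"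
    using inv_out[OF sing] out_psubset k12 dom k1 K1 by blast+
  have K1S: "K1 \<subseteq> ?S1" and K2S: "K2 \<subseteq> ?S2" using K1 K2 S1 S2 by blast+
  have i1: "invar F K1" using cycle_invar[OF S1(1,2) K1S K1(3,2)] .
  have i2: "invar F K2" using cycle_invar[OF S2(1,2) K2S K2(3,2)] .
  have n1: "\<not> branching K1 E" using cycle_nobranch[OF S1(1,2) K1S K1(3)] .
  have n2: "\<not> branching K2 E" using cycle_nobranch[OF S2(1,2) K2S K2(3)] .
  have m1: "\<not> branching K1 (E\<inverse>)"
    using min_hard.cycle_nobranch[OF dual S1(1,2) K1S] K1 by simp
  have m2: "\<not> branching K2 (E\<inverse>)"
    using min_hard.cycle_nobranch[OF dual S2(1,2) K2S] K2 by simp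
  \<comment> \<open>Used to make the union of the two cycles invariant: it consists of exactly the
    vertices with a closed walk of length six.\<close>
  let ?W = "E O E O E O E O E O E"
  have W: "invar2 F ?W" by (intro invar2_relcomp E)
  have walk: "y \<in> K1 \<union> K2" if y: "(y, y) \<in> ?W" for y
  proof -
    let ?Y = "{w. (y, w) \<in> E\<^sup>* \<and> (w, y) \<in> E\<^sup>*}"
    have sm: "smooth ?Y E" by (rule closed_walk_smooth[OF y])
    have yY: "y \<in> ?Y" by simp
    have yV: "y \<in> V" using y inV by blast
    have clU: "w \<in> U" if "(u, w) \<in> E\<^sup>*" "u \<in> U" for u w
      using that by (induction rule: rtrancl_induct) (use U in blast)+
    have clV: "w \<in> V" if "(y, w) \<in> E\<^sup>*" for w
      using that yV by (induction rule: rtrancl_induct) (use inV in blast)+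
    show ?thesis
    proof (cases "y \<in> U")
      case True
      then have "?Y \<subseteq> ?S2" using clU S2 by blast
      then have "?Y = K2" using cycle_unique[OF S2(1,2) _ sm _ K2S K2(3,2)] yY by blast
      then show ?thesis using yY by blast
    next
      case False
      then have "?Y \<subseteq> V - U" using clU clV by blast
      then have "?Y \<subseteq> ?S1" using S1 by blast
      then have "?Y = K1" using cycle_unique[OF S1(1,2) _ sm _ K1S K1(3,2)] yY by blast
      then show ?thesis using yY by blast
    qed
  qed
  have KV: "K1 \<subseteq> V" "K2 \<subseteq> V" using K1 K2 U by blast+
  have i12: "invar F (K1 \<union> K2)"
    unfolding invar_def
  proof (intro ballI allI impI)
    fix f and x :: "nat \<Rightarrow> 'a" assume f: "f \<in> F" and x: "\<forall>i. x i \<in> K1 \<union> K2"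
    have "(x i, x i) \<in> ?W" for i
      using cycle_six[OF KV(1) K1(3) n1] cycle_six[OF KV(2) K2(3) n2] x by blast
    then have "(f x, f x) \<in> ?W" by (rule invar2D[OF W f])
    then show "f x \<in> K1 \<union> K2" by (rule walk)
  qed
  have "projective F (K1 \<union> K2)"
  proof (rule two_cycles_projective[OF fin i1 i2 i12 _ E K1(3) K2(3) K1(2) K2(2)])
    show "invar F {v}" if "v \<in> K1 \<union> K2" for v using sing KV that by blast
    show "(v, v) \<notin> E" for v by (rule irr)
    show "K1 \<inter> K2 = {}" using K1 K2 by blast
    show "(x, y) \<in> E" if "x \<in> K1" "y \<in> K2" for x y using dom K1 K2 that by blast
    show "v = w" if "u \<in> K1" "v \<in> K1" "w \<in> K1" "(u, v) \<in> E" "(u, w) \<in> E" for u v w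
      using n1 that unfolding branching_def by blast
    show "v = w" if "u \<in> K2" "v \<in> K2" "w \<in> K2" "(u, v) \<in> E" "(u, w) \<in> E" for u v w
      using n2 that unfolding branching_def by blast
    show "v = w" if "u \<in> K1" "v \<in> K1" "w \<in> K1" "(v, u) \<in> E" "(w, u) \<in> E" for u v w
      using m1 that unfolding branching_def by blast
    show "v = w" if "u \<in> K2" "v \<in> K2" "w \<in> K2" "(v, u) \<in> E" "(w, u) \<in> E" for u v w
      using m2 that unfolding branching_def by blast
  qed
  then show ?thesis by (rule projective_mono) (use KV in blast)
qed

section \<open>A cycle in a proper invariant set of a strong digraph\<close>

lemma ex_proper_cycle:
  assumes strong: strong
  obtains S K where "invar F S" "S \<subset> V" "K \<subseteq> S" "smooth K E" "K \<noteq> {}"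
proof -
  have reach: "{w. (v, w) \<in> E\<^sup>+} = V" if v: "v \<in> V" for v
  proof (rule strongD[OF strong])
    show "{w. (v, w) \<in> E\<^sup>+} \<subseteq> V" using EV trancl_subset_Sigma by blast
    show "{w. (v, w) \<in> E\<^sup>+} \<noteq> {}" using out[OF v] by blast
    show "E `` {w. (v, w) \<in> E\<^sup>+} \<subseteq> {w. (v, w) \<in> E\<^sup>+}" by (auto intro: trancl_into_trancl)
  qed
  obtain v0 u0 w0 where v0: "v0 \<in> V" "u0 \<in> V" "w0 \<in> V" "(v0, u0) \<in> E" "(v0, w0) \<in> E" "u0 \<noteq> w0"
    using hard unfolding hard_def branching_def by blast
  obtain p where p: "p > 0" "(v0, v0) \<in> E ^^ p"
    using reach[OF v0(1)] v0(1) trancl_power[of "(v0, v0)" E] by blast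
  have rV: "w \<in> V" if "(v, w) \<in> E ^^ n" "v \<in> V" for v w n
    using that by (induction n arbitrary: w) (auto dest: inV)
  \<comment> \<open>That \<open>V\<close> is the only set closed under walks of length
    \<open>p\<close> plays the role of aperiodicity: it yields a single walk length that leads from
    \<open>v0\<close> to every vertex.\<close>
  define cl where "cl X \<longleftrightarrow> X \<noteq> {} \<and> X \<subseteq> V \<and> (E ^^ p) `` X \<subseteq> X" for X
  have "cl V" unfolding cl_def using rV v0 by blast
  have "\<exists>M. cl M \<and> (\<forall>M'. cl M' \<longrightarrow> card M \<le> card M')"
    using \<open>cl V\<close> by (rule ex_has_least_nat)
  then obtain M where M: "cl M" and least: "\<And>M'. cl M' \<Longrightarrow> card M \<le> card M'" by blast
  have MV: "M \<subseteq> V" "M \<noteq> {}" using M unfolding cl_def by auto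
  have minM: "M' = M" if "cl M'" "M' \<subseteq> M" for M'
    using least[OF that(1)] that(2) MV(1) finV by (meson card_seteq rev_finite_subset)
  have comm: "(E ^^ p) `` (E `` X) = E `` ((E ^^ p) `` X)" for X
    using relpow_commute[of E p] by (auto simp: relcomp_Image[symmetric])
  have "M = V"
  proof (rule ccontr)
    assume MneV: "M \<noteq> V"
    show False
    proof (cases "\<exists>u\<in>M. \<exists>w\<in>M. u \<noteq> w")
      case True
      then obtain u w where uw: "u \<in> M" "w \<in> M" "(u, w) \<in> E" using tot MV by blast
      \<comment> \<open>Powers of \<open>E\<close> commute with \<open>E\<close>, so the successors
        of \<open>M\<close> inside \<open>M\<close> form a closed set again. By minimality
        \<open>M\<close> is contained in its image; images then grow with the number of steps, and
        after \<open>p\<close> steps they are back in \<open>M\<close>.\<close>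
      have "(E ^^ p) `` (E `` M \<inter> M) \<subseteq> E `` M \<inter> M"
        using M comm[of M] unfolding cl_def by blast
      then have "cl (E `` M \<inter> M)" using uw MV unfolding cl_def by blast
      then have sub: "M \<subseteq> E `` M" using minM by blast
      have "E `` M \<subseteq> (E ^^ Suc n) `` M" for n
      proof (induction n)
        case (Suc n)
        have "(E ^^ Suc n) `` M \<subseteq> (E ^^ Suc n) `` (E `` M)" using sub by blast
        also have "\<dots> = (E ^^ Suc (Suc n)) `` M"
          using relpow_commute[of E "Suc n"] by (simp add: relcomp_Image[symmetric])
        finally show ?case using Suc by blast
      qed simp
      then have "E `` M \<subseteq> M" using M p(1) unfolding cl_def by (metis Suc_pred order_trans)
      then show False using strongD[OF strong MV] MneV by blast
    next
      case False
      then obtain v where v: "M = {v}" using MV by blast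
      have vV: "v \<in> V" using v MV by blast
      have home: "(v, w) \<in> E ^^ (p * k) \<Longrightarrow> w = v" for k w
      proof (induction k arbitrary: w)
        case (Suc k)
        then obtain z where "(v, z) \<in> E ^^ (p * k)" "(z, w) \<in> E ^^ p"
          by (auto simp: relpow_add add.commute[of p])
        then show ?case using Suc.IH M unfolding cl_def v by blast
      qed simp
      have ext: "\<exists>z. (w, z) \<in> E ^^ n" if wV: "w \<in> V" for w n
      proof (induction n)
        case (Suc n)
        then obtain z where z: "(w, z) \<in> E ^^ n" by blast
        then obtain z' where "(z, z') \<in> E" using out rV wV by blast
        then show ?case using z by auto
      qed simp
      \<comment> \<open>The edge would give a walk of length \<open>p * i + 1\<close> from
        \<open>v\<close> to \<open>v\<close>. Every walk from \<open>v\<close> is at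
        \<open>v\<close> after \<open>p * i\<close> steps, so a loop at \<open>v\<close> would
        follow.\<close>
      have noedge: "False" if u: "(v, u) \<in> E ^^ i" and w: "(v, w) \<in> E ^^ i" and e: "(u, w) \<in> E" for u w i
      proof -
        have "i \<le> p * i" using p(1) by simp
        then obtain j where j: "p * i = i + j" using le_Suc_ex by blast
        obtain z where z: "(w, z) \<in> E ^^ j" using ext inV(2)[OF e] by blast
        then have "(v, z) \<in> E ^^ (p * i)" unfolding j relpow_add using w by blast
        then have "z = v" by (rule home)
        then have "(w, v) \<in> E ^^ j" using z by simp
        then have "(v, v) \<in> E ^^ i O (E O E ^^ j)" using u e by blast
        also have "E ^^ i O (E O E ^^ j) = E ^^ (p * i) O E"
          unfolding j relpow_add using relpow_commute[of E j] by (simp add: O_assoc)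
        finally obtain y where "(v, y) \<in> E ^^ (p * i)" "(y, v) \<in> E" by blast
        then show False using home irr by blast
      qed
      have single: "u = w" if "(v, u) \<in> E ^^ i" "(v, w) \<in> E ^^ i" for u w i
        using tot[of u w] noedge[of u i w] noedge[of w i u] that rV vV by blast
      obtain i where "(v, v0) \<in> E ^^ i"
        using reach[OF vV] v0(1) by (metis mem_Collect_eq trancl_power)
      then have "(v, u0) \<in> E ^^ Suc i" "(v, w0) \<in> E ^^ Suc i" using v0 by auto
      then show False using single v0(6) by blast
    qed
  qed
  define W where "W = {w. \<exists>k. (v0, w) \<in> E ^^ (p * k)}"
  have "(E ^^ p) `` W \<subseteq> W"
  proof
    fix w assume "w \<in> (E ^^ p) `` W"
    then obtain k where "(v0, w) \<in> E ^^ (p * k) O E ^^ p" unfolding W_def by blast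
    then have "(v0, w) \<in> E ^^ (p * Suc k)"
      by (simp add: relpow_add[symmetric] add.commute)
    then show "w \<in> W" unfolding W_def by blast
  qed
  moreover have "v0 \<in> W" unfolding W_def by (auto intro!: exI[of _ 0])
  moreover have "W \<subseteq> V" unfolding W_def using rV v0(1) by blast
  ultimately have "cl W" unfolding cl_def by blast
  then have WV: "W = V" using minM[of W] \<open>M = V\<close> \<open>W \<subseteq> V\<close> by blast
  \<comment> \<open>The closed walk of length \<open>p\<close> at \<open>v0\<close> pads walks to a
    common length.\<close>
  have up: "(v0, w) \<in> E ^^ (p * (j + k))" if "(v0, w) \<in> E ^^ (p * k)" for w j k
  proof (induction j)
    case (Suc j)
    then have "(v0, w) \<in> E ^^ p O E ^^ (p * (j + k))" using p(2) by blast
    then show ?case by (simp add: relpow_add[symmetric])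
  qed (use that in simp)
  have "\<forall>w\<in>V. \<exists>k. (v0, w) \<in> E ^^ (p * k)" using WV unfolding W_def by blast
  then obtain k where k: "\<And>w. w \<in> V \<Longrightarrow> (v0, w) \<in> E ^^ (p * k w)" by metis
  have "(v0, w) \<in> E ^^ (p * Max (k ` V))" if w: "w \<in> V" for w
  proof -
    have "k w \<le> Max (k ` V)" using finV w by simp
    then show ?thesis using up[OF k[OF w], of "Max (k ` V) - k w"] by simp
  qed
  then have ex: "\<exists>n. (E ^^ n) `` {v0} = V" using rV v0(1) by blast
  \<comment> \<open>One step before the images of \<open>v0\<close> fill \<open>V\<close>, the image
    is still proper, but each of its vertices has a predecessor in it; so it contains a
    cycle.\<close>
  define n where "n = (LEAST n. (E ^^ n) `` {v0} = V)"
  have n: "(E ^^ n) `` {v0} = V" unfolding n_def using ex by (rule LeastI_ex)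
  have "n \<noteq> 0"
  proof
    assume "n = 0"
    then have "V = {v0}" using n by simp
    then show False using v0 by blast
  qed
  then obtain m where m: "n = Suc m" using not0_implies_Suc by blast
  let ?S = "(E ^^ m) `` {v0}"
  have SneV: "?S \<noteq> V" using not_less_Least[of m "\<lambda>n. (E ^^ n) `` {v0} = V"] m unfolding n_def by simp
  have SV: "?S \<subset> V" using SneV rV v0(1) by blast
  have ES: "E `` ?S = V" using n unfolding m by (simp add: relcomp_Image)
  have "invar F ((E ^^ i) `` {v0})" for i
  proof (induction i)
    case 0 then show ?case using sing[OF v0(1)] by simp
  next
    case (Suc i) then show ?case using inv_out by (simp add: relcomp_Image)
  qed
  then have inv: "invar F ?S" .
  have finS: "finite ?S" using SV finV by (meson finite_subset psubset_imp_subset)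
  have neS: "?S \<noteq> {}" using ES v0(1) by blast
  have "\<exists>y\<in>?S. (y, x) \<in> E" if "x \<in> ?S" for x
    using ES SV that by blast
  then obtain K where K: "K \<subseteq> ?S" "K \<noteq> {}" "smooth K E"
    using ex_smooth_subset[OF finS neS, of E] by blast
  show thesis by (rule that[OF inv SV K(1,3,2)])
qed

text \<open>Invariant sets made from one- and two-step neighbourhoods contain \<open>a\<close>,
  \<open>b\<close> and a vertex between them, so \<open>two_cycles\<close> makes them all of
  \<open>V\<close>. This forces further neighbours inside \<open>M1\<close>, which ends in a loop or
  a forbidden cycle unless \<open>V\<close> has three vertices.\<close>

lemma mixed_two_cycle:
  assumes C: "invar F {a, b}" and ab: "(a, b) \<in> E" "(b, a) \<in> E"
    and sa: "\<And>x. (a, x) \<in> E \<Longrightarrow> (x, a) \<in> E \<Longrightarrow> x = b"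
    and sb: "\<And>x. (b, x) \<in> E \<Longrightarrow> (x, b) \<in> E \<Longrightarrow> x = a"
    and x0: "(a, x0) \<in> E" "(x0, b) \<in> E"
  shows "V = {a, b, x0}"
proof (rule ccontr)
  assume ne3: "V \<noteq> {a, b, x0}"
  define M1 where "M1 = {x. (a, x) \<in> E \<and> (x, b) \<in> E}"
  define M2 where "M2 = {x. (b, x) \<in> E \<and> (x, a) \<in> E}"
  have aV: "a \<in> V" "b \<in> V" "x0 \<in> V" using ab x0 inV by blast+
  have inv1: "invar F M1"
  proof -
    have "M1 = E `` {a} \<inter> E\<inverse> `` {b}" unfolding M1_def by auto
    then show ?thesis using invar_Int[OF inv_out[OF sing] inv_in[OF sing]] aV by metis
  qed
  have M1V: "M1 \<subset> V" unfolding M1_def using inV aV irr by blast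
  have all: "y = a \<or> y = b \<or> y \<in> M1 \<or> y \<in> M2" if y: "y \<in> V" for y
  proof -
    have "E `` {a, b} \<inter> E\<inverse> `` {a, b} = V"
    proof (rule two_cycles)
      show "invar F (E `` {a, b} \<inter> E\<inverse> `` {a, b})"
        by (rule invar_Int[OF inv_out[OF C] inv_in[OF C]])
      show "(a, b) \<in> E" "(b, a) \<in> E" "(a, x0) \<in> E" "(x0, b) \<in> E" by fact+
    qed (use ab x0 inV in blast)+
    then have "y \<in> E `` {a, b}" "y \<in> E\<inverse> `` {a, b}" using y by blast+
    then show ?thesis using sa[of y] sb[of y] unfolding M1_def M2_def by auto
  qed
  have M1: "(a, x) \<in> E" "(x, b) \<in> E" "(x, a) \<notin> E" "(b, x) \<notin> E" if "x \<in> M1" for x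
    using that sa[of x] sb[of x] irr unfolding M1_def by auto
  have M2: "(b, x) \<in> E" "(x, a) \<in> E" "(a, x) \<notin> E" "(x, b) \<notin> E" if "x \<in> M2" for x
    using that sa[of x] sb[of x] irr unfolding M2_def by auto
  have x0M: "x0 \<in> M1" using x0 unfolding M1_def by blast
  show False
  proof (cases "M2 = {}")
    case False
    then obtain y where y: "y \<in> M2" by blast
    have M1single: "x = x0" if x: "x \<in> M1" for x
    proof (rule ccontr)
      assume "x \<noteq> x0"
      then have edge: "\<exists>u\<in>M1. \<exists>s\<in>M1. (u, s) \<in> E" using tot[of x x0] x x0M M1V by blast
      \<comment> \<open>\<open>M1\<close> contains at most one cycle. If there is one,
        \<open>u\<close> is chosen on it, so that the out-neighbours of \<open>u\<close>, not
        including \<open>u\<close>, contain none.\<close>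
      obtain u s where us: "u \<in> M1" "s \<in> M1" "(u, s) \<in> E"
        and acyc: "\<And>L. L \<subseteq> M1 \<inter> E `` {u} \<Longrightarrow> L \<noteq> {} \<Longrightarrow> \<not> smooth L E"
      proof (cases "\<exists>L\<subseteq>M1. L \<noteq> {} \<and> smooth L E")
        case True
        then obtain L where L: "L \<subseteq> M1" "L \<noteq> {}" "smooth L E" by blast
        then obtain u where u: "u \<in> L" by blast
        then obtain s where s: "s \<in> L" "(u, s) \<in> E" using L(3) unfolding smooth_def by blast
        have "\<not> smooth L' E" if L': "L' \<subseteq> M1 \<inter> E `` {u}" "L' \<noteq> {}" for L'
        proof
          assume "smooth L' E"
          then have "L' = L" using cycle_unique[OF inv1 M1V, of L' L] L L' by blast
          then show False using u L' irr by blast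
        qed
        then show ?thesis by (intro that[of u s]) (use L u s in auto)
      next
        case False
        obtain u s where us: "u \<in> M1" "s \<in> M1" "(u, s) \<in> E" using edge by blast
        have "\<not> smooth L E" if "L \<subseteq> M1 \<inter> E `` {u}" "L \<noteq> {}" for L
          using False that by (meson le_inf_iff)
        then show ?thesis by (rule that[OF us])
      qed
      let ?S = "E `` (E `` {a} \<inter> E `` {u})"
      have uV: "u \<in> V" using us M1V by blast
      have bS: "b \<in> E `` {a} \<inter> E `` {u}" using ab M1[OF us(1)] by blast
      have sS: "s \<in> E `` {a} \<inter> E `` {u}" using us M1[OF us(2)] by blast
      have S: "?S = V"
      proof (rule two_cycles)
        show "invar F ?S" by (intro inv_out invar_Int sing aV uV)
        show "(b, a) \<in> E" "(a, b) \<in> E" "(b, y) \<in> E" "(y, a) \<in> E" using ab M2[OF y] by auto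
        show "?S \<subseteq> V" by (rule E_sub)
        show "a \<in> ?S" "y \<in> ?S" using bS ab M2[OF y] by blast+
        show "b \<in> ?S" using sS M1[OF us(2)] by blast
      qed
      let ?O = "M1 \<inter> E `` {u}"
      have "\<exists>z\<in>?O. (z, m) \<in> E" if m: "m \<in> ?O" for m
      proof -
        have mM: "m \<in> M1" using m by blast
        have "m \<in> ?S" using S mM M1V by blast
        then obtain z where z: "(a, z) \<in> E" "(u, z) \<in> E" "(z, m) \<in> E" by blast
        have "z \<noteq> a" "z \<noteq> b" using z irr M1[OF mM] by blast+
        then have "z \<in> M1" using all[OF inV(1)[OF z(3)]] z M2[of z] by blast
        then show ?thesis using z by blast
      qed
      moreover have "finite ?O" using M1V finV by (meson finite_Int finite_subset psubset_imp_subset)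
      moreover have "?O \<noteq> {}" using us by blast
      ultimately obtain L where "L \<subseteq> ?O" "L \<noteq> {}" "smooth L E" using ex_smooth_subset[of ?O E] by blast
      then show False using acyc by blast
    qed
    let ?S = "E\<inverse> `` (E\<inverse> `` {b})"
    have S: "?S = V"
    proof (rule two_cycles)
      show "invar F ?S" by (intro inv_in sing aV)
      show "(b, a) \<in> E" "(a, b) \<in> E" "(b, y) \<in> E" "(y, a) \<in> E" using ab M2[OF y] by auto
      show "?S \<subseteq> V" by (rule E_sub)
      show "a \<in> ?S" "b \<in> ?S" "y \<in> ?S" using ab x0 M2[OF y] by blast+
    qed
    then obtain z where z: "(x0, z) \<in> E" "(z, b) \<in> E" using aV by blast
    have "z \<noteq> a" "z \<noteq> b" using z irr M1[OF x0M] by blast+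
    then have "z \<in> M1" using all[OF inV(1)[OF z(2)]] z M2[of z] by blast
    then show False using M1single z irr by blast
  next
    case True
    obtain x1 where x1: "x1 \<in> M1" "x1 \<noteq> x0"
    proof -
      have "\<exists>x\<in>V. x \<notin> {a, b, x0}" using ne3 aV by blast
      then show ?thesis using all True that by blast
    qed
    obtain u s where us: "u \<in> M1" "s \<in> M1" "(u, s) \<in> E"
      using tot[of x1 x0] x1 x0M M1V by blast
    have mid: "z \<in> M1" if "(z, m) \<in> E \<and> (a, z) \<in> E \<or> (m, z) \<in> E \<and> (z, b) \<in> E" "m \<in> M1" for z m
    proof -
      have "z \<noteq> a" "z \<noteq> b" using that irr M1[OF that(2)] by blast+
      then show ?thesis using all[of z] that inV True by blast
    qed
    have succ: "\<exists>z\<in>M1. (m, z) \<in> E" if m: "m \<in> M1" for m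
    proof -
      let ?S = "E\<inverse> `` (E\<inverse> `` {b})"
      have "?S = V"
      proof (rule two_cycles)
        show "invar F ?S" by (intro inv_in sing aV)
        show "(a, b) \<in> E" "(b, a) \<in> E" "(a, u) \<in> E" "(u, b) \<in> E" using ab M1[OF us(1)] by auto
        show "?S \<subseteq> V" by (rule E_sub)
        show "a \<in> ?S" "b \<in> ?S" using ab x0 by blast+
        show "u \<in> ?S" using us(3) M1[OF us(2)] by blast
      qed
      then obtain z where "(m, z) \<in> E" "(z, b) \<in> E" using m M1V by blast
      then show ?thesis using mid m by blast
    qed
    have pred: "\<exists>z\<in>M1. (z, m) \<in> E" if m: "m \<in> M1" for m
    proof -
      let ?S = "E `` (E `` {a})"
      have "?S = V"
      proof (rule two_cycles)
        show "invar F ?S" by (intro inv_out sing aV)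
        show "(a, b) \<in> E" "(b, a) \<in> E" "(a, s) \<in> E" "(s, b) \<in> E" using ab M1[OF us(2)] by auto
        show "?S \<subseteq> V" by (rule E_sub)
        show "a \<in> ?S" "b \<in> ?S" using ab x0 by blast+
        show "s \<in> ?S" using us(3) M1[OF us(1)] by blast
      qed
      then obtain z where "(z, m) \<in> E" "(a, z) \<in> E" using m M1V by blast
      then show ?thesis using mid m by blast
    qed
    have sm: "smooth M1 E" unfolding smooth_def using succ pred by blast
    have nb: "\<not> branching M1 E" by (rule cycle_nobranch[OF inv1 M1V subset_refl sm])
    obtain t where t: "t \<in> M1" "(t, u) \<in> E" using pred[OF us(1)] by blast
    \<comment> \<open>If this is everything, a path of length two leads from \<open>u\<close> to
      \<open>s\<close>. Its midpoint lies in \<open>M1\<close>, where \<open>s\<close> is the only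
      successor of \<open>u\<close>, so there is a loop at \<open>s\<close>.\<close>
    let ?S = "E\<inverse> `` (E\<inverse> `` {s})"
    have sV: "s \<in> V" using us M1V by blast
    have "?S = V"
    proof (rule two_cycles)
      show "invar F ?S" by (intro inv_in sing sV)
      show "(a, b) \<in> E" "(b, a) \<in> E" "(a, t) \<in> E" "(t, b) \<in> E" using ab M1[OF t(1)] by auto
      show "?S \<subseteq> V" by (rule E_sub)
      show "a \<in> ?S" using us M1[OF us(1)] by blast
      show "b \<in> ?S" using ab M1[OF us(2)] by blast
      show "t \<in> ?S" using us t by blast
    qed
    then obtain z where z: "(u, z) \<in> E" "(z, s) \<in> E" using us M1V by blast
    have "z \<noteq> a" "z \<noteq> b" using z M1[OF us(1)] M1[OF us(2)] by blast+
    then have "z \<in> M1" using all[of z] z inV True by blast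
    then have "z = s" using nb us z unfolding branching_def by blast
    then show False using z irr by blast
  qed
qed

section \<open>Cycles that form a module\<close>

text \<open>\<open>Z\<close> consists of the vertices reached in two steps from the predecessor of \<open>g\<close> on the cycle.\<close>

lemma module_cycle:
  assumes strong: strong
    and C: "C \<subset> V" "C \<noteq> {}" "smooth C E" "\<not> branching C E"
    and module: "\<And>x. x \<in> V - C \<Longrightarrow> (\<forall>c\<in>C. (c, x) \<in> E \<and> (x, c) \<notin> E) \<or> (\<forall>c\<in>C. (x, c) \<in> E \<and> (c, x) \<notin> E)"
  obtains g e h x y Z where "g \<in> C" "e \<in> C" "h \<in> C" "(g, e) \<in> E" "(e, h) \<in> E"
    "x \<in> V - C" "y \<in> V - C" "(x, y) \<in> E"
    "\<forall>c\<in>C. (c, x) \<in> E \<and> (x, c) \<notin> E" "\<forall>c\<in>C. (y, c) \<in> E \<and> (c, y) \<notin> E"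
    "invar F Z" "Z \<subset> V" "{e, x, y} \<subseteq> Z" "g \<notin> Z"
    "\<forall>u\<in>V - C. (\<forall>c\<in>C. (c, u) \<in> E) \<longrightarrow> u \<in> Z \<and> E `` {u} \<subseteq> Z"
proof -
  define X where "X = {x \<in> V - C. \<forall>c\<in>C. (c, x) \<in> E \<and> (x, c) \<notin> E}"
  define Y where "Y = {x \<in> V - C. \<forall>c\<in>C. (x, c) \<in> E \<and> (c, x) \<notin> E}"
  have X: "x \<in> V" "x \<notin> C" "c \<in> C \<Longrightarrow> (c, x) \<in> E" "c \<in> C \<Longrightarrow> (x, c) \<notin> E" if "x \<in> X" for x c
    using that unfolding X_def by auto
  have VXY: "z \<in> C \<or> z \<in> X \<or> z \<in> Y" if "z \<in> V" for z
    using module[of z] that unfolding X_def Y_def by auto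
  have CX: "z \<in> C \<or> z \<in> X" if "(c, z) \<in> E" "c \<in> C" for c z
    using VXY[OF inV(2)[OF that(1)]] that unfolding Y_def by auto
  have "X \<noteq> {}"
  proof
    assume "X = {}"
    then have "E `` C \<subseteq> C" using CX by blast
    then show False using strongD[OF strong, of C] C by blast
  qed
  moreover have "X \<subseteq> V" unfolding X_def by blast
  moreover have "X \<noteq> V" using C unfolding X_def by blast
  ultimately have "\<not> E `` X \<subseteq> X" using strongD[OF strong, of X] by blast
  then obtain x y where xy: "x \<in> X" "y \<notin> X" "(x, y) \<in> E" by blast
  then have y: "y \<in> Y" using VXY[OF inV(2)[OF xy(3)]] X by blast
  obtain c where c: "c \<in> C" using C(2) by blast
  obtain g where g: "g \<in> C" "(c, g) \<in> E" using C(3) c unfolding smooth_def by blast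
  obtain e where e: "e \<in> C" "(g, e) \<in> E" using C(3) g(1) unfolding smooth_def by blast
  obtain h where h: "h \<in> C" "(e, h) \<in> E" using C(3) e(1) unfolding smooth_def by blast
  let ?Z = "E `` (E `` {c})"
  have cV: "c \<in> V" using c C by blast
  \<comment> \<open>A path of length two from \<open>c\<close> to \<open>g\<close> cannot pass
    through \<open>X\<close>, which sends no edge into \<open>C\<close>, and within \<open>C\<close>
    the only successor of \<open>c\<close> is \<open>g\<close> itself.\<close>
  have gZ: "g \<notin> ?Z"
  proof
    assume "g \<in> ?Z"
    then obtain w where w: "(c, w) \<in> E" "(w, g) \<in> E" by blast
    have "w \<in> C" using CX[OF w(1) c] X(4)[of w g] g w by blast
    then have "w = g" using C(4) c g w unfolding branching_def by blast
    then show False using w irr by blast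
  qed
  show thesis
  proof (rule that[of g e h x y ?Z])
    show "x \<in> V - C" "\<forall>c\<in>C. (c, x) \<in> E \<and> (x, c) \<notin> E" using xy unfolding X_def by auto
    show "y \<in> V - C" "\<forall>c\<in>C. (y, c) \<in> E \<and> (c, y) \<notin> E" using y unfolding Y_def by auto
    show "invar F ?Z" by (intro inv_out sing cV)
    have gV: "g \<in> V" using g C by blast
    show "?Z \<subset> V" using gZ gV E_sub(1) by blast
    have "(c, x) \<in> E" "(g, x) \<in> E" using X[OF xy(1)] c g by auto
    then show "{e, x, y} \<subseteq> ?Z" using g e xy(3) by blast
    show "\<forall>u\<in>V - C. (\<forall>c\<in>C. (c, u) \<in> E) \<longrightarrow> u \<in> ?Z \<and> E `` {u} \<subseteq> ?Z"
      using c g by blast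
  qed (fact g e h gZ xy)+
qed

text \<open>
  The relation \<open>E O E\<close> contains the reverse of the invariant 3-cycle \<open>e, x, y\<close>, two more
  edges, and possibly a loop at \<open>e\<close>; intersecting it with its rotation removes the loop.
\<close>

lemma module_no_double_edges:
  assumes strong: strong
    and C: "C \<subset> V" "C \<noteq> {}" "smooth C E" "\<not> branching C E"
    and module: "\<And>x. x \<in> V - C \<Longrightarrow> (\<forall>c\<in>C. (c, x) \<in> E \<and> (x, c) \<notin> E) \<or> (\<forall>c\<in>C. (x, c) \<in> E \<and> (c, x) \<notin> E)"
    and double: "\<And>x y. (x, y) \<in> E \<Longrightarrow> (y, x) \<in> E \<Longrightarrow> x \<in> C"
  shows False
proof -
  obtain g e h x y Z where C': "g \<in> C" "e \<in> C" "h \<in> C" "(g, e) \<in> E" "(e, h) \<in> E"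
    and xy: "x \<in> V - C" "y \<in> V - C" "(x, y) \<in> E"
    "\<forall>c\<in>C. (c, x) \<in> E \<and> (x, c) \<notin> E" "\<forall>c\<in>C. (y, c) \<in> E \<and> (c, y) \<notin> E"
    and Z: "invar F Z" "Z \<subset> V" "{e, x, y} \<subseteq> Z" "g \<notin> Z"
    by (rule module_cycle[OF strong C module]) blast
  let ?T = "{e, x, y}"
  have ed: "(e, x) \<in> E" "(g, x) \<in> E" "(h, x) \<in> E" "(y, e) \<in> E" "(y, g) \<in> E" "(y, h) \<in> E"
    "(x, e) \<notin> E" "(e, y) \<notin> E"
    using C' xy by auto
  have yx: "(y, x) \<notin> E" using double[of x y] xy by auto
  have d: "e \<noteq> x" "e \<noteq> y" "x \<noteq> y" using C' xy ed irr by auto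
  have sT: "smooth ?T E" by (rule smooth_triple) (use ed xy in auto)
  have iT: "invar F ?T" by (rule cycle_invar[OF Z(1-3) sT]) simp
  have TV: "?T \<subset> V" using Z by blast
  define s where "s = E \<inter> ?T \<times> ?T"
  define R1 where "R1 = E O E"
  define R where "R = R1 \<inter> s O R1 O s\<inverse>"
  have s: "s = {(e, x), (x, y), (y, e)}"
    unfolding s_def using ed xy yx irr d by auto
  have inv_s: "invar2 F s" unfolding s_def by (intro invar2_Int invar2_Times E iT)
  have iR: "invar2 F R" unfolding R_def R1_def by (intro invar2_Int invar2_relcomp invar2_converse E inv_s)
  have RI: "(u, v) \<in> R" if "(u, v) \<in> R1" "(u, u') \<in> s" "(v, v') \<in> s" "(u', v') \<in> R1" for u v u' v'
    unfolding R_def using that by auto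
  \<comment> \<open>The first three edges run along the 3-cycle \<open>e\<close>, \<open>x\<close>,
    \<open>y\<close>. The paths from \<open>y\<close> through \<open>g\<close> to \<open>e\<close>
    and from \<open>e\<close> through \<open>h\<close> to \<open>x\<close> give the other
    two.\<close>
  have R1: "(x, e) \<in> R1" "(y, x) \<in> R1" "(e, y) \<in> R1" "(y, e) \<in> R1" "(e, x) \<in> R1"
    unfolding R1_def using ed xy C' by auto
  have ss: "(e, x) \<in> s" "(x, y) \<in> s" "(y, e) \<in> s" using s by auto
  have R: "(x, e) \<in> R" "(y, x) \<in> R" "(e, y) \<in> R" "(y, e) \<in> R"
    using RI[OF R1(1) ss(2) ss(1) R1(2)] RI[OF R1(2) ss(3) ss(2) R1(3)]
      RI[OF R1(3) ss(1) ss(3) R1(1)] RI[OF R1(4) ss(3) ss(1) R1(5)] by auto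
  have loop: "u \<in> C" if "(u, u) \<in> R1" for u
    using that double unfolding R1_def by auto
  have "(u, u) \<notin> R" if "u \<in> ?T" for u
  proof
    assume u: "(u, u) \<in> R"
    then have "u = e" using loop[of u] that xy unfolding R_def by auto
    then have "(x, x) \<in> R1" using u s d unfolding R_def by auto
    then show False using loop xy by blast
  qed
  then have "semic ?T R" unfolding semic_def using R by auto
  moreover have "smooth ?T R"
    using smooth_triple[of y x R e] R by (simp add: insert_commute)
  ultimately have "\<not> branching ?T R" using nobranch[OF iT TV iR] by blast
  then show False using R d unfolding branching_def by blast
qed

text \<open>The double edge at \<open>x\<close> and the 3-cycle \<open>e\<close>, \<open>x\<close>,
  \<open>y\<close> are two different smooth subsets of the proper invariant set
  \<open>Z\<close>.\<close>

lemma module_double_edge: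
  assumes strong: strong
    and C: "C \<subset> V" "C \<noteq> {}" "smooth C E" "\<not> branching C E"
    and module: "\<And>x. x \<in> V - C \<Longrightarrow> (\<forall>c\<in>C. (c, x) \<in> E \<and> (x, c) \<notin> E) \<or> (\<forall>c\<in>C. (x, c) \<in> E \<and> (c, x) \<notin> E)"
    and double: "\<And>x. x \<in> V - C \<Longrightarrow> \<exists>y. (x, y) \<in> E \<and> (y, x) \<in> E"
  shows False
proof -
  obtain g e h x y Z where C': "g \<in> C" "e \<in> C" "h \<in> C" "(g, e) \<in> E" "(e, h) \<in> E"
    and xy: "x \<in> V - C" "y \<in> V - C" "(x, y) \<in> E"
    "\<forall>c\<in>C. (c, x) \<in> E \<and> (x, c) \<notin> E" "\<forall>c\<in>C. (y, c) \<in> E \<and> (c, y) \<notin> E"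
    and Z: "invar F Z" "Z \<subset> V" "{e, x, y} \<subseteq> Z" "g \<notin> Z"
      "\<forall>u\<in>V - C. (\<forall>c\<in>C. (c, u) \<in> E) \<longrightarrow> u \<in> Z \<and> E `` {u} \<subseteq> Z"
    by (rule module_cycle[OF strong C module]) blast
  obtain z where z: "(x, z) \<in> E" "(z, x) \<in> E" using double[OF xy(1)] by blast
  have "{x, z} \<subseteq> Z" using Z(5) xy(1,4) z by auto
  moreover have "smooth {x, z} E" using z by (rule smooth_pair)
  moreover have "smooth {e, x, y} E" by (rule smooth_triple) (use C' xy in auto)
  ultimately have "{x, z} = {e, x, y}" using cycle_unique[OF Z(1,2)] Z(3) by (meson insert_not_empty)
  then have "e = x \<or> e = z" by blast
  then show False using z xy C' by blast
qed

end

section \<open>Digraphs with three vertices\<close>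

lemma relcomp_insert: "insert (x, y) A O B = ({x} \<times> (B `` {y})) \<union> A O B"
  by auto

lemma Image_insert: "insert (u, v) A `` {y} = (if u = y then insert v (A `` {y}) else A `` {y})"
  by auto

lemma converse_insert: "(insert (u, v) A)\<inverse> = insert (v, u) (A\<inverse>)"
  by auto

text \<open>The relational terms in this section were found by a computer search over short terms.\<close>

lemma relcomp_K3_four:
  assumes d: "a \<noteq> b" "b \<noteq> c" "a \<noteq> c" and E: "E = {(a, b), (b, a), (b, c), (c, a)}"
  shows "((E\<inverse> O E) O (E O E\<inverse>) \<inter> E O E O E) O (E\<inverse> O E\<inverse> \<inter> E)
    = {(a, b), (a, c), (b, a), (b, c), (c, a), (c, b)}"
  unfolding E using d d[symmetric]
  by (simp add: relcomp_insert Image_insert converse_insert Times_insert_right Int_insert_left insert_commute)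

lemma relcomp_K3_five:
  assumes d: "a \<noteq> b" "b \<noteq> c" "a \<noteq> c" and E: "E = {(a, b), (b, a), (b, c), (c, a), (c, b)}"
  shows "E\<inverse> O (E\<inverse> \<inter> E) O E \<inter> E O E\<inverse> O E\<inverse>
    = {(a, b), (a, c), (b, a), (b, c), (c, a), (c, b)}"
  unfolding E using d d[symmetric]
  by (simp add: relcomp_insert Image_insert converse_insert Times_insert_right Int_insert_left insert_commute)


text \<open>On \<open>v\<close>, \<open>t\<close>, \<open>s\<close> the result is the 3-cycle
  \<open>v\<close>, \<open>s\<close>, \<open>t\<close> with the extra edge from \<open>v\<close> to
  \<open>t\<close>, so it branches. The two diagonal relations restrict a midpoint to the pairs
  \<open>u\<close>, \<open>t\<close> and \<open>u\<close>, \<open>v\<close>, which are invariant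
  where the lemma is applied.\<close>

lemma relcomp_wheel:
  assumes d: "u \<noteq> v" "u \<noteq> t" "u \<noteq> s" "v \<noteq> t" "v \<noteq> s" "t \<noteq> s"
    and E: "E = {(u, v), (v, u), (u, t), (t, u), (u, s), (s, u), (v, t), (t, s), (s, v)}"
  shows "(E O {(u, u), (t, t)} O E \<inter> E) O (E\<inverse> O {(u, u), (v, v)} O E \<inter> E)
    = {(s, t), (t, v), (u, v), (v, s), (v, t), (v, u)}"
  unfolding E using d d[symmetric]
  by (simp add: relcomp_insert Image_insert converse_insert Times_insert_right Int_insert_left insert_commute)

context min_hard
begin

lemma V_not_pair: "V \<noteq> {a, b}"
proof
  assume V: "V = {a, b}"
  obtain u v w where "u \<in> V" "v \<in> V" "w \<in> V" "(u, v) \<in> E" "(u, w) \<in> E" "v \<noteq> w"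
    using hard unfolding hard_def branching_def by blast
  then show False using V irr by auto
qed

lemma three_projective:
  assumes V: "V = {a, b, c}" "a \<noteq> b" "b \<noteq> c" "a \<noteq> c"
    and R: "invar2 F R" "R = {(a, b), (a, c), (b, a), (b, c), (c, a), (c, b)}"
  shows "projective F V"
proof (rule K3_projective[OF fin V])
  show "invar F {v}" if "v \<in> V" for v using sing that .
  have "R = {(x, y). x \<in> V \<and> y \<in> V \<and> x \<noteq> y}" unfolding R(2) V(1) using V(2-4) by auto
  then show "invar2 F {(x, y). x \<in> V \<and> y \<in> V \<and> x \<noteq> y}" using R(1) by simp
qed

lemma mixed_projective:
  assumes C: "invar F {a, b}" and ab: "(a, b) \<in> E" "(b, a) \<in> E"
    and sa: "\<And>x. (a, x) \<in> E \<Longrightarrow> (x, a) \<in> E \<Longrightarrow> x = b"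
    and sb: "\<And>x. (b, x) \<in> E \<Longrightarrow> (x, b) \<in> E \<Longrightarrow> x = a"
    and x: "(a, x) \<in> E" "(x, b) \<in> E"
  shows "projective F V"
proof -
  have V: "V = {b, a, x}" using mixed_two_cycle[OF assms] by blast
  have d: "b \<noteq> a" "a \<noteq> x" "b \<noteq> x" using ab x irr by auto
  have n: "(x, a) \<notin> E" "(b, x) \<notin> E" using sa[OF x(1)] sb[OF _ x(2)] d by auto
  have EV': "E \<subseteq> {b, a, x} \<times> {b, a, x}" using EV unfolding V .
  have Eeq: "E = {(b, a), (a, b), (a, x), (x, b)}"
    using EV' n irr ab x by auto
  show ?thesis
    by (rule three_projective[OF V d _ relcomp_K3_four[OF d Eeq]])
      (intro invar2_Int invar2_relcomp invar2_converse E)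
qed

section \<open>Vertices on two double edges\<close>

text \<open>Two double edges at \<open>u\<close> among the out-neighbours of \<open>v\<close> would
  be two cycles in a proper invariant set.\<close>

lemma star_unique:
  assumes "(v, u) \<in> E" "(v, w) \<in> E" "(v, t) \<in> E"
    and "(u, w) \<in> E" "(w, u) \<in> E" "(u, t) \<in> E" "(t, u) \<in> E"
  shows "w = t"
proof -
  have vV: "v \<in> V" using assms inV by blast
  have "{u, w} = {u, t}"
    by (rule cycle_unique[OF inv_out[OF sing[OF vV]] out_psubset[OF vV]])
      (use assms smooth_pair in auto)
  then show ?thesis using assms irr by (metis doubleton_eq_iff)
qed

lemma star_unique_in:
  assumes "(u, v) \<in> E" "(w, v) \<in> E" "(t, v) \<in> E"
    and "(u, w) \<in> E" "(w, u) \<in> E" "(u, t) \<in> E" "(t, u) \<in> E"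
  shows "w = t"
  using min_hard.star_unique[OF dual, of v u w t] assms by simp

lemma inv_double: "invar2 F (E \<inter> E\<inverse>)"
  by (intro invar2_Int invar2_converse E)

text \<open>The double neighbours of \<open>u\<close> and \<open>v\<close> include \<open>u\<close>,
  \<open>v\<close> and \<open>t\<close>, and hence two different double edges.\<close>

lemma double_star_all:
  assumes "(u, v) \<in> E" "(v, u) \<in> E" "(u, t) \<in> E" "(t, u) \<in> E" "v \<noteq> t" and C: "invar F {u, v}"
  shows "(E \<inter> E\<inverse>) `` {u, v} = V"
proof (rule ccontr)
  let ?S = "(E \<inter> E\<inverse>) `` {u, v}"
  assume "?S \<noteq> V"
  then have S: "?S \<subset> V" using EV by blast
  have "{u, v} = {u, t}"
    by (rule cycle_unique[OF invar_Image[OF inv_double C] S]) (use assms smooth_pair in auto)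
  then show False using assms irr by (metis doubleton_eq_iff)
qed

text \<open>A further double neighbour of one corner is joined to another corner in some direction,
  which \<open>star_unique\<close> or its dual excludes. So the triangle is definable from
  \<open>u\<close> by double edges; containing several cycles, it is all of
  \<open>V\<close>.\<close>

lemma double_triangle_projective:
  assumes uv: "(u, v) \<in> E" "(v, u) \<in> E" and ut: "(u, t) \<in> E" "(t, u) \<in> E"
    and vt: "(v, t) \<in> E" "(t, v) \<in> E"
  shows "projective F V"
proof -
  let ?D = "E \<inter> E\<inverse>"
  have uV: "u \<in> V" using uv inV by blast
  have nbr: "w = y \<or> w = z"
    if "(x, y) \<in> ?D" "(x, z) \<in> ?D" "(y, z) \<in> ?D" "(x, w) \<in> ?D" for x y z w
  proof (rule ccontr)
    assume n: "\<not> ?thesis"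
    then have "(y, w) \<in> E \<or> (w, y) \<in> E" using tot that inV by blast
    then show False
      using star_unique[of y x z w] star_unique_in[of x y z w] that n by auto
  qed
  have Du: "?D `` {u} = {v, t}" using nbr[of u v t] uv ut vt by auto
  have "?D `` {v, t} = {u, v, t}" using nbr[of v u t] nbr[of t u v] uv ut vt by auto
  then have inv3: "invar F {u, v, t}"
    using invar_Image[OF inv_double invar_Image[OF inv_double sing[OF uV]]] Du by simp
  have d: "u \<noteq> v" "v \<noteq> t" "u \<noteq> t" using uv vt ut irr by auto
  have V: "V = {u, v, t}"
  proof (rule ccontr)
    assume "V \<noteq> {u, v, t}"
    then have sub: "{u, v, t} \<subset> V" using uv ut inV by blast
    have "{u, v} = {u, t}"
      by (rule cycle_unique[OF inv3 sub]) (use uv ut smooth_pair in auto)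
    then show False using d by (metis doubleton_eq_iff)
  qed
  have EV': "E \<subseteq> {u, v, t} \<times> {u, v, t}" using EV unfolding V .
  have "E = {(u, v), (u, t), (v, u), (v, t), (t, u), (t, v)}"
    using EV' uv ut vt irr by auto
  then show ?thesis using three_projective[OF V d E] by simp
qed

text \<open>
  Either \<open>V\<close> has three vertices, or it consists of a 3-cycle and a vertex \<open>u\<close> joined to it
  by double edges. In the latter case \<open>relcomp_wheel\<close> yields a smaller digraph on the 3-cycle.
\<close>

lemma double_path_projective:
  assumes uv: "(u, v) \<in> E" "(v, u) \<in> E" and ut: "(u, t) \<in> E" "(t, u) \<in> E"
    and vt: "(v, t) \<in> E" "(t, v) \<notin> E"
  shows "projective F V"
proof -
  have V3: "u \<in> V" "v \<in> V" "t \<in> V" using uv ut inV by blast+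
  have d: "u \<noteq> v" "u \<noteq> t" "v \<noteq> t" using uv vt ut irr by auto
  have i1: "invar F {u, t}"
    by (rule cycle_invar[OF inv_out[OF sing[OF V3(2)]] out_psubset[OF V3(2)]])
      (use uv ut vt smooth_pair in auto)
  have i2: "invar F {u, v}"
    by (rule cycle_invar[OF inv_in[OF sing[OF V3(3)]] in_psubset[OF V3(3)]])
      (use uv ut vt smooth_pair in auto)
  have all1: "(E \<inter> E\<inverse>) `` {u, v} = V" using double_star_all[OF uv ut d(3) i2] .
  have all2: "(E \<inter> E\<inverse>) `` {u, t} = V" using double_star_all[OF ut uv d(3)[symmetric] i1] .
  have us: "(u, s) \<in> E \<and> (s, u) \<in> E" if s: "s \<in> V - {u, v, t}" for s
  proof (rule ccontr)
    assume n: "\<not> ?thesis"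
    have "s \<in> (E \<inter> E\<inverse>) `` {u, v}" "s \<in> (E \<inter> E\<inverse>) `` {u, t}" using all1 all2 s by auto
    then have "(v, s) \<in> E" "(s, t) \<in> E" "(t, s) \<in> E" using n by auto
    then have "u = s" using star_unique[of v t u s] uv ut vt by auto
    then show False using s by blast
  qed
  have sv: "(v, s) \<notin> E" "(s, v) \<in> E" and ts: "(t, s) \<in> E" "(s, t) \<notin> E" if s: "s \<in> V - {u, v, t}" for s
  proof -
    show 1: "(v, s) \<notin> E" using star_unique[of v u t s] uv ut vt us[OF s] s by auto
    show 2: "(s, t) \<notin> E" using star_unique_in[of u t v s] uv ut vt us[OF s] s by auto
    show "(s, v) \<in> E" "(t, s) \<in> E" using 1 2 tot[of s v] tot[of s t] s V3 by auto
  qed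
  have atmost: "s = r" if "s \<in> V - {u, v, t}" "r \<in> V - {u, v, t}" for s r
    using star_unique[of t u s r] ut us[OF that(1)] us[OF that(2)] ts[OF that(1)] ts[OF that(2)] by auto
  show ?thesis
  proof (cases "V = {u, v, t}")
    case True
    have V: "V = {t, u, v}" using True by blast
    have EV': "E \<subseteq> {t, u, v} \<times> {t, u, v}" using EV unfolding V .
    have dd: "t \<noteq> u" "u \<noteq> v" "t \<noteq> v" using d by auto
    have Eeq: "E = {(t, u), (u, t), (u, v), (v, t), (v, u)}"
      using EV' uv ut vt irr by auto
    show ?thesis
      by (rule three_projective[OF V dd _ relcomp_K3_five[OF dd Eeq]])
        (intro invar2_Int invar2_relcomp invar2_converse E)
  next
    case False
    then obtain s where s: "s \<in> V - {u, v, t}" using V3 by blast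
    have V: "V = {u, v, t, s}" using atmost[OF s] s V3 by blast
    have ds: "u \<noteq> s" "v \<noteq> s" "t \<noteq> s" using s by auto
    have EV': "E \<subseteq> {u, v, t, s} \<times> {u, v, t, s}" using EV unfolding V .
    let ?W = "{(u, v), (v, u), (u, t), (t, u), (u, s), (s, u), (v, t), (t, s), (s, v)}"
    have neg: "(t, v) \<notin> E" "(v, s) \<notin> E" "(s, t) \<notin> E" using vt sv[OF s] ts[OF s] by auto
    have "E \<subseteq> ?W"
    proof (rule subrelI)
      fix x y assume e: "(x, y) \<in> E"
      have x: "x = u \<or> x = v \<or> x = t \<or> x = s" and y: "y = u \<or> y = v \<or> y = t \<or> y = s"
        using EV' e by blast+
      show "(x, y) \<in> ?W"
        using x y e neg irr by (elim disjE) simp_all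
    qed
    moreover have "?W \<subseteq> E" using uv ut vt us[OF s] sv[OF s] ts[OF s] by simp
    ultimately have Eeq: "E = ?W" by (rule subset_antisym)
    let ?R = "(E O {(u, u), (t, t)} O E \<inter> E) O (E\<inverse> O {(u, u), (v, v)} O E \<inter> E)"
    have R: "?R = {(s, t), (t, v), (u, v), (v, s), (v, t), (v, u)}"
      by (rule relcomp_wheel[OF d(1,2) ds(1) d(3) ds(2,3) Eeq])
    have "Id_on {u, t} = {(u, u), (t, t)}" "Id_on {u, v} = {(u, u), (v, v)}" by auto
    then have "invar2 F {(u, u), (t, t)}" "invar2 F {(u, u), (v, v)}"
      using invar2_Id_on[OF i1] invar2_Id_on[OF i2] by simp_all
    then have iR: "invar2 F ?R" by (intro invar2_relcomp invar2_Int invar2_converse E)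
    have "E `` {u} = {v, t, s}" unfolding Eeq using d ds by auto
    then have iS: "invar F {v, t, s}" using inv_out[OF sing[OF V3(1)]] by simp
    have sub: "{v, t, s} \<subset> V" using V d ds by auto
    have "semic {v, t, s} ?R" unfolding R semic_def using d ds by auto
    moreover have "smooth {v, t, s} ?R" unfolding R smooth_def by auto
    ultimately have "\<not> branching {v, t, s} ?R" using nobranch[OF iS sub iR] by blast
    moreover have "branching {v, t, s} ?R" unfolding R branching_def using ds by blast
    ultimately show ?thesis by blast
  qed
qed

section \<open>Tournaments and double edges that form a matching\<close>

text \<open>Without double edges \<open>E O E\<close> has no loops, and on a 3-cycle it contains the
  reversed cycle. Somewhere on \<open>C\<close> a vertex points to \<open>x\<close> while
  \<open>x\<close> points to its successor; this adds a forward edge, so that \<open>E O E\<close>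
  branches on \<open>C\<close>.\<close>

lemma tournament_mixed:
  assumes single: "\<And>x y. (x, y) \<in> E \<Longrightarrow> (y, x) \<notin> E"
    and C: "invar F C" "C \<subset> V" "C \<noteq> {}" "smooth C E" "\<not> branching C E"
    and x: "x \<in> V - C" "i \<in> C" "(i, x) \<in> E" "j \<in> C" "(x, j) \<in> E"
  shows False
proof -
  have CV: "C \<subseteq> V" using C by blast
  from semicV[OF CV] C(4,3,5) show False
  proof (cases rule: smooth_nonbranching_cases)
    case (two a b)
    then show False using single by blast
  next
    case (three a b c)
    have R: "(a, c) \<in> E O E" "(b, a) \<in> E O E" "(c, b) \<in> E O E" using three by auto
    have "(v, v) \<notin> E O E" for v using single by auto
    then have s: "semic C (E O E)" unfolding semic_def three(1) using R by auto
    have sm: "smooth C (E O E)" unfolding three(1) using smooth_triple[of a c "E O E" b] R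
      by (simp add: insert_commute)
    have nb: "\<not> branching C (E O E)"
      by (rule nobranch[OF C(1,2) invar2_relcomp[OF E E] s subset_refl sm])
    have adj: "(k, x) \<in> E \<or> (x, k) \<in> E" if "k \<in> C" for k using tot[of k x] that x CV by blast
    have "((a, x) \<in> E \<and> (x, b) \<in> E) \<or> ((b, x) \<in> E \<and> (x, c) \<in> E) \<or> ((c, x) \<in> E \<and> (x, a) \<in> E)"
      using adj[of a] adj[of b] adj[of c] x single unfolding three(1) by blast
    then have "(a, b) \<in> E O E \<or> (b, c) \<in> E O E \<or> (c, a) \<in> E O E" by blast
    then show False using nb R three(2-4) unfolding branching_def three(1) by blast
  qed
qed

text \<open>A vertex between \<open>a\<close> and \<open>b\<close> would leave only three vertices,
  which no perfect matching covers. Otherwise the pair is a module, and the double edges outside it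
  give the contradiction.\<close>

lemma matching_two_cycle:
  assumes strong: strong and matching: matching
    and ab: "invar F {a, b}" "(a, b) \<in> E" "(b, a) \<in> E"
  shows False
proof -
  note match = matching_unique[OF matching] and perfect = matching_ex[OF matching]
  have mixed: "False"
    if i: "invar F {a, b}" and e: "(a, b) \<in> E" "(b, a) \<in> E" and x: "(a, x) \<in> E" "(x, b) \<in> E" for a b x
  proof -
    have V: "V = {a, b, x}"
      by (rule mixed_two_cycle[OF i e _ _ x]) (use match e in blast)+
    obtain y where y: "(x, y) \<in> E" "(y, x) \<in> E" using perfect[of x] V by blast
    then have "y = a \<or> y = b" using V inV irr by blast
    then show False using match[of a b x] match[of b a x] e x y irr by blast
  qed
  have aV: "a \<in> V" "b \<in> V" using ab inV by blast+
  have sub: "{a, b} \<subset> V" using aV V_not_pair[of a b] by blast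
  have nb: "\<not> branching {a, b} E" unfolding branching_def using irr by auto
  show False
  proof (rule module_double_edge[OF strong sub _ smooth_pair[OF ab(2,3)] nb])
    fix x assume x: "x \<in> V - {a, b}"
    have "\<not> ((a, x) \<in> E \<and> (x, a) \<in> E)" "\<not> ((b, x) \<in> E \<and> (x, b) \<in> E)"
      using match[of a b x] match[of b a x] ab x by blast+
    moreover have "\<not> ((a, x) \<in> E \<and> (x, b) \<in> E)" "\<not> ((b, x) \<in> E \<and> (x, a) \<in> E)"
      using mixed[of a b x] mixed[of b a x] ab by (auto simp: insert_commute)
    moreover have "(a, x) \<in> E \<or> (x, a) \<in> E" "(b, x) \<in> E \<or> (x, b) \<in> E"
      using tot[of a x] tot[of b x] x aV by auto
    ultimately show "(\<forall>c\<in>{a, b}. (c, x) \<in> E \<and> (x, c) \<notin> E) \<or> (\<forall>c\<in>{a, b}. (x, c) \<in> E \<and> (c, x) \<notin> E)"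
      by blast
    show "\<exists>y. (x, y) \<in> E \<and> (y, x) \<in> E" using perfect x by blast
  qed auto
qed

text \<open>
  No vertex dominates both ends of a double edge, or is dominated by both. So on an invariant
  3-cycle, going along an edge, then a double edge, then an edge backwards relates any two
  distinct vertices.
\<close>

lemma matching_three_cycle:
  assumes strong: strong and matching: matching
    and C: "invar F {a, b, c}" "{a, b, c} \<subset> V" "a \<noteq> b" "b \<noteq> c" "a \<noteq> c"
      "(a, b) \<in> E" "(b, c) \<in> E" "(c, a) \<in> E" "(b, a) \<notin> E" "(c, b) \<notin> E" "(a, c) \<notin> E"
  shows False
proof -
  note perfect = matching_ex[OF matching]
  have no_out: "False" if e: "(x, y) \<in> E" "(y, x) \<in> E" and v: "(v, x) \<in> E" "(v, y) \<in> E" for v x y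
  proof -
    have vV: "v \<in> V" using v inV by blast
    have "invar F {x, y}"
      by (rule cycle_invar[OF inv_out[OF sing[OF vV]] out_psubset[OF vV]])
        (use e v smooth_pair in auto)
    then show False using matching_two_cycle[OF strong matching _ e] by blast
  qed
  have no_in: "False" if e: "(x, y) \<in> E" "(y, x) \<in> E" and v: "(x, v) \<in> E" "(y, v) \<in> E" for v x y
  proof -
    have vV: "v \<in> V" using v inV by blast
    have "invar F {x, y}"
      by (rule cycle_invar[OF inv_in[OF sing[OF vV]] in_psubset[OF vV]])
        (use e v smooth_pair in auto)
    then show False using matching_two_cycle[OF strong matching _ e] by blast
  qed
  let ?C = "{a, b, c}"
  define D where "D = E \<inter> E\<inverse> \<inter> V \<times> ?C"
  define R where "R = (E O D O E\<inverse>) \<inter> ?C \<times> ?C"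
  have iR: "invar2 F R" unfolding R_def D_def
    by (intro invar2_Int invar2_relcomp invar2_converse invar2_Times E invV C(1))
  have RI: "(i, j) \<in> R" if "i \<in> ?C" "j \<in> ?C" "k \<in> ?C" "(i, k') \<in> E" "(k, k') \<in> E" "(k', k) \<in> E" "(j, k) \<in> E"
    for i j k k'
    using that inV unfolding R_def D_def by blast
  have R: "(i, j) \<in> R" "(i, k) \<in> R"
    if e: "(i, j) \<in> E" "(j, k) \<in> E" "(k, i) \<in> E" "(i, k) \<notin> E" "?C = {i, j, k}" for i j k
  proof -
    have m: "i \<in> ?C" "j \<in> ?C" "k \<in> ?C" using e by auto
    obtain i' where i': "(i, i') \<in> E" "(i', i) \<in> E" using perfect[OF inV(1)[OF e(1)]] by blast
    obtain k' where k': "(k, k') \<in> E" "(k', k) \<in> E" using perfect[OF inV(1)[OF e(3)]] by blast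
    show "(i, k) \<in> R" by (rule RI[OF m(1,3,1) i'(1) i' e(3)])
    \<comment> \<open>Otherwise both ends of the double edge between \<open>k\<close> and
      \<open>k'\<close> would dominate \<open>i\<close>.\<close>
    have "(k', i) \<notin> E" using no_in[OF k' e(3)] by blast
    moreover have "k' \<noteq> i" using k' e(4) by blast
    ultimately have ik': "(i, k') \<in> E" using tot[of i k'] inV(1)[OF e(1)] inV(2)[OF k'(1)] by blast
    show "(i, j) \<in> R" by (rule RI[OF m ik' k' e(2)])
  qed
  have nR: "(i, i) \<notin> R" if e: "(i, j) \<in> E" "(j, k) \<in> E" "(k, i) \<in> E" "(i, k) \<notin> E" "?C = {i, j, k}" for i j k
  proof
    assume "(i, i) \<in> R"
    then obtain l l' where l: "(i, l') \<in> E" "(l', l) \<in> E" "(l, l') \<in> E" "(i, l) \<in> E" "l \<in> ?C"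
      unfolding R_def D_def by auto
    show False by (rule no_out[OF l(3,2,4,1)])
  qed
  have eqs: "?C = {b, c, a}" "?C = {c, a, b}" by auto
  have all: "(a, b) \<in> R" "(a, c) \<in> R" "(b, c) \<in> R" "(b, a) \<in> R" "(c, a) \<in> R" "(c, b) \<in> R"
    using R[OF C(6-8,11) refl] R[OF C(7,8,6,9) eqs(1)] R[OF C(8,6,7,10) eqs(2)] by simp_all
  have "(a, a) \<notin> R" "(b, b) \<notin> R" "(c, c) \<notin> R"
    using nR[OF C(6-8,11) refl] nR[OF C(7,8,6,9) eqs(1)] nR[OF C(8,6,7,10) eqs(2)] by simp_all
  then have s: "semic ?C R" unfolding semic_def using all by auto
  have sm: "smooth ?C R" by (rule smooth_triple) (use all in auto)
  have "\<not> branching ?C R" by (rule nobranch[OF C(1,2) iR s subset_refl sm])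
  then show False using all C(4) unfolding branching_def by blast
qed

section \<open>Case analysis by strong connectedness and double edges\<close>

theorem projective: "projective F V"
proof (cases "\<exists>U\<subseteq>V. U \<noteq> {} \<and> U \<noteq> V \<and> E `` U \<subseteq> U")
  case True
  then show ?thesis using not_strong_projective by blast
next
  case False
  then have strong: strong unfolding strong_def by blast
  show ?thesis
  proof (cases "\<exists>u v t. (u, v) \<in> E \<and> (v, u) \<in> E \<and> (u, t) \<in> E \<and> (t, u) \<in> E \<and> v \<noteq> t")
    case True
    then obtain u v t where uv: "(u, v) \<in> E" "(v, u) \<in> E" and ut: "(u, t) \<in> E" "(t, u) \<in> E" and "v \<noteq> t"
      by blast
    then have "(v, t) \<in> E \<or> (t, v) \<in> E" using tot inV by blast
    then show ?thesis
      using double_triangle_projective[OF uv ut] double_path_projective[OF uv ut]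
        double_path_projective[OF ut uv] by blast
  next
    case False
    then have match: "y = z" if "(x, y) \<in> E" "(y, x) \<in> E" "(x, z) \<in> E" "(z, x) \<in> E" for x y z
      using that by blast
    obtain S K where S: "invar F S" "S \<subset> V" and K: "K \<subseteq> S" "smooth K E" "K \<noteq> {}"
      using ex_proper_cycle[OF strong] by blast
    have iK: "invar F K" and nK: "\<not> branching K E" and KV: "K \<subset> V"
      using cycle_invar[OF S K] cycle_nobranch[OF S K(1,2)] S K by blast+
    let ?D = "E \<inter> E\<inverse>"
    consider "?D = {}" | "Domain ?D = V" | a b where "(a, b) \<in> ?D" "Domain ?D \<noteq> V" by fastforce
    then show ?thesis
    proof cases
      case 1
      then have single: "(y, x) \<notin> E" if "(x, y) \<in> E" for x y using that by blast
      have module: "(\<forall>c\<in>K. (c, x) \<in> E \<and> (x, c) \<notin> E) \<or> (\<forall>c\<in>K. (x, c) \<in> E \<and> (c, x) \<notin> E)"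
        if x: "x \<in> V - K" for x
      proof -
        have "(c, x) \<in> E \<or> (x, c) \<in> E" if "c \<in> K" for c using tot[of c x] x KV that by blast
        then show ?thesis
          using tournament_mixed[OF single iK KV K(3,2) nK x] single by blast
      qed
      have False
        by (rule module_no_double_edges[OF strong KV K(3,2) nK module]) (use single in blast)+
      then show ?thesis ..
    next
      case 2
      then have matching: matching unfolding matching_def using match by blast
      have KV': "K \<subseteq> V" using KV by blast
      from semicV[OF KV'] K(2,3) nK have False
      proof (cases rule: smooth_nonbranching_cases)
        case (two a b)
        then show False using matching_two_cycle[OF strong matching, of a b] iK by blast
      next
        case (three a b c)
        show False
          by (rule matching_three_cycle[OF strong matching, of a b c])
            (use three iK KV in simp_all)
      qed
      then show ?thesis ..
    next
      case 3
      then have ab: "(a, b) \<in> E" "(b, a) \<in> E" by auto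
      have DV: "Domain ?D \<subset> V" using 3(2) EV by blast
      have smD: "smooth (Domain ?D) E" unfolding smooth_def by blast
      \<comment> \<open>The vertices on double edges form a smooth set that is invariant and proper,
        so there is only one double edge.\<close>
      have "{a, b} = Domain ?D"
        by (rule cycle_unique[OF invar_Domain[OF inv_double] DV])
          (use ab smD smooth_pair[OF ab] in auto)
      then have dom: "x \<in> {a, b}" if "(x, y) \<in> E" "(y, x) \<in> E" for x y using that by blast
      have iab: "invar F {a, b}" using invar_Domain[OF inv_double] \<open>{a, b} = Domain ?D\<close> by simp
      have iba: "invar F {b, a}" using iab by (simp add: insert_commute)
      have aV: "a \<in> V" "b \<in> V" using ab inV by blast+
      have sub: "{a, b} \<subset> V" using aV V_not_pair[of a b] by blast
      have nb: "\<not> branching {a, b} E" unfolding branching_def using irr by auto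
      show ?thesis
      proof (cases "\<exists>x. ((a, x) \<in> E \<and> (x, b) \<in> E) \<or> ((b, x) \<in> E \<and> (x, a) \<in> E)")
        case True
        then obtain x where "((a, x) \<in> E \<and> (x, b) \<in> E) \<or> ((b, x) \<in> E \<and> (x, a) \<in> E)" by blast
        then show ?thesis
        proof
          assume x: "(a, x) \<in> E \<and> (x, b) \<in> E"
          show ?thesis
            by (rule mixed_projective[OF iab ab, of x]) (use match ab x in blast)+
        next
          assume x: "(b, x) \<in> E \<and> (x, a) \<in> E"
          show ?thesis
            by (rule mixed_projective[OF iba ab(2,1), of x]) (use match ab x in blast)+
        qed
      next
        case False
        have False
        proof (rule module_no_double_edges[OF strong sub _ smooth_pair[OF ab] nb])
          fix x assume x: "x \<in> V - {a, b}"
          then have "\<not> ((a, x) \<in> E \<and> (x, a) \<in> E)" "\<not> ((b, x) \<in> E \<and> (x, b) \<in> E)"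
            using dom[of x] by blast+
          moreover have "(a, x) \<in> E \<or> (x, a) \<in> E" "(b, x) \<in> E \<or> (x, b) \<in> E"
            using tot[of a x] tot[of b x] x aV by auto
          ultimately show "(\<forall>c\<in>{a, b}. (c, x) \<in> E \<and> (x, c) \<notin> E) \<or> (\<forall>c\<in>{a, b}. (x, c) \<in> E \<and> (c, x) \<notin> E)"
            using False by blast
        qed (use dom in auto)
        then show ?thesis ..
      qed
    qed
  qed
qed

end

theorem hard_projective:
  fixes F :: "((nat \<Rightarrow> 'a) \<Rightarrow> 'a) set"
  assumes fin: "\<And>f. f \<in> F \<Longrightarrow> \<exists>m. \<forall>x y. (\<forall>i<m. x i = y i) \<longrightarrow> f x = f y"
    and sing: "\<And>v. v \<in> V \<Longrightarrow> invar F {v}"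
    and V: "invar F V" and E: "invar2 F E" and hard: "hard V E"
  shows "projective F V"
proof -
  \<comment> \<open>The relation is quantified inside \<open>P\<close>, so that minimality of
    \<open>S\<close> excludes every invariant relation on a smaller set.\<close>
  define P where "P S \<longleftrightarrow> S \<subseteq> V \<and> invar F S \<and> (\<exists>R. invar2 F R \<and> hard S R)" for S
  have "P V" unfolding P_def using V E hard by blast
  then obtain S where S: "P S" and least: "\<And>T. P T \<Longrightarrow> card S \<le> card T"
    using ex_has_least_nat[of P V card] by blast
  then obtain R where SR: "S \<subseteq> V" "invar F S" "invar2 F R" "hard S R" unfolding P_def by blast
  interpret min_hard F S "R \<inter> S \<times> S"
  proof
    show "invar2 F (R \<inter> S \<times> S)" using SR by (intro invar2_Int invar2_Times)
    show "hard S (R \<inter> S \<times> S)"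
      using SR(4) unfolding hard_def semic_def smooth_def branching_def by blast
    show "invar F {v}" if "v \<in> S" for v using sing SR(1) that by blast
    show "card S \<le> card T" if "T \<subseteq> S" "invar F T" "invar2 F Q" "hard T Q" for T Q
      using least[of T] that SR(1) unfolding P_def by blast
  qed (use fin in auto)
  show ?thesis by (rule projective_mono[OF projective SR(1)])
qed

section \<open>Pp-constructions from minor maps\<close>

definition edges :: "'a dgraph \<Rightarrow> ('a \<times> 'a) set" where
  "edges G = {(u, v). edge G u v}"

lemma edges_iff: "(u, v) \<in> edges G \<longleftrightarrow> [u, v] \<in> rel G ()"
  unfolding edges_def edge_def by simp

lemma edges_subset: "is_digraph G \<Longrightarrow> edges G \<subseteq> universe G \<times> universe G"
  unfolding is_digraph_def is_struct_def edges_def edge_def by auto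

lemma digraph_rel_cases:
  assumes "is_digraph G" "xs \<in> rel G r"
  obtains u v where "xs = [u, v]" "(u, v) \<in> edges G"
proof -
  have "length xs = 2" using assms unfolding is_digraph_def is_struct_def by auto
  then obtain u v where "xs = [u, v]" by (auto simp: numeral_2_eq_2 length_Suc_conv)
  then show thesis using that assms(2) edges_iff[of u v G] by (cases r) simp
qed

section \<open>Polymorphisms, minors and formulas\<close>

definition polymorphism :: "'a set \<Rightarrow> ('a \<times> 'a) set \<Rightarrow> nat \<Rightarrow> ('a list \<Rightarrow> 'a) \<Rightarrow> bool" where
  "polymorphism V E k f \<longleftrightarrow>
     (\<forall>xs. length xs = k \<and> set xs \<subseteq> V \<longrightarrow> f xs \<in> V) \<and>
     (\<forall>xs ys. length xs = k \<and> length ys = k \<and> (\<forall>i<k. (xs ! i, ys ! i) \<in> E) \<longrightarrow> (f xs, f ys) \<in> E)"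

text \<open>Coordinate \<open>j\<close> of \<open>f\<close> reads coordinate \<open>\<pi> j\<close>
  of \<open>g\<close>. Only tuples from \<open>V\<close> matter, so \<open>g\<close> may take any
  values elsewhere.\<close>

definition minor_of :: "'a set \<Rightarrow> nat \<Rightarrow> (nat \<Rightarrow> nat) \<Rightarrow> nat \<Rightarrow> ('a list \<Rightarrow> 'a) \<Rightarrow> ('a list \<Rightarrow> 'a) \<Rightarrow> bool" where
  "minor_of V k \<pi> l f g \<longleftrightarrow> (\<forall>j<k. \<pi> j < l) \<and>
     (\<forall>xs. length xs = l \<and> set xs \<subseteq> V \<longrightarrow> g xs = f (map (\<lambda>j. xs ! \<pi> j) [0..<k]))"

lemma edgewise_subset:
  assumes "E \<subseteq> V \<times> V" "length xs = k \<and> length ys = k \<and> (\<forall>i<k. (xs ! i, ys ! i) \<in> E)"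
  shows "set xs \<subseteq> V" "set ys \<subseteq> V"
proof -
  have "xs ! i \<in> V \<and> ys ! i \<in> V" if "i < k" for i
    using assms that by blast
  then show "set xs \<subseteq> V" "set ys \<subseteq> V"
    using assms(2) by (auto simp: in_set_conv_nth)
qed

lemma polymorphism_minor:
  assumes "polymorphism V E k f" "minor_of V k \<pi> l f g" "E \<subseteq> V \<times> V"
  shows "polymorphism V E l g"
  unfolding polymorphism_def
proof (intro conjI allI impI)
  fix xs assume xs: "length xs = l \<and> set xs \<subseteq> V"
  then have "set (map (\<lambda>j. xs ! \<pi> j) [0..<k]) \<subseteq> V"
    using assms(2) unfolding minor_of_def by auto
  then show "g xs \<in> V" using assms xs unfolding polymorphism_def minor_of_def by simp
next
  fix xs ys assume xy: "length xs = l \<and> length ys = l \<and> (\<forall>i<l. (xs ! i, ys ! i) \<in> E)"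
  then have "set xs \<subseteq> V" "set ys \<subseteq> V" using edgewise_subset[OF assms(3)] by blast+
  then show "(g xs, g ys) \<in> E"
    using assms xy unfolding polymorphism_def minor_of_def by simp
qed

definition exs :: "nat list \<Rightarrow> 'r pp \<Rightarrow> 'r pp" where
  "exs vs p = foldr Ex vs p"

text \<open>\<open>Eq 0 0\<close> stands for truth. It makes the variable \<open>0\<close> free,
  which is why \<open>fv_phi\<close> relies on \<open>Npos\<close>.\<close>

definition conj :: "'r pp list \<Rightarrow> 'r pp" where
  "conj ps = foldr And ps (Eq 0 0)"

lemma fv_exs: "fv (exs vs p) = fv p - set vs"
  unfolding exs_def by (induction vs) auto

lemma fv_conj: "fv (conj ps) = {0} \<union> (\<Union>p\<in>set ps. fv p)"
  unfolding conj_def by (induction ps) auto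

lemma sat_conj: "sat A s (conj ps) \<longleftrightarrow> (\<forall>p\<in>set ps. sat A s p)"
  unfolding conj_def by (induction ps) auto

lemma sat_exs:
  "sat A s (exs vs p) \<longleftrightarrow>
     (\<exists>s'. (\<forall>v\<in>set vs. s' v \<in> universe A) \<and> (\<forall>v. v \<notin> set vs \<longrightarrow> s' v = s v) \<and> sat A s' p)"
proof (induction vs arbitrary: s)
  case Nil
  have "s' = s" if "\<forall>v. s' v = s v" for s' :: "nat \<Rightarrow> 'b" using that by blast
  then show ?case unfolding exs_def by auto
next
  case (Cons v vs)
  have "sat A s (exs (v # vs) p) \<longleftrightarrow> (\<exists>a\<in>universe A. sat A (s(v := a)) (exs vs p))"
    unfolding exs_def by simp
  also have "\<dots> \<longleftrightarrow> (\<exists>a\<in>universe A. \<exists>s'. (\<forall>w\<in>set vs. s' w \<in> universe A) \<and>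
      (\<forall>w. w \<notin> set vs \<longrightarrow> s' w = (s(v := a)) w) \<and> sat A s' p)"
    unfolding Cons.IH ..
  also have "\<dots> \<longleftrightarrow> (\<exists>s'. (\<forall>w\<in>set (v # vs). s' w \<in> universe A) \<and>
      (\<forall>w. w \<notin> set (v # vs) \<longrightarrow> s' w = s w) \<and> sat A s' p)" (is "?L \<longleftrightarrow> ?R")
  proof
    assume ?L
    then obtain a s' where a: "a \<in> universe A" and s': "\<forall>w\<in>set vs. s' w \<in> universe A"
      "\<forall>w. w \<notin> set vs \<longrightarrow> s' w = (s(v := a)) w" "sat A s' p" by blast
    have "s' v \<in> universe A" using a s' by (cases "v \<in> set vs") auto
    then show ?R using s' by (intro exI[of _ s']) auto
  next
    assume ?R
    then obtain s' where s': "\<forall>w\<in>set (v # vs). s' w \<in> universe A"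
      "\<forall>w. w \<notin> set (v # vs) \<longrightarrow> s' w = s w" "sat A s' p" by blast
    then show ?L by (intro bexI[of _ "s' v"] exI[of _ s']) auto
  qed
  finally show ?case .
qed

text \<open>
  The elements of the power are the functions from \<open>k\<close>-tuples to \<open>A\<close>, where \<open>k\<close> is the number
  of vertices of \<open>B\<close>. Two of them are adjacent iff they are the minors, along sources and along
  targets, of one polymorphism whose coordinates are the edges of \<open>B\<close>.
\<close>

lemma pp_constructs_if_minor_map:
  fixes A :: "'a dgraph" and B :: "'b dgraph"
  assumes A: "is_digraph A" "finite (universe A)"
    and B: "is_digraph B" "finite (universe B)" "edges B \<noteq> {}"
    and \<xi>: "\<And>k f. polymorphism (universe A) (edges A) k f \<Longrightarrow> 0 < k \<Longrightarrow> \<xi> k f < k"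
    and minor: "\<And>k l \<pi> f g. polymorphism (universe A) (edges A) k f \<Longrightarrow> 0 < k \<Longrightarrow>
       minor_of (universe A) k \<pi> l f g \<Longrightarrow> \<xi> l g = \<pi> (\<xi> k f)"
  shows "pp_constructs A B"
proof -
  let ?V = "universe A" and ?E = "edges A"
  obtain vs where vs: "set vs = ?V" "distinct vs" using finite_distinct_list[OF A(2)] by blast
  obtain bs where bs: "set bs = universe B" "distinct bs" using finite_distinct_list[OF B(2)] by blast
  define k where "k = length bs"
  have "finite {(s, t). s < k \<and> t < k \<and> (bs ! s, bs ! t) \<in> edges B}"
    by (rule finite_subset[of _ "{..<k} \<times> {..<k}"]) auto
  then obtain es where es: "set es = {(s, t). s < k \<and> t < k \<and> (bs ! s, bs ! t) \<in> edges B}"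
    using finite_list by blast
  define m where "m = length es"
  define T where "T = List.n_lists k vs"
  define U where "U = List.n_lists m vs"
  define N where "N = length T"
  have T: "set T = {xs. length xs = k \<and> set xs \<subseteq> ?V}" unfolding T_def by (simp add: set_n_lists vs)
  have U: "set U = {xs. length xs = m \<and> set xs \<subseteq> ?V}" unfolding U_def by (simp add: set_n_lists vs)
  have EV: "?E \<subseteq> ?V \<times> ?V" using edges_subset[OF A(1)] .
  have EB: "edges B \<subseteq> universe B \<times> universe B" using edges_subset[OF B(1)] .
  obtain v0 where v0: "v0 \<in> ?V" using A(1) unfolding is_digraph_def is_struct_def by blast
  define pos where "pos b = (SOME i. i < k \<and> bs ! i = b)" for b
  have pos: "pos b < k \<and> bs ! pos b = b" if "b \<in> universe B" for b
  proof -
    have "\<exists>i. i < k \<and> bs ! i = b" using that bs(1) unfolding k_def by (metis in_set_conv_nth)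
    then show ?thesis unfolding pos_def by (rule someI_ex)
  qed
  define tix where "tix xs = (SOME i. i < N \<and> T ! i = xs)" for xs
  have tix: "tix xs < N \<and> T ! tix xs = xs" if "length xs = k" "set xs \<subseteq> ?V" for xs
  proof -
    have "xs \<in> set T" using that T by simp
    then have "\<exists>i. i < N \<and> T ! i = xs" unfolding N_def by (metis in_set_conv_nth)
    then show ?thesis unfolding tix_def by (rule someI_ex)
  qed
  define uix where "uix xs = (SOME i. i < length U \<and> U ! i = xs)" for xs
  have uix: "uix xs < length U \<and> U ! uix xs = xs" if "length xs = m" "set xs \<subseteq> ?V" for xs
  proof -
    have "xs \<in> set U" using that U by simp
    then have "\<exists>i. i < length U \<and> U ! i = xs" by (metis in_set_conv_nth)
    then show ?thesis unfolding uix_def by (rule someI_ex)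
  qed
  have Tnth: "length (T ! i) = k" "set (T ! i) \<subseteq> ?V" if "i < N" for i
    using that T nth_mem[of i T] unfolding N_def by auto
  have Unth: "length (U ! i) = m" "set (U ! i) \<subseteq> ?V" if "i < length U" for i
    using that U nth_mem[of i U] by auto
  define src where "src xs = map (\<lambda>e. xs ! fst e) es" for xs :: "'a list"
  define tgt where "tgt xs = map (\<lambda>e. xs ! snd e) es" for xs :: "'a list"
  have esk: "fst e < k" "snd e < k" "(bs ! fst e, bs ! snd e) \<in> edges B" if "e \<in> set es" for e
    using that unfolding es by auto
  have src: "length (src xs) = m" "set (src xs) \<subseteq> ?V" and tgt: "length (tgt xs) = m" "set (tgt xs) \<subseteq> ?V"
    if "length xs = k" "set xs \<subseteq> ?V" for xs
    using that esk unfolding src_def tgt_def m_def by (auto simp: subset_iff)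
  have src_map: "src xs = map (\<lambda>j. xs ! fst (es ! j)) [0..<m]" for xs
    unfolding src_def m_def by (rule nth_equalityI) auto
  have tgt_map: "tgt xs = map (\<lambda>j. xs ! snd (es ! j)) [0..<m]" for xs
    unfolding tgt_def m_def by (rule nth_equalityI) auto
  have Npos: "N \<ge> 1"
  proof -
    have "set (replicate k v0) \<subseteq> ?V" using v0 by (simp add: set_replicate_conv_if)
    then show ?thesis using tix[of "replicate k v0"] by simp
  qed
  define Rel where "Rel = {[map (\<lambda>xs. g (src xs)) T, map (\<lambda>xs. g (tgt xs)) T] | g. polymorphism ?V ?E m g}"
  define P :: "(unit, 'a list) rel_structure"
    where "P = \<lparr>universe = {xs. length xs = N \<and> set xs \<subseteq> ?V}, arity = (\<lambda>_. 2), rel = (\<lambda>_. Rel)\<rparr>"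
  have gV: "g (src xs) \<in> ?V" "g (tgt xs) \<in> ?V"
    if "polymorphism ?V ?E m g" "xs \<in> set T" for g xs
    using that T src tgt unfolding polymorphism_def by auto
  have structP: "is_struct P"
    unfolding is_struct_def
  proof (intro conjI allI)
    have "replicate N v0 \<in> universe P" unfolding P_def using v0 by (auto simp: set_replicate_conv_if)
    then show "universe P \<noteq> {}" by blast
    show "rel P r \<subseteq> {xs. length xs = arity P r \<and> set xs \<subseteq> universe P}" for r
      unfolding P_def Rel_def using gV by (auto simp: N_def)
  qed
  \<comment> \<open>The first two blocks of \<open>N\<close> variables hold two elements of the
    power, and variable \<open>2 * N + i\<close> holds the value of \<open>g\<close> at
    \<open>U ! i\<close>. The atoms say that \<open>g\<close> preserves edges, the equations that
    its two minors are the given elements.\<close>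
  define atoms where "atoms = [Atom () [2 * N + i, 2 * N + j]. i \<leftarrow> [0..<length U], j \<leftarrow> [0..<length U],
      \<forall>l<m. (U ! i ! l, U ! j ! l) \<in> ?E]"
  define eqs :: "unit pp list" where "eqs = [Eq i (2 * N + uix (src (T ! i))). i \<leftarrow> [0..<N]] @
      [Eq (N + i) (2 * N + uix (tgt (T ! i))). i \<leftarrow> [0..<N]]"
  define \<phi> where "\<phi> = exs [2 * N..<2 * N + length U] (conj (atoms @ eqs))"
  have set_atoms: "set atoms = {Atom () [2 * N + i, 2 * N + j] | i j. i < length U \<and> j < length U \<and>
      (\<forall>l<m. (U ! i ! l, U ! j ! l) \<in> ?E)}"
    unfolding atoms_def by auto
  have fv_phi: "fv \<phi> \<subseteq> {..<2 * N}"
  proof -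
    have "fv p \<subseteq> {..<2 * N + length U}" if "p \<in> set (atoms @ eqs)" for p
      using that uix src tgt Tnth unfolding set_append set_atoms eqs_def by fastforce
    then show ?thesis unfolding \<phi>_def fv_exs fv_conj using Npos by fastforce
  qed
  have sat_phi: "sat A s \<phi> \<longleftrightarrow> (\<exists>g. polymorphism ?V ?E m g \<and>
      (\<forall>i<N. s i = g (src (T ! i)) \<and> s (N + i) = g (tgt (T ! i))))" for s
  proof
    assume "sat A s \<phi>"
    then obtain s' where s': "\<And>v. v \<in> {2 * N..<2 * N + length U} \<Longrightarrow> s' v \<in> ?V"
        "\<And>v. v < 2 * N \<Longrightarrow> s' v = s v" and sat: "\<And>p. p \<in> set (atoms @ eqs) \<Longrightarrow> sat A s' p"
      unfolding \<phi>_def sat_exs sat_conj by (metis atLeastLessThan_iff not_le set_upt)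
    define g where "g xs = s' (2 * N + uix xs)" for xs
    have "polymorphism ?V ?E m g"
      unfolding polymorphism_def
    proof (intro conjI allI impI)
      fix xs assume "length xs = m \<and> set xs \<subseteq> ?V"
      then show "g xs \<in> ?V" unfolding g_def using s'(1) uix by simp
    next
      fix xs ys assume xy: "length xs = m \<and> length ys = m \<and> (\<forall>i<m. (xs ! i, ys ! i) \<in> ?E)"
      then have "set xs \<subseteq> ?V" "set ys \<subseteq> ?V" using edgewise_subset[OF EV] by blast+
      then have "Atom () [2 * N + uix xs, 2 * N + uix ys] \<in> set atoms"
        unfolding set_atoms using uix[of xs] uix[of ys] xy by auto
      then show "(g xs, g ys) \<in> ?E"
        using sat[of "Atom () [2 * N + uix xs, 2 * N + uix ys]"] unfolding g_def edges_iff by simp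
    qed
    moreover have "s i = g (src (T ! i)) \<and> s (N + i) = g (tgt (T ! i))" if i: "i < N" for i
    proof -
      have "Eq i (2 * N + uix (src (T ! i))) \<in> set eqs" "Eq (N + i) (2 * N + uix (tgt (T ! i))) \<in> set eqs"
        unfolding eqs_def using i by auto
      then show ?thesis
        using sat[of "Eq i (2 * N + uix (src (T ! i)))"] sat[of "Eq (N + i) (2 * N + uix (tgt (T ! i)))"]
          s'(2)[of i] s'(2)[of "N + i"] i unfolding g_def by simp
    qed
    ultimately show "\<exists>g. polymorphism ?V ?E m g \<and>
      (\<forall>i<N. s i = g (src (T ! i)) \<and> s (N + i) = g (tgt (T ! i)))" by blast
  next
    assume "\<exists>g. polymorphism ?V ?E m g \<and>
      (\<forall>i<N. s i = g (src (T ! i)) \<and> s (N + i) = g (tgt (T ! i)))"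
    then obtain g where g: "polymorphism ?V ?E m g"
      "\<And>i. i < N \<Longrightarrow> s i = g (src (T ! i)) \<and> s (N + i) = g (tgt (T ! i))" by blast
    define s' where "s' v = (if 2 * N \<le> v \<and> v < 2 * N + length U then g (U ! (v - 2 * N)) else s v)" for v
    have s'U: "s' (2 * N + i) = g (U ! i)" if "i < length U" for i
      unfolding s'_def using that by simp
    have s'N: "s' i = s i" if "i < 2 * N" for i unfolding s'_def using that by simp
    have "sat A s' p" if p: "p \<in> set (atoms @ eqs)" for p
    proof -
      consider i j where "p = Atom () [2 * N + i, 2 * N + j]" "i < length U" "j < length U"
          "\<forall>l<m. (U ! i ! l, U ! j ! l) \<in> ?E"
        | i where "i < N" "p = Eq i (2 * N + uix (src (T ! i)))"
        | i where "i < N" "p = Eq (N + i) (2 * N + uix (tgt (T ! i)))"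
        using p unfolding set_append set_atoms eqs_def by auto
      then show ?thesis
      proof cases
        case 1
        then have "(g (U ! i), g (U ! j)) \<in> ?E"
          using g(1) Unth unfolding polymorphism_def by blast
        then show ?thesis using 1 s'U unfolding edges_iff by simp
      next
        case 2
        then show ?thesis using g(2)[of i] s'N[of i] s'U uix src Tnth by simp
      next
        case 3
        then show ?thesis using g(2)[of i] s'N[of "N + i"] s'U uix tgt Tnth by simp
      qed
    qed
    moreover have "s' v \<in> ?V" if "v \<in> set [2 * N..<2 * N + length U]" for v
    proof -
      have "v = 2 * N + (v - 2 * N)" "v - 2 * N < length U" using that by auto
      then show ?thesis using s'U[of "v - 2 * N"] Unth[of "v - 2 * N"] g(1)
        unfolding polymorphism_def by metis
    qed
    moreover have "s' v = s v" if "v \<notin> set [2 * N..<2 * N + length U]" for v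
      unfolding s'_def using that by auto
    ultimately show "sat A s \<phi>" unfolding \<phi>_def sat_exs sat_conj by blast
  qed
  have "concat ` Rel = {xs. length xs = 2 * N \<and> set xs \<subseteq> ?V \<and> sat A (nth xs) \<phi>}"
  proof (intro set_eqI iffI)
    fix xs assume "xs \<in> concat ` Rel"
    then obtain g where g: "polymorphism ?V ?E m g"
      and xs: "xs = map (\<lambda>xs. g (src xs)) T @ map (\<lambda>xs. g (tgt xs)) T" unfolding Rel_def by auto
    have "sat A (nth xs) \<phi>"
      unfolding sat_phi using g by (intro exI[of _ g]) (auto simp: xs nth_append N_def)
    moreover have "set xs \<subseteq> ?V" unfolding xs set_append using gV[OF g] by auto
    ultimately show "xs \<in> {xs. length xs = 2 * N \<and> set xs \<subseteq> ?V \<and> sat A (nth xs) \<phi>}"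
      by (simp add: xs N_def)
  next
    fix xs assume "xs \<in> {xs. length xs = 2 * N \<and> set xs \<subseteq> ?V \<and> sat A (nth xs) \<phi>}"
    then obtain g where len: "length xs = 2 * N" and g: "polymorphism ?V ?E m g"
      "\<forall>i<N. xs ! i = g (src (T ! i)) \<and> xs ! (N + i) = g (tgt (T ! i))" unfolding sat_phi by blast
    have "xs = map (\<lambda>xs. g (src xs)) T @ map (\<lambda>xs. g (tgt xs)) T"
    proof (rule nth_equalityI)
      show "length xs = length (map (\<lambda>xs. g (src xs)) T @ map (\<lambda>xs. g (tgt xs)) T)"
        using len by (simp add: N_def)
      fix i assume i: "i < length xs"
      show "xs ! i = (map (\<lambda>xs. g (src xs)) T @ map (\<lambda>xs. g (tgt xs)) T) ! i"
      proof (cases "i < N")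
        case True
        then show ?thesis using g(2) by (simp add: nth_append N_def)
      next
        case False
        then have "i - N < N" "N + (i - N) = i" using i len by auto
        then show ?thesis using g(2)[rule_format, of "i - N"] False by (simp add: nth_append N_def)
      qed
    qed
    then have "xs = concat [map (\<lambda>xs. g (src xs)) T, map (\<lambda>xs. g (tgt xs)) T]" by simp
    then show "xs \<in> concat ` Rel" unfolding Rel_def using g(1) by blast
  qed
  then have "pp_definable A (2 * N) (concat ` Rel)"
    unfolding pp_definable_def using fv_phi by blast
  then have "is_power_struct N A P"
    unfolding is_power_struct_def using structP by (simp add: P_def)
  moreover have "isomorphic P P"
    unfolding isomorphic_def by (intro conjI exI[of _ id]) auto
  ultimately have power: "is_pp_power A P" unfolding is_pp_power_def using Npos by blast
  \<comment> \<open>A vertex goes to the projection to its own position, and an edge is witnessed by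
    the projection to the coordinate of that edge.\<close>
  have "is_hom (\<lambda>b. map (\<lambda>xs. xs ! pos b) T) B P"
    unfolding is_hom_def
  proof (intro conjI allI ballI)
    show "(\<lambda>b. map (\<lambda>xs. xs ! pos b) T) ` universe B \<subseteq> universe P"
      unfolding P_def using pos T by (auto simp: N_def) (metis nth_mem subsetD)
    fix r ys assume "ys \<in> rel B r"
    then obtain u v where uv: "ys = [u, v]" "(u, v) \<in> edges B" using digraph_rel_cases[OF B(1)] by blast
    then have "u \<in> universe B" "v \<in> universe B" using EB by auto
    then have "(pos u, pos v) \<in> set es" unfolding es using pos uv by simp
    then obtain e where e: "e < m" "es ! e = (pos u, pos v)" unfolding m_def by (metis in_set_conv_nth)
    have "polymorphism ?V ?E m (\<lambda>xs. xs ! e)"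
      unfolding polymorphism_def using e by (auto simp: subset_iff)
    moreover have "src xs ! e = xs ! pos u" "tgt xs ! e = xs ! pos v" for xs
      using e unfolding src_def tgt_def m_def by auto
    ultimately have "[map (\<lambda>xs. xs ! pos u) T, map (\<lambda>xs. xs ! pos v) T] \<in> Rel"
      unfolding Rel_def by (intro CollectI exI[of _ "\<lambda>xs. xs ! e"]) simp
    then show "map (\<lambda>b. map (\<lambda>xs. xs ! pos b) T) ys \<in> rel P r" by (simp add: P_def uv)
  qed
  moreover define val where "val F xs = F ! tix xs" for F :: "'a list" and xs
  \<comment> \<open>Elements that are not polymorphisms lie on no edge of the power, so the default
    position \<open>0\<close> is an arbitrary vertex for them.\<close>
  define h where "h F = bs ! (if polymorphism ?V ?E k (val F) then \<xi> k (val F) else 0)" for F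
  have kpos: "0 < k" and mpos: "0 < m"
  proof -
    obtain u v where uv: "(u, v) \<in> edges B" using B(3) by auto
    then have "u \<in> universe B" "v \<in> universe B" using EB by auto
    then show "0 < k" using pos[of u] by simp
    have "(pos u, pos v) \<in> set es" unfolding es using pos uv \<open>u \<in> universe B\<close> \<open>v \<in> universe B\<close> by simp
    then show "0 < m" unfolding m_def by (cases es) auto
  qed
  have "is_hom h P B"
    unfolding is_hom_def
  proof (intro conjI allI ballI)
    show "h ` universe P \<subseteq> universe B"
      unfolding h_def using \<xi> kpos bs(1) unfolding k_def by (auto intro!: nth_mem)
    fix r ys assume "ys \<in> rel P r"
    then obtain g where g: "polymorphism ?V ?E m g"
      and ys: "ys = [map (\<lambda>xs. g (src xs)) T, map (\<lambda>xs. g (tgt xs)) T]" unfolding P_def Rel_def by auto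
    let ?F = "map (\<lambda>xs. g (src xs)) T" and ?F' = "map (\<lambda>xs. g (tgt xs)) T"
    have es_nth: "es ! j \<in> set es" if "j < m" for j using that unfolding m_def by simp
    have m1: "minor_of ?V m (\<lambda>j. fst (es ! j)) k g (val ?F)"
      unfolding minor_of_def
    proof (intro conjI allI impI)
      show "fst (es ! j) < k" if "j < m" for j using esk es_nth that by blast
      fix xs assume "length xs = k \<and> set xs \<subseteq> ?V"
      then show "val ?F xs = g (map (\<lambda>j. xs ! fst (es ! j)) [0..<m])"
        unfolding val_def src_map[symmetric] using tix[of xs] by (simp add: N_def)
    qed
    have m2: "minor_of ?V m (\<lambda>j. snd (es ! j)) k g (val ?F')"
      unfolding minor_of_def
    proof (intro conjI allI impI)
      show "snd (es ! j) < k" if "j < m" for j using esk es_nth that by blast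
      fix xs assume "length xs = k \<and> set xs \<subseteq> ?V"
      then show "val ?F' xs = g (map (\<lambda>j. xs ! snd (es ! j)) [0..<m])"
        unfolding val_def tgt_map[symmetric] using tix[of xs] by (simp add: N_def)
    qed
    \<comment> \<open>Compatibility with minors turns the two images into the source and the target
      of the edge numbered \<open>\<xi> m g\<close>.\<close>
    have "h ?F = bs ! fst (es ! \<xi> m g)"
      unfolding h_def using polymorphism_minor[OF g m1 EV] minor[OF g mpos m1] by simp
    moreover have "h ?F' = bs ! snd (es ! \<xi> m g)"
      unfolding h_def using polymorphism_minor[OF g m2 EV] minor[OF g mpos m2] by simp
    ultimately have "(h ?F, h ?F') \<in> edges B" using esk(3)[OF es_nth[OF \<xi>[OF g mpos]]] by simp
    then show "map h ys \<in> rel B r" unfolding ys edges_iff by simp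
  qed
  ultimately have "hom_equiv B P"
    unfolding hom_equiv_def using B(1) by (auto simp: is_digraph_def P_def)
  then show ?thesis unfolding pp_constructs_def using structP power by blast
qed

section \<open>Digraphs without branching core\<close>

text \<open>Without a source every vertex would have a predecessor, and
  \<open>ex_smooth_subset\<close> would give a smooth subset. The source dominates all other
  vertices, takes rank \<open>0\<close> and shifts the remaining ranks by one.\<close>

lemma acyclic_ranking:
  assumes "finite S" "semic S E" "\<And>K. K \<subseteq> S \<Longrightarrow> K \<noteq> {} \<Longrightarrow> \<not> smooth K E"
  shows "\<exists>h. bij_betw h S {..<card S} \<and> (\<forall>u\<in>S. \<forall>v\<in>S. (u, v) \<in> E \<longleftrightarrow> h u < h v)"
  using assms
proof (induction "card S" arbitrary: S)
  case 0
  then show ?case by (simp add: bij_betw_def)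
next
  case (Suc n)
  have "S \<noteq> {}" using Suc.hyps(2) by auto
  then have "\<exists>s\<in>S. \<forall>y\<in>S. (y, s) \<notin> E"
    using ex_smooth_subset[OF Suc.prems(1), of E] Suc.prems(3) by blast
  then obtain s where s: "s \<in> S" "\<forall>y\<in>S. (y, s) \<notin> E" by blast
  let ?T = "S - {s}"
  have card: "n = card ?T" using Suc.hyps(2) s(1) Suc.prems(1) by simp
  have "\<exists>h. bij_betw h ?T {..<card ?T} \<and> (\<forall>u\<in>?T. \<forall>v\<in>?T. (u, v) \<in> E \<longleftrightarrow> h u < h v)"
  proof (rule Suc.hyps(1)[OF card])
    show "finite ?T" "semic ?T E" using Suc.prems(1) semic_subset[OF Suc.prems(2)] by auto
    show "\<not> smooth K E" if "K \<subseteq> ?T" "K \<noteq> {}" for K using Suc.prems(3)[of K] that by blast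
  qed
  then obtain h where h: "bij_betw h ?T {..<card ?T}"
    and hE: "\<forall>u\<in>?T. \<forall>v\<in>?T. (u, v) \<in> E \<longleftrightarrow> h u < h v" by blast
  define g where "g v = (if v = s then 0 else Suc (h v))" for v
  have "bij_betw (\<lambda>v. Suc (h v)) ?T (Suc ` {..<n})"
    using bij_betw_trans[OF h, of Suc "Suc ` {..<n}"] card by (simp add: bij_betw_def comp_def)
  then have "bij_betw g ?T (Suc ` {..<n})"
    by (rule bij_betw_cong[THEN iffD1, rotated]) (simp add: g_def)
  moreover have "bij_betw g {s} {0}" by (simp add: bij_betw_def g_def)
  ultimately have "bij_betw g ({s} \<union> ?T) ({0} \<union> Suc ` {..<n})"
    by (intro bij_betw_combine) auto
  moreover have "{s} \<union> ?T = S" "{0} \<union> Suc ` {..<n} = {..<card S}"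
    using s(1) by (auto simp: Suc.hyps(2)[symmetric] lessThan_Suc_eq_insert_0)
  ultimately have "bij_betw g S {..<card S}" by simp
  moreover have "(u, v) \<in> E \<longleftrightarrow> g u < g v" if uv: "u \<in> S" "v \<in> S" for u v
  proof (cases "u = s \<or> v = s")
    case True
    then show ?thesis using s uv Suc.prems(2) unfolding g_def semic_def by auto
  next
    case False
    then show ?thesis using hE uv unfolding g_def by auto
  qed
  ultimately show ?case by blast
qed

lemma isomorphic_digraph_of:
  assumes G: "is_digraph G" and h: "bij_betw h (universe G) W"
    and E: "\<And>u v. u \<in> universe G \<Longrightarrow> v \<in> universe G \<Longrightarrow> edge G u v \<longleftrightarrow> (h u, h v) \<in> E'"
  shows "isomorphic G (digraph_of W E')"
  unfolding isomorphic_def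
proof (intro conjI exI[of _ h] allI ballI)
  show "arity G = arity (digraph_of W E')" using G by (simp add: is_digraph_def digraph_of_def)
  show "bij_betw h (universe G) (universe (digraph_of W E'))" using h by (simp add: digraph_of_def)
  fix r xs assume xs: "xs \<in> lists (universe G)"
  have r: "r = ()" by simp
  show "xs \<in> rel G r \<longleftrightarrow> map h xs \<in> rel (digraph_of W E') r"
  proof
    assume a: "xs \<in> rel G r"
    then have "length xs = 2" using G unfolding is_digraph_def is_struct_def by auto
    then obtain u v where uv: "xs = [u, v]" by (auto simp: numeral_2_eq_2 length_Suc_conv)
    then have "edge G u v" using a unfolding edge_def r by simp
    then show "map h xs \<in> rel (digraph_of W E') r" using E uv xs by (auto simp: digraph_of_def)
  next
    assume "map h xs \<in> rel (digraph_of W E') r"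
    then obtain u' v' where uv': "map h xs = [u', v']" "(u', v') \<in> E'" by (auto simp: digraph_of_def)
    then obtain u v where uv: "xs = [u, v]" by auto
    then have "edge G u v" using E[of u v] uv' xs by auto
    then show "xs \<in> rel G r" unfolding edge_def r uv .
  qed
qed

text \<open>Since the core is the largest smooth subset, no outside vertex has edges both from and
  to \<open>K\<close>, and no edge leads from \<open>R\<close> back to \<open>L\<close>. So
  \<open>L\<close>, \<open>K\<close>, \<open>R\<close> follow each other, and \<open>L\<close> and
  \<open>R\<close>, having no smooth subsets but the empty one, are linearly ordered.\<close>

lemma core_levels:
  assumes fin: "finite V" and sem: "semic V E" and K: "K = core V E" "K \<noteq> {}"
    and g: "bij_betw g K S" "S \<subseteq> {VA, VB, VC}"
  shows "\<exists>h n k. bij_betw h V (C_verts S n k) \<and> (\<forall>x\<in>K. h x = g x) \<and>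
    (\<forall>u\<in>V. \<forall>v\<in>V. \<not> (u \<in> K \<and> v \<in> K) \<longrightarrow> (u, v) \<in> E \<longleftrightarrow> level (h u) < level (h v)) \<and>
    (\<forall>u\<in>V - K. level (h u) \<noteq> 0)"
proof -
  have KV: "K \<subseteq> V" unfolding K(1) by (rule core_subset)
  have sK: "smooth K E" unfolding K(1) by (rule smooth_core)
  have max: "M \<subseteq> K" if "M \<subseteq> V" "smooth M E" for M unfolding K(1) using smooth_le_core that by blast
  have tot: "(u, v) \<in> E \<or> (v, u) \<in> E" if "u \<in> V" "v \<in> V" "u \<noteq> v" for u v
    using sem that unfolding semic_def by blast
  define L where "L = {v \<in> V - K. \<forall>k\<in>K. (v, k) \<in> E \<and> (k, v) \<notin> E}"
  define R where "R = {v \<in> V - K. \<forall>k\<in>K. (k, v) \<in> E \<and> (v, k) \<notin> E}"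
  have not_both: "False" if v: "v \<in> V - K" "k \<in> K" "(k, v) \<in> E" "l \<in> K" "(v, l) \<in> E" for v k l
  proof -
    have "smooth (insert v K) E" using sK v unfolding smooth_def by blast
    then show False using max[of "insert v K"] v KV by blast
  qed
  have LR: "v \<in> L \<or> v \<in> R" if "v \<in> V - K" for v
  proof -
    have t: "(v, k) \<in> E \<or> (k, v) \<in> E" if "k \<in> K" for k using tot[of v k] \<open>v \<in> V - K\<close> that KV by blast
    show ?thesis
    proof (cases "\<exists>k\<in>K. (k, v) \<in> E")
      case True
      then show ?thesis unfolding R_def using not_both[OF that] t that by blast
    next
      case False
      then show ?thesis unfolding L_def using t that by blast
    qed
  qed
  have LtoR: "(u, v) \<in> E \<and> (v, u) \<notin> E" if uv: "u \<in> L" "v \<in> R" for u v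
  proof -
    have V: "u \<in> V - K" "v \<in> V - K" using uv unfolding L_def R_def by auto
    have ne: "u \<noteq> v" using uv K(2) unfolding L_def R_def by blast
    obtain k where k: "k \<in> K" using K(2) by blast
    have "(v, u) \<notin> E"
    proof
      assume "(v, u) \<in> E"
      moreover have "(u, k) \<in> E" "(k, v) \<in> E" using uv k unfolding L_def R_def by auto
      ultimately have "smooth (insert u (insert v K)) E" using sK k unfolding smooth_def by blast
      then show False using max[of "insert u (insert v K)"] V KV by blast
    qed
    then show ?thesis using tot[of u v] V ne by blast
  qed
  have LV: "L \<subseteq> V" "R \<subseteq> V" "L \<inter> K = {}" "R \<inter> K = {}" unfolding L_def R_def by auto
  have disj: "L \<inter> R = {}" using LtoR by blast
  have VLKR: "V = L \<union> K \<union> R" using LR LV KV by blast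
  have acyc: "\<not> smooth M E" if "M \<subseteq> L \<or> M \<subseteq> R" "M \<noteq> {}" for M
    using max[of M] that LV by blast
  obtain l where l: "bij_betw l L {..<card L}" "\<And>u v. u \<in> L \<Longrightarrow> v \<in> L \<Longrightarrow> (u, v) \<in> E \<longleftrightarrow> l u < l v"
    using acyclic_ranking[of L E] acyc semic_subset[OF sem LV(1)] finite_subset[OF LV(1) fin] by metis
  obtain r where r: "bij_betw r R {..<card R}" "\<And>u v. u \<in> R \<Longrightarrow> v \<in> R \<Longrightarrow> (u, v) \<in> E \<longleftrightarrow> r u < r v"
    using acyclic_ranking[of R E] acyc semic_subset[OF sem LV(2)] finite_subset[OF LV(2) fin] by metis
  \<comment> \<open>The last vertex of \<open>L\<close> gets \<open>-1\<close> and the first of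
    \<open>R\<close> gets \<open>1\<close>; level \<open>0\<close> is left to the cycle.\<close>
  define h where "h v = (if v \<in> K then g v else if v \<in> L then Num (int (l v) - int (card L)) else Num (int (r v) + 1))" for v
  have hK: "h v = g v" if "v \<in> K" for v unfolding h_def using that by simp
  have hL: "h v = Num (int (l v) - int (card L))" if "v \<in> L" for v unfolding h_def using that LV by auto
  have hR: "h v = Num (int (r v) + 1)" if "v \<in> R" for v unfolding h_def using that LV disj by auto
  have bL: "bij_betw h L (Num ` {- int (card L)..-1})"
  proof -
    have "bij_betw (\<lambda>i. Num (int i - int (card L))) {..<card L} (Num ` {- int (card L)..-1})"
      by (rule bij_betw_byWitness[where f' = "\<lambda>c. nat (level c + int (card L))"]) auto
    from bij_betw_trans[OF l(1) this] show ?thesis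
      by (rule bij_betw_cong[THEN iffD1, rotated]) (simp add: hL)
  qed
  have bR: "bij_betw h R (Num ` {1..int (card R)})"
  proof -
    have "bij_betw (\<lambda>i. Num (int i + 1)) {..<card R} (Num ` {1..int (card R)})"
      by (rule bij_betw_byWitness[where f' = "\<lambda>c. nat (level c - 1)"]) auto
    from bij_betw_trans[OF r(1) this] show ?thesis
      by (rule bij_betw_cong[THEN iffD1, rotated]) (simp add: hR)
  qed
  have bK: "bij_betw h K S" using g(1) by (rule bij_betw_cong[THEN iffD1, rotated]) (simp add: hK)
  have "bij_betw h (L \<union> K \<union> R) (Num ` {- int (card L)..-1} \<union> S \<union> Num ` {1..int (card R)})"
    using g(2) by (intro bij_betw_combine bL bK bR) auto
  then have bij: "bij_betw h V (C_verts S (card L) (card R))"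
    unfolding C_verts_def VLKR[symmetric] .
  have levK: "level (h v) = 0" if "v \<in> K" for v
  proof -
    have "g v \<in> S" using g(1) that by (auto simp: bij_betw_def)
    then show ?thesis using g(2) hK[OF that] by auto
  qed
  have levL: "level (h v) = int (l v) - int (card L)" "level (h v) < 0" if "v \<in> L" for v
    using hL[OF that] l(1) that by (auto simp: bij_betw_def)
  have levR: "level (h v) = int (r v) + 1" "level (h v) > 0" if "v \<in> R" for v
    using hR[OF that] by auto
  have edge: "(u, v) \<in> E \<longleftrightarrow> level (h u) < level (h v)" if uv: "u \<in> V" "v \<in> V" "\<not> (u \<in> K \<and> v \<in> K)" for u v
  proof -
    consider "u \<in> L" "v \<in> L" | "u \<in> L" "v \<in> K" | "u \<in> L" "v \<in> R" | "u \<in> K" "v \<in> L" | "u \<in> K" "v \<in> R"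
      | "u \<in> R" "v \<in> L" | "u \<in> R" "v \<in> K" | "u \<in> R" "v \<in> R"
      using uv VLKR by blast
    then show ?thesis
    proof cases
      case 1 then show ?thesis using l(2) levL(1) by simp
    next
      case 2 then show ?thesis using levL(2)[OF 2(1)] levK[OF 2(2)] unfolding L_def by auto
    next
      case 3 then show ?thesis using levL(2)[OF 3(1)] levR(2)[OF 3(2)] LtoR by fastforce
    next
      case 4 then show ?thesis using levL(2)[OF 4(2)] levK[OF 4(1)] unfolding L_def by auto
    next
      case 5 then show ?thesis using levR(2)[OF 5(2)] levK[OF 5(1)] unfolding R_def by auto
    next
      case 6 then show ?thesis using levL(2)[OF 6(2)] levR(2)[OF 6(1)] LtoR by fastforce
    next
      case 7 then show ?thesis using levR(2)[OF 7(1)] levK[OF 7(2)] unfolding R_def by auto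
    next
      case 8 then show ?thesis using r(2) levR(1) by simp linarith
    qed
  qed
  have "level (h u) \<noteq> 0" if "u \<in> V - K" for u
    using LR[OF that] levL(2)[of u] levR(2)[of u] by auto
  then show ?thesis using bij hK edge by blast
qed

section \<open>The classification\<close>

lemma semicomplete_semic: "semicomplete G \<Longrightarrow> semic (universe G) (edges G)"
  unfolding semicomplete_def semic_def edges_def by blast

text \<open>
  Semicomplete digraphs are cores: \<open>v \<mapsto> f(v, \<dots>, v)\<close> is an automorphism. Composing \<open>f\<close>
  with its inverse makes the polymorphism \<open>f\<close> idempotent.
\<close>

definition idem :: "'a set \<Rightarrow> nat \<Rightarrow> ('a list \<Rightarrow> 'a) \<Rightarrow> (nat \<Rightarrow> 'a) \<Rightarrow> 'a" where
  "idem V k f x = inv_into V (\<lambda>v. f (replicate k v)) (f (map x [0..<k]))"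

text \<open>Distinct vertices are joined by an edge, so identifying them would create a loop, and
  the diagonal is injective. By finiteness it permutes the vertices and also the edges, so it
  reflects edges.\<close>

lemma diagonal_automorphism:
  assumes "finite V" "semic V E" "E \<subseteq> V \<times> V" and f: "polymorphism V E k f"
  defines "\<alpha> \<equiv> \<lambda>v. f (replicate k v)"
  shows "bij_betw \<alpha> V V" "(\<alpha> u, \<alpha> v) \<in> E \<Longrightarrow> u \<in> V \<Longrightarrow> v \<in> V \<Longrightarrow> (u, v) \<in> E"
proof -
  have V: "\<alpha> v \<in> V" if "v \<in> V" for v
    using f that unfolding polymorphism_def \<alpha>_def by (simp add: set_replicate_conv_if)
  have E: "(\<alpha> u, \<alpha> v) \<in> E" if "(u, v) \<in> E" for u v
    using f that unfolding polymorphism_def \<alpha>_def by simp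
  have inj: "inj_on \<alpha> V"
  proof (rule inj_onI, rule ccontr)
    fix u v assume uv: "u \<in> V" "v \<in> V" "\<alpha> u = \<alpha> v" "u \<noteq> v"
    then have "(u, v) \<in> E \<or> (v, u) \<in> E" using assms(2) unfolding semic_def by blast
    then have "(\<alpha> v, \<alpha> v) \<in> E" using E[of u v] E[of v u] uv(3) by auto
    then show False using assms(2) V[OF uv(2)] unfolding semic_def by blast
  qed
  show bij: "bij_betw \<alpha> V V"
    using inj V assms(1) by (simp add: bij_betw_def endo_inj_surj image_subsetI)
  have "inj_on (map_prod \<alpha> \<alpha>) E"
    using map_prod_inj_on[OF inj inj] assms(3) by (rule inj_on_subset)
  moreover have "map_prod \<alpha> \<alpha> ` E \<subseteq> E" using E by auto
  moreover have "finite E" using assms(1,3) finite_subset by blast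
  ultimately have surj: "map_prod \<alpha> \<alpha> ` E = E" by (simp add: endo_inj_surj)
  assume uv: "(\<alpha> u, \<alpha> v) \<in> E" "u \<in> V" "v \<in> V"
  from uv(1) have "(\<alpha> u, \<alpha> v) \<in> map_prod \<alpha> \<alpha> ` E" unfolding surj .
  then obtain u' v' where e: "(u', v') \<in> E" and "\<alpha> u' = \<alpha> u" "\<alpha> v' = \<alpha> v" by auto
  moreover have "u' \<in> V" "v' \<in> V" using e assms(3) by auto
  ultimately have "u' = u" "v' = v" using inj uv by (auto dest: inj_onD)
  then show "(u, v) \<in> E" using e by simp
qed

text \<open>A minor has the same diagonal as the original operation, so the same inverse corrects
  both.\<close>

lemma idem_minor:
  assumes f: "polymorphism V E k f" and g: "minor_of V k \<pi> l f g" and x: "\<And>i. x i \<in> V"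
  shows "idem V l g x = idem V k f (x \<circ> \<pi>)"
proof -
  have "g (replicate l v) = f (replicate k v)" if "v \<in> V" for v
  proof -
    have "map (\<lambda>j. replicate l v ! \<pi> j) [0..<k] = replicate k v"
      using g unfolding minor_of_def by (intro nth_equalityI) auto
    moreover have "g (replicate l v) = f (map (\<lambda>j. replicate l v ! \<pi> j) [0..<k])"
      using g that unfolding minor_of_def by (simp add: set_replicate_conv_if)
    ultimately show ?thesis by simp
  qed
  then have "inv_into V (\<lambda>v. g (replicate l v)) y = inv_into V (\<lambda>v. f (replicate k v)) y" for y
    unfolding inv_into_def by (metis (no_types, lifting))
  moreover have "g (map x [0..<l]) = f (map (x \<circ> \<pi>) [0..<k])"
  proof -
    have eq: "map (\<lambda>j. map x [0..<l] ! \<pi> j) [0..<k] = map (x \<circ> \<pi>) [0..<k]"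
      using g unfolding minor_of_def by (intro nth_equalityI) auto
    have "g (map x [0..<l]) = f (map (\<lambda>j. map x [0..<l] ! \<pi> j) [0..<k])"
      using g x unfolding minor_of_def by (auto simp: image_subset_iff)
    then show ?thesis unfolding eq .
  qed
  ultimately show ?thesis unfolding idem_def by simp
qed

lemma branching_core_pp_constructs:
  fixes A :: "'a dgraph" and B :: "'b dgraph"
  assumes A: "is_digraph A" "finite (universe A)" "semicomplete A"
    and br: "branching (core (universe A) (edges A)) (edges A)"
    and B: "is_digraph B" "finite (universe B)" "edges B \<noteq> {}"
  shows "pp_constructs A B"
proof -
  let ?V = "universe A" and ?E = "edges A"
  define F where "F = {idem ?V k f | k f. polymorphism ?V ?E k f}"
  have sem: "semic ?V ?E" using A(3) by (rule semicomplete_semic)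
  have EV: "?E \<subseteq> ?V \<times> ?V" using edges_subset[OF A(1)] .
  have mapV: "set (map x [0..<k]) \<subseteq> ?V" if "\<And>i. x i \<in> ?V" for x :: "nat \<Rightarrow> 'a" and k
    using that by auto
  have aut: "bij_betw (\<lambda>v. f (replicate k v)) ?V ?V" if "polymorphism ?V ?E k f" for k f
    using diagonal_automorphism(1)[OF A(2) sem EV that] .
  have V: "idem ?V k f x \<in> ?V" if f: "polymorphism ?V ?E k f" and x: "\<And>i. x i \<in> ?V" for k f x
  proof -
    have "f (map x [0..<k]) \<in> ?V" using f mapV[of x, OF x] unfolding polymorphism_def by simp
    then show ?thesis unfolding idem_def using aut[OF f]
      by (metis bij_betw_imp_surj_on inv_into_into)
  qed
  have inv: "f (replicate k (idem ?V k f x)) = f (map x [0..<k])"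
    if f: "polymorphism ?V ?E k f" and x: "\<And>i. x i \<in> ?V" for k f x
  proof -
    have "f (map x [0..<k]) \<in> ?V" using f mapV[of x, OF x] unfolding polymorphism_def by simp
    then show ?thesis unfolding idem_def using aut[OF f]
      by (metis bij_betw_imp_surj_on f_inv_into_f)
  qed
  have fin: "\<exists>m. \<forall>x y. (\<forall>i<m. x i = y i) \<longrightarrow> h x = h y" if "h \<in> F" for h
  proof -
    obtain k f where h: "h = idem ?V k f" using \<open>h \<in> F\<close> unfolding F_def by blast
    have "h x = h y" if "\<forall>i<k. x i = y i" for x y
    proof -
      have eq: "map x [0..<k] = map y [0..<k]" using that by simp
      show ?thesis unfolding h idem_def eq ..
    qed
    then show ?thesis by blast
  qed
  have iV: "invar F ?V" unfolding invar_def F_def using V by blast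
  have iE: "invar2 F ?E"
    unfolding invar2_def
  proof (intro ballI allI impI)
    fix h and x y :: "nat \<Rightarrow> 'a" assume "h \<in> F" and xy: "\<forall>i. (x i, y i) \<in> ?E"
    then obtain k f where h: "h = idem ?V k f" and f: "polymorphism ?V ?E k f" unfolding F_def by blast
    have xyV: "x i \<in> ?V" "y i \<in> ?V" for i using xy EV by blast+
    have vals: "h x \<in> ?V" "h y \<in> ?V" unfolding h by (rule V[OF f], rule xyV)+
    have hx: "f (replicate k (h x)) = f (map x [0..<k])" unfolding h by (rule inv[OF f xyV(1)])
    have hy: "f (replicate k (h y)) = f (map y [0..<k])" unfolding h by (rule inv[OF f xyV(2)])
    have "(f (map x [0..<k]), f (map y [0..<k])) \<in> ?E"
      using f xy unfolding polymorphism_def by simp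
    then show "(h x, h y) \<in> ?E"
      unfolding hx[symmetric] hy[symmetric] by (rule diagonal_automorphism(2)[OF A(2) sem EV f _ vals])
  qed
  have sing: "invar F {v}" if v: "v \<in> ?V" for v
    unfolding invar_def
  proof (intro ballI allI impI)
    fix h and x :: "nat \<Rightarrow> 'a" assume "h \<in> F" and x: "\<forall>i. x i \<in> {v}"
    then obtain k f where h: "h = idem ?V k f" and f: "polymorphism ?V ?E k f" unfolding F_def by blast
    have "map x [0..<k] = replicate k v" using x by (intro nth_equalityI) auto
    then have "h x = v" unfolding h idem_def using aut[OF f] v
      by (simp add: bij_betw_def inv_into_f_f[of "\<lambda>v. f (replicate k v)"])
    then show "h x \<in> {v}" by simp
  qed
  have "hard (core ?V ?E) ?E"
    unfolding hard_def
    using br smooth_core semic_subset[OF sem core_subset] finite_subset[OF core_subset A(2)] by blast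
  then have "projective F (core ?V ?E)"
    using core_subset[of ?V ?E] by (intro hard_projective[OF fin _ invar_core[OF iE iV] iE] sing) auto
  then obtain p q where pq: "p \<in> ?V" "q \<in> ?V" "p \<noteq> q"
    and proj: "\<And>h. h \<in> F \<Longrightarrow> \<exists>i. \<forall>S. h (\<lambda>j. if j \<in> S then p else q) = (if i \<in> S then p else q)"
    using core_subset[of ?V ?E] unfolding projective_def by blast
  define \<xi> where "\<xi> k f = (SOME i. \<forall>S. idem ?V k f (\<lambda>j. if j \<in> S then p else q) = (if i \<in> S then p else q))" for k f
  have \<xi>: "idem ?V k f (\<lambda>j. if j \<in> S then p else q) = (if \<xi> k f \<in> S then p else q)"
    if f: "polymorphism ?V ?E k f" for k f S
  proof -
    have "\<exists>i. \<forall>S. idem ?V k f (\<lambda>j. if j \<in> S then p else q) = (if i \<in> S then p else q)"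
      using f unfolding F_def by (intro proj) (auto simp: F_def)
    then show ?thesis unfolding \<xi>_def by (rule someI_ex[THEN spec])
  qed
  have \<xi>_less: "\<xi> k f < k" if f: "polymorphism ?V ?E k f" for k f
  proof (rule ccontr)
    assume "\<not> \<xi> k f < k"
    \<comment> \<open>A coordinate from \<open>k\<close> on has no influence on the value, whereas
      the decisive one distinguishes these two tuples.\<close>
    then have eq: "map (\<lambda>j. if j \<in> {\<xi> k f} then p else q) [0..<k] = map (\<lambda>j. if j \<in> {} then p else q) [0..<k]"
      by auto
    have "idem ?V k f (\<lambda>j. if j \<in> {\<xi> k f} then p else q) = idem ?V k f (\<lambda>j. if j \<in> {} then p else q)"
      unfolding idem_def eq ..
    then show False unfolding \<xi>[OF f] using pq by simp
  qed
  show ?thesis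
  proof (rule pp_constructs_if_minor_map[where \<xi> = \<xi>, OF A(1,2) B])
    show "\<xi> k f < k" if "polymorphism ?V ?E k f" for k f by (rule \<xi>_less[OF that])
    show "\<xi> l g = \<pi> (\<xi> k f)"
      if f: "polymorphism ?V ?E k f" and "0 < k" and g: "minor_of ?V k \<pi> l f g" for k l \<pi> f g
    proof -
      have pg: "polymorphism ?V ?E l g" by (rule polymorphism_minor[OF f g EV])
      \<comment> \<open>This tuple is \<open>p\<close> in a single place. Reindexed by
        \<open>\<pi>\<close> it is \<open>p\<close> at the decisive coordinate of \<open>f\<close>,
        so the value is \<open>p\<close> and the decisive coordinate of \<open>g\<close> must be
        that place.\<close>
      let ?x = "\<lambda>j. if j \<in> {\<pi> (\<xi> k f)} then p else q"
      have "?x \<circ> \<pi> = (\<lambda>j. if j \<in> {j. \<pi> j = \<pi> (\<xi> k f)} then p else q)" by auto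
      moreover have "idem ?V l g ?x = idem ?V k f (?x \<circ> \<pi>)"
        by (rule idem_minor[OF f g]) (use pq in auto)
      ultimately have "idem ?V l g ?x = p" using \<xi>[OF f, of "{j. \<pi> j = \<pi> (\<xi> k f)}"] by simp
      then show ?thesis using \<xi>[OF pg, of "{\<pi> (\<xi> k f)}"] pq by (auto split: if_splits)
    qed
  qed
qed

lemma K3_properties:
  "is_digraph K3" "finite (universe K3)" "semicomplete K3" "edges K3 \<noteq> {}"
  "branching (core (universe K3) (edges K3)) (edges K3)"
proof -
  have E: "edges K3 = {(i, j). i < 3 \<and> j < 3 \<and> i \<noteq> j}" and V: "universe K3 = {..<3}"
    unfolding edges_def edge_def K3_def digraph_of_def by auto
  show "is_digraph K3" "finite (universe K3)"
    unfolding is_digraph_def is_struct_def K3_def digraph_of_def by (auto simp: lessThan_empty_iff)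
  show "semicomplete K3" unfolding semicomplete_def edge_def K3_def digraph_of_def by auto
  have e: "(0, 1) \<in> edges K3" "(1, 2) \<in> edges K3" "(2, 0) \<in> edges K3" "(0, 2) \<in> edges K3"
    unfolding E by auto
  then show "edges K3 \<noteq> {}" by blast
  have "{0, 1, 2} \<subseteq> core (universe K3) (edges K3)"
    by (rule smooth_le_core[OF _ smooth_triple[OF e(1-3)]]) (auto simp: V)
  then show "branching (core (universe K3) (edges K3)) (edges K3)"
    using e unfolding branching_def by (metis insert_subset numeral_eq_one_iff semiring_norm(85))
qed

theorem theorem5p11:
  fixes G :: "'a dgraph"
  assumes "is_digraph G" and "finite (universe G)" and "semicomplete G"
  shows "(\<exists>n\<ge>1. isomorphic G (transitive_tournament n)) \<or>
         (\<exists>n k. isomorphic G (C2 n k)) \<or>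
         (\<exists>n k. isomorphic G (C3 n k)) \<or>
         same_pp_class G K3"
proof -
  let ?V = "universe G" and ?E = "edges G"
  let ?K = "core ?V ?E"
  have sem: "semic ?V ?E" using assms(3) by (rule semicomplete_semic)
  have edge: "edge G u v \<longleftrightarrow> (u, v) \<in> ?E" for u v unfolding edges_def by simp
  have semK: "semic ?K ?E" by (rule semic_subset[OF sem core_subset])
  have irr: "(u, u) \<notin> ?E" if "u \<in> ?V" for u using sem that unfolding semic_def by blast
  consider "branching ?K ?E" | "?K = {}" | "\<not> branching ?K ?E" "?K \<noteq> {}" by blast
  then show ?thesis
  proof cases
    case 1
    then have "?E \<noteq> {}" unfolding branching_def by blast
    then have "same_pp_class G K3"
      unfolding same_pp_class_def
      using branching_core_pp_constructs[OF assms 1 K3_properties(1,2,4)]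
        branching_core_pp_constructs[OF K3_properties(1-3,5) assms(1,2)] by blast
    then show ?thesis by blast
  next
    case 2
    have "\<not> smooth K ?E" if "K \<subseteq> ?V" "K \<noteq> {}" for K
      using smooth_le_core[OF that(1)] 2 that(2) by blast
    then obtain h where h: "bij_betw h ?V {..<card ?V}"
      "\<And>u v. u \<in> ?V \<Longrightarrow> v \<in> ?V \<Longrightarrow> (u, v) \<in> ?E \<longleftrightarrow> h u < h v"
      using acyclic_ranking[OF assms(2) sem] by metis
    have "isomorphic G (transitive_tournament (card ?V))"
      unfolding transitive_tournament_def
    proof (rule isomorphic_digraph_of[OF assms(1) h(1)])
      fix u v assume uv: "u \<in> ?V" "v \<in> ?V"
      then have "h v < card ?V" using h(1) by (auto simp: bij_betw_def)
      then show "edge G u v \<longleftrightarrow> (h u, h v) \<in> {(i, j). i < j \<and> j < card ?V}"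
        unfolding edge using h(2) uv by simp
    qed
    moreover have "card ?V \<ge> 1"
      using assms(1,2) unfolding is_digraph_def is_struct_def by (simp add: Suc_le_eq card_gt_0_iff)
    ultimately show ?thesis by blast
  next
    case 3
    from semK smooth_core 3(2,1) show ?thesis
    proof (cases rule: smooth_nonbranching_cases)
      case (two a b)
      define g where "g x = (if x = a then VA else VB)" for x
      have g: "bij_betw g ?K {VA, VB}" unfolding two(1) using two(2) by (auto simp: bij_betw_def g_def)
      obtain h n k where h: "bij_betw h ?V (C_verts {VA, VB} n k)" "\<forall>x\<in>?K. h x = g x"
        "\<forall>u\<in>?V. \<forall>v\<in>?V. \<not> (u \<in> ?K \<and> v \<in> ?K) \<longrightarrow> (u, v) \<in> ?E \<longleftrightarrow> level (h u) < level (h v)"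
        "\<forall>u\<in>?V - ?K. level (h u) \<noteq> 0"
        using core_levels[OF assms(2) sem refl 3(2) g] by auto
      have hV: "h u \<in> C_verts {VA, VB} n k" if "u \<in> ?V" for u using h(1) that by (auto simp: bij_betw_def)
      have hab: "h a = VA" "h b = VB" using h(2) two by (auto simp: g_def)
      have abV: "a \<in> ?V" "b \<in> ?V" using core_subset[of ?V ?E] two(1) by auto
      have "isomorphic G (C2 n k)"
        unfolding C2_def
      proof (rule isomorphic_digraph_of[OF assms(1) h(1)])
        fix u v assume uv: "u \<in> ?V" "v \<in> ?V"
        show "edge G u v \<longleftrightarrow> (h u, h v) \<in> {(u, v). u \<in> C_verts {VA, VB} n k \<and> v \<in> C_verts {VA, VB} n k \<and>
            level u < level v} \<union> {(VA, VB), (VB, VA)}"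
        proof (cases "u \<in> ?K \<and> v \<in> ?K")
          case True
          then show ?thesis unfolding edge using two hab irr abV by auto
        next
          case False
          \<comment> \<open>Vertices off the cycle have nonzero level, so the additional edges of
            the cycle do not interfere.\<close>
          then have "level (h u) \<noteq> 0 \<or> level (h v) \<noteq> 0" using h(4) uv by blast
          then have "(h u, h v) \<notin> {(VA, VB), (VB, VA)}" by auto
          moreover have "(u, v) \<in> ?E \<longleftrightarrow> level (h u) < level (h v)" using h(3) uv False by blast
          ultimately show ?thesis unfolding edge using hV[OF uv(1)] hV[OF uv(2)] by auto
        qed
      qed
      then show ?thesis by blast
    next
      case (three a b c)
      define g where "g x = (if x = a then VA else if x = b then VB else VC)" for x
      have g: "bij_betw g ?K {VA, VB, VC}" unfolding three(1) using three(2-4) by (auto simp: bij_betw_def g_def)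
      obtain h n k where h: "bij_betw h ?V (C_verts {VA, VB, VC} n k)" "\<forall>x\<in>?K. h x = g x"
        "\<forall>u\<in>?V. \<forall>v\<in>?V. \<not> (u \<in> ?K \<and> v \<in> ?K) \<longrightarrow> (u, v) \<in> ?E \<longleftrightarrow> level (h u) < level (h v)"
        "\<forall>u\<in>?V - ?K. level (h u) \<noteq> 0"
        using core_levels[OF assms(2) sem refl 3(2) g] by auto
      have hV: "h u \<in> C_verts {VA, VB, VC} n k" if "u \<in> ?V" for u using h(1) that by (auto simp: bij_betw_def)
      have habc: "h a = VA" "h b = VB" "h c = VC" using h(2) three by (auto simp: g_def)
      have abcV: "a \<in> ?V" "b \<in> ?V" "c \<in> ?V" using core_subset[of ?V ?E] three(1) by auto
      have "isomorphic G (C3 n k)"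
        unfolding C3_def
      proof (rule isomorphic_digraph_of[OF assms(1) h(1)])
        fix u v assume uv: "u \<in> ?V" "v \<in> ?V"
        show "edge G u v \<longleftrightarrow> (h u, h v) \<in> {(u, v). u \<in> C_verts {VA, VB, VC} n k \<and> v \<in> C_verts {VA, VB, VC} n k \<and>
            level u < level v} \<union> {(VA, VB), (VB, VC), (VC, VA)}"
        proof (cases "u \<in> ?K \<and> v \<in> ?K")
          case True
          then show ?thesis unfolding edge using three habc irr abcV by auto
        next
          case False
          then have "level (h u) \<noteq> 0 \<or> level (h v) \<noteq> 0" using h(4) uv by blast
          then have "(h u, h v) \<notin> {(VA, VB), (VB, VC), (VC, VA)}" by auto
          moreover have "(u, v) \<in> ?E \<longleftrightarrow> level (h u) < level (h v)" using h(3) uv False by blast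
          ultimately show ?thesis unfolding edge using hV[OF uv(1)] hV[OF uv(2)] by auto
        qed
      qed
      then show ?thesis by blast
    qed
  qed
qed

end
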